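(* Let $g:\mathcal X\times\mathbb R\times\mathbb R^d\to\mathbb R^d$ be a score function and for each $a\in\mathcal A$ let $\theta_a^*\in\mathbb R^d$ satisfy $\mathbb E[g(X,Y(a);\theta_a^* )]=0$. Assume (1) (unconfoundedness) $A_t\perp\{Y_t(a')\}_{a'\in\mathcal A}\mid(\mathcal H_{t-1},X_t)$ for all $t$, and that, with constants $R_\theta,M_2$, the following hold for every $a\in\mathcal A$: (2) For all $\epsilon>0$, $\inf_{\|\theta-\theta_a^*\|_2>\epsilon}\|\mathbb E[g(X_t,Y_t(a);\theta)]\|_2>0$. (3) (i) $\|\mathbb E[g(X_t,Y_t(a);\theta_a^* )g(X_t,Y_t(a);\theta_a^* )^\top\mid X_t]\|_2\le M_2$ for a.e. $X_t$; (ii) $\|\theta_a^*\|_2<R_\theta$ and $\sup_{\|\theta\|_2\le R_\theta}\mathbb E[\|g(X_t,Y_t(a);\theta)\|_2^2]<\infty$; (iii) $\mathbb E[\|g(X_t,Y_t(a);\theta_a^* )\|_2^4]<\infty$. (4) (i) $g(x,y;\theta)$ is twice differentiable in $\theta$, and $\mathbb E[\nabla g(X_t,Y_t(a);\theta_a^* )]$ is nonsingular; (ii) there is a function $\phi$ (possibly depending on $a$) with $\sup_{\|\theta\|_2\le R_\theta}\|\nabla g(x,y;\theta)\|_2\le\phi(x,y)$ for all $x,y$ and $\mathbb E[\phi(X_t,Y_t(a))^2]<\infty$; (iii) there are $\epsilon_0>0$ and a function $\Phi$ (possibly depending on $a$) with $\sup_{\|\theta-\theta_a^*\|_2\le\epsilon_0,\,i\in[d]}\|\nabla^2g^{(i)}(x,y;\theta)\|_2\le\Phi(x,y)$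 and $\mathbb E[\Phi(X_t,Y_t(a))]<\infty$, where $g^{(i)}$ is the $i$-th entry of $g$. (5) $\pi_t(a)\ge\pi_{\min}$ almost surely for some constant $\pi_{\min}\in(0,1)$. Suppose the behavior policy converges, i.e. there is a stationary policy $\bar\pi:\mathcal X\to\Delta(\mathcal A)$ with $\pi_t(a\mid X_t,\mathcal H_{t-1})-\bar\pi(a\mid X_t)\xrightarrow{p}0$ as $t\to\infty$ for every $a\in\mathcal A$. Then there exist estimators $\{\hat\theta_a^{(T)}\}_{a\in\mathcal A,T\ge1}$ such that, for each $a\in\mathcal A$, $$\frac1T\sum_{t=1}^T\frac{1_{\{A_t=a\}}}{\pi_t(A_t)}g(X_t,Y_t;\hat\theta_a^{(T)})=o_p(1/\sqrt T),$$ and $\|\hat\theta_a^{(T)}\|_2\le R_\theta$ for all $a\in\mathcal A$, $T\ge1$. In addition, any such estimators satisfy, as $T\to\infty$, $$\sqrt T(\hat\theta^{(T)}-\theta^* )\xrightarrow{d}\mathcal N(0,\Sigma^* ),$$ where $\hat\theta^{(T)}=((\hat\theta_1^{(T)})^\top,\dots,(\hat\theta_K^{(T)})^\top)^\top$, $\theta^*=(\theta_1^{*\top},\dots,\theta_K^{*\top})^\top$, $\Sigma^*=\mathrm{diag}(\Sigma_1^*,\dots,\Sigma_K^* )$ (block diagonal), $\Sigma_a^*=J_a^{-1}\bar I_a(J_a^{-1})^\top$, $\bar I_a=\mathbb E\big[\frac1{\bar\pi(a\mid X_t)}g(X_t,Y_t(a);\theta_a^* )g(X_t,Y_t(a);\theta_a^*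 )^\top\big]$ and $J_a=\mathbb E[\nabla g(X_t,Y_t(a);\theta_a^* )]$.
   Context: Contextual bandit setting. Contexts $X_t\in\mathcal X\subseteq\mathbb R^{d_X}$, finite action set $\mathcal A=\{1,\dots,K\}$, potential outcomes $Y_t(a)\in\mathbb R$; the tuples $(X_t,\{Y_t(a)\}_{a\in\mathcal A})$, $t\ge1$, are i.i.d., with generic copy $(X,\{Y(a)\})$. At time $t$, given the history $\mathcal H_{t-1}=\{X_\tau,\pi_\tau,A_\tau,Y_\tau\}_{\tau<t}$ and $X_t$, the action $A_t$ is drawn from the behavior policy $\pi_t(\cdot\mid X_t,\mathcal H_{t-1})\in\Delta(\mathcal A)$ (probability distributions on $\mathcal A$), and the outcome $Y_t=Y_t(A_t)$ is observed. The tuple $(X_t,\{Y_t(a)\}_a)$ is independent of $\mathcal H_{t-1}$. We abbreviate $\pi_t(a)=\pi_t(a\mid X_t,\mathcal H_{t-1})$. $\nabla g$ denotes the Jacobian of $g$ in $\theta$, $\nabla^2 g^{(i)}$ the Hessian in $\theta$; $\|\cdot\|_2$ is the Euclidean norm of vectors and the spectral norm of matrices. *)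

theory Defs
  imports "HOL-Probability.Probability"
begin

definition outer :: "real^'n \<Rightarrow> real^'n^'n" where
  "outer v = (\<chi> i j. v $ i * v $ j)"

definition spectral_norm :: "real^'n^'m \<Rightarrow> real" where
  "spectral_norm B = onorm ((*v) B)"

definition gradient :: "(real^'n \<Rightarrow> real) \<Rightarrow> real^'n \<Rightarrow> real^'n" where
  "gradient h x = (\<chi> j. frechet_derivative h (at x) (axis j 1))"

definition hessian :: "(real^'n \<Rightarrow> real) \<Rightarrow> real^'n \<Rightarrow> real^'n^'n" where
  "hessian h x = jacobian (gradient h) (at x)"

definition twice_differentiable :: "(real^'n \<Rightarrow> real^'m) \<Rightarrow> bool" where
  "twice_differentiable f \<longleftrightarrow>
     (\<forall>x. f differentiable (at x)) \<and> (\<forall>x. (\<lambda>z. jacobian f (at z)) differentiable (at x))"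

text \<open>Vectors and matrices of size \<open>K d\<close> are indexed by pairs (block, entry within the block).\<close>

definition stack :: "('k::finite \<Rightarrow> real^'d) \<Rightarrow> real^('k \<times> 'd)" where
  "stack v = (\<chi> p. v (fst p) $ snd p)"

definition block_diag :: "('k::finite \<Rightarrow> real^'d^'d) \<Rightarrow> real^('k \<times> 'd)^('k \<times> 'd)" where
  "block_diag S = (\<chi> p q. if fst p = fst q then S (fst p) $ snd p $ snd q else 0)"

definition prob_simplex :: "(real^'k) set" where
  "prob_simplex = {p. (\<forall>a. 0 \<le> p $ a) \<and> (\<Sum>a\<in>UNIV. p $ a) = 1}"

definition cond_exp_matrix ::
    "'w measure \<Rightarrow> 'w measure \<Rightarrow> ('w \<Rightarrow> real^'n^'m) \<Rightarrow> 'w \<Rightarrow> real^'n^'m" where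
  "cond_exp_matrix M F V \<omega> = (\<chi> i j. real_cond_exp M F (\<lambda>\<omega>'. V \<omega>' $ i $ j) \<omega>)"

definition cond_indep_var ::
    "'w measure \<Rightarrow> 'w measure \<Rightarrow> 's measure \<Rightarrow> ('w \<Rightarrow> 's) \<Rightarrow> 't measure \<Rightarrow> ('w \<Rightarrow> 't) \<Rightarrow> bool" where
  "cond_indep_var M F S U T V \<longleftrightarrow>
     (\<forall>B\<in>sets S. \<forall>C\<in>sets T. AE \<omega> in M.
        real_cond_exp M F (indicator (U -` B \<inter> V -` C \<inter> space M)) \<omega> =
        real_cond_exp M F (indicator (U -` B \<inter> space M)) \<omega> *
        real_cond_exp M F (indicator (V -` C \<inter> space M)) \<omega>)"

definition tends_to_zero_in_prob ::
    "'w measure \<Rightarrow> (nat \<Rightarrow> 'w \<Rightarrow> 'b::real_normed_vector) \<Rightarrow> bool" where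
  "tends_to_zero_in_prob M Z \<longleftrightarrow>
     (\<forall>\<epsilon>>0. (\<lambda>n. measure M {\<omega> \<in> space M. norm (Z n \<omega>) > \<epsilon>}) \<longlonglongrightarrow> 0)"

definition small_o_p ::
    "'w measure \<Rightarrow> (nat \<Rightarrow> 'w \<Rightarrow> 'b::real_normed_vector) \<Rightarrow> (nat \<Rightarrow> real) \<Rightarrow> bool" where
  "small_o_p M Z r \<longleftrightarrow> tends_to_zero_in_prob M (\<lambda>n \<omega>. Z n \<omega> /\<^sub>R r n)"

definition converges_in_distribution ::
    "'w measure \<Rightarrow> (nat \<Rightarrow> 'w \<Rightarrow> 'b::topological_space) \<Rightarrow> 'b measure \<Rightarrow> bool" where
  "converges_in_distribution M Z N \<longleftrightarrow>
     (\<forall>f :: 'b \<Rightarrow> real. continuous_on UNIV f \<longrightarrow> bounded (range f) \<longrightarrow>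
        (\<lambda>n. LINT \<omega>|M. f (Z n \<omega>)) \<longlonglongrightarrow> (LINT x|N. f x))"

definition std_normal_vector :: "(real^'n) measure" where
  "std_normal_vector =
     distr (\<Pi>\<^sub>M i\<in>(UNIV :: 'n set). density lborel std_normal_density) borel (\<lambda>z. \<chi> i. z i)"

text \<open>\<open>N\<close> is the law \<open>\<N>(\<mu>, \<Sigma>)\<close> of \<open>\<mu> + B Z\<close> with \<open>B B\<^sup>T = \<Sigma>\<close> and \<open>Z\<close> standard normal; it does not
  depend on the choice of \<open>B\<close>. \<open>\<Sigma>\<close> may be singular.\<close>

definition multivariate_normal :: "real^'n \<Rightarrow> real^'n^'n \<Rightarrow> (real^'n) measure \<Rightarrow> bool" where
  "multivariate_normal \<mu> \<Sigma> N \<longleftrightarrow>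
     (\<exists>B :: real^'n^'n. B ** transpose B = \<Sigma> \<and> N = distr std_normal_vector borel (\<lambda>z. \<mu> + B *v z))"

text \<open>The actions are the elements of the finite type \<open>'k\<close>. Time starts at \<open>1\<close>.
  \<open>X t\<close> is the context, \<open>P t $ a\<close> the potential outcome of action \<open>a\<close>,
  \<open>\<pi> t $ a\<close> the realized probability \<open>\<pi>\<^sub>t(a | X\<^sub>t, H\<^sub>t\<^sub>-\<^sub>1)\<close>, \<open>A t\<close> the action and \<open>Y t\<close> the
  observed outcome. \<open>history X \<pi> A Y t\<close> is the random element \<open>H\<^sub>t\<close>, consisting of the
  observations at the times \<open>1, \<dots>, t\<close>.\<close>

definition history ::
    "(nat \<Rightarrow> 'w \<Rightarrow> real^'p) \<Rightarrow> (nat \<Rightarrow> 'w \<Rightarrow> real^'k) \<Rightarrow> (nat \<Rightarrow> 'w \<Rightarrow> 'k) \<Rightarrow> (nat \<Rightarrow> 'w \<Rightarrow> real) \<Rightarrow>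
     nat \<Rightarrow> 'w \<Rightarrow> nat \<Rightarrow> (real^'p) \<times> (real^'k) \<times> 'k \<times> real" where
  "history X \<pi> A Y t \<omega> = (\<lambda>\<tau>\<in>{1..t}. (X \<tau> \<omega>, \<pi> \<tau> \<omega>, A \<tau> \<omega>, Y \<tau> \<omega>))"

definition history_space ::
    "nat \<Rightarrow> (nat \<Rightarrow> (real^'p) \<times> (real^'k) \<times> 'k \<times> real) measure" where
  "history_space t =
     (\<Pi>\<^sub>M \<tau>\<in>{1..t}. borel \<Otimes>\<^sub>M borel \<Otimes>\<^sub>M count_space UNIV \<Otimes>\<^sub>M borel)"

definition history_algebra ::
    "'w measure \<Rightarrow> (nat \<Rightarrow> 'w \<Rightarrow> real^'p) \<Rightarrow> (nat \<Rightarrow> 'w \<Rightarrow> real^'k) \<Rightarrow> (nat \<Rightarrow> 'w \<Rightarrow> 'k) \<Rightarrow>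
     (nat \<Rightarrow> 'w \<Rightarrow> real) \<Rightarrow> nat \<Rightarrow> 'w measure" where
  "history_algebra M X \<pi> A Y t = vimage_algebra (space M) (history X \<pi> A Y t) (history_space t)"

text \<open>The \<open>\<sigma>\<close>-algebra generated by \<open>(H\<^sub>t\<^sub>-\<^sub>1, X\<^sub>t)\<close>, for \<open>t \<ge> 1\<close>.\<close>

definition decision_algebra ::
    "'w measure \<Rightarrow> (nat \<Rightarrow> 'w \<Rightarrow> real^'p) \<Rightarrow> (nat \<Rightarrow> 'w \<Rightarrow> real^'k) \<Rightarrow> (nat \<Rightarrow> 'w \<Rightarrow> 'k) \<Rightarrow>
     (nat \<Rightarrow> 'w \<Rightarrow> real) \<Rightarrow> nat \<Rightarrow> 'w measure" where
  "decision_algebra M X \<pi> A Y t =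
     vimage_algebra (space M) (\<lambda>\<omega>. (history X \<pi> A Y (t - 1) \<omega>, X t \<omega>))
       (history_space (t - 1) \<Otimes>\<^sub>M borel)"

text \<open>\<open>D\<close> is the law of the generic copy of the tuple (context, vector of potential outcomes).
  For an arbitrary set of contexts \<open>\<X>\<close>, \<open>restrict_space borel \<X>\<close> is the trace of the Borel
  \<open>\<sigma>\<close>-algebra on \<open>\<X>\<close>; measurability into it includes \<open>X t \<omega> \<in> \<X>\<close>.\<close>

locale contextual_bandit = prob_space M
  for M :: "'w measure" +
  fixes \<X> :: "(real^'p) set"
    and D :: "((real^'p) \<times> (real^'k)) measure"
    and X :: "nat \<Rightarrow> 'w \<Rightarrow> real^'p"
    and P :: "nat \<Rightarrow> 'w \<Rightarrow> real^'k"
    and \<pi> :: "nat \<Rightarrow> 'w \<Rightarrow> real^'k"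
    and A :: "nat \<Rightarrow> 'w \<Rightarrow> 'k"
    and Y :: "nat \<Rightarrow> 'w \<Rightarrow> real"
  assumes context_measurable: "\<And>t. t \<ge> 1 \<Longrightarrow> X t \<in> measurable M (restrict_space borel \<X>)"
    and potential_outcomes_measurable: "\<And>t. t \<ge> 1 \<Longrightarrow> P t \<in> borel_measurable M"
    and action_measurable: "\<And>t. t \<ge> 1 \<Longrightarrow> A t \<in> measurable M (count_space UNIV)"
    and tuples_independent:
      "indep_vars (\<lambda>_. restrict_space borel \<X> \<Otimes>\<^sub>M borel) (\<lambda>t \<omega>. (X t \<omega>, P t \<omega>)) {1..}"
    and tuples_identically_distributed:
      "\<And>t. t \<ge> 1 \<Longrightarrow>
         distr M (restrict_space borel \<X> \<Otimes>\<^sub>M borel) (\<lambda>\<omega>. (X t \<omega>, P t \<omega>)) = D"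
    and tuple_independent_of_history:
      "\<And>t. t \<ge> 1 \<Longrightarrow>
         indep_set
           (sets (vimage_algebra (space M) (\<lambda>\<omega>. (X t \<omega>, P t \<omega>)) (restrict_space borel \<X> \<Otimes>\<^sub>M borel)))
           (sets (history_algebra M X \<pi> A Y (t - 1)))"
    and policy_measurable:
      "\<And>t. t \<ge> 1 \<Longrightarrow> \<pi> t \<in> borel_measurable (decision_algebra M X \<pi> A Y t)"
    and policy_simplex: "\<And>t \<omega>. t \<ge> 1 \<Longrightarrow> \<omega> \<in> space M \<Longrightarrow> \<pi> t \<omega> \<in> prob_simplex"
    and action_drawn_from_policy:
      "\<And>t a. t \<ge> 1 \<Longrightarrow> AE \<omega> in M.
         real_cond_exp M (decision_algebra M X \<pi> A Y t) (indicator {\<omega> \<in> space M. A t \<omega> = a}) \<omega>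
           = \<pi> t \<omega> $ a"
    and observed_outcome: "\<And>t \<omega>. t \<ge> 1 \<Longrightarrow> \<omega> \<in> space M \<Longrightarrow> Y t \<omega> = P t \<omega> $ A t \<omega>"

definition ipw_score ::
    "(real^'p \<Rightarrow> real \<Rightarrow> real^'d \<Rightarrow> real^'d) \<Rightarrow> (nat \<Rightarrow> 'w \<Rightarrow> real^'p) \<Rightarrow> (nat \<Rightarrow> 'w \<Rightarrow> real^'k) \<Rightarrow>
     (nat \<Rightarrow> 'w \<Rightarrow> 'k) \<Rightarrow> (nat \<Rightarrow> 'w \<Rightarrow> real) \<Rightarrow> 'k \<Rightarrow> nat \<Rightarrow> real^'d \<Rightarrow> 'w \<Rightarrow> real^'d" where
  "ipw_score g X \<pi> A Y a T \<theta> \<omega> =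
     (1 / real T) *\<^sub>R (\<Sum>t=1..T. ((if A t \<omega> = a then 1 else 0) / \<pi> t \<omega> $ A t \<omega>) *\<^sub>R g (X t \<omega>) (Y t \<omega>) \<theta>)"

text \<open>An estimator at time \<open>T\<close> is a (measurable) function of the data \<open>H\<^sub>T\<close>.\<close>

definition ipw_estimators ::
    "'w measure \<Rightarrow> (real^'p \<Rightarrow> real \<Rightarrow> real^'d \<Rightarrow> real^'d) \<Rightarrow> real \<Rightarrow> (nat \<Rightarrow> 'w \<Rightarrow> real^'p) \<Rightarrow>
     (nat \<Rightarrow> 'w \<Rightarrow> real^'k) \<Rightarrow> (nat \<Rightarrow> 'w \<Rightarrow> 'k) \<Rightarrow> (nat \<Rightarrow> 'w \<Rightarrow> real) \<Rightarrow>
     ('k \<Rightarrow> nat \<Rightarrow> 'w \<Rightarrow> real^'d) \<Rightarrow> bool" where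
  "ipw_estimators M g R X \<pi> A Y \<theta>h \<longleftrightarrow>
     (\<forall>a. \<forall>T\<ge>1. \<theta>h a T \<in> borel_measurable (history_algebra M X \<pi> A Y T)) \<and>
     (\<forall>a. small_o_p M (\<lambda>T \<omega>. ipw_score g X \<pi> A Y a T (\<theta>h a T \<omega>) \<omega>) (\<lambda>T. 1 / sqrt (real T))) \<and>
     (\<forall>a. \<forall>T\<ge>1. \<forall>\<omega>\<in>space M. norm (\<theta>h a T \<omega>) \<le> R)"

definition score_jacobian_mean ::
    "((real^'p) \<times> (real^'k)) measure \<Rightarrow> (real^'p \<Rightarrow> real \<Rightarrow> real^'d \<Rightarrow> real^'d) \<Rightarrow>
     ('k \<Rightarrow> real^'d) \<Rightarrow> 'k \<Rightarrow> real^'d^'d" where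
  "score_jacobian_mean D g \<theta>s a = (LINT (x, y)|D. jacobian (g x (y $ a)) (at (\<theta>s a)))"

definition weighted_score_covariance ::
    "((real^'p) \<times> (real^'k)) measure \<Rightarrow> (real^'p \<Rightarrow> real \<Rightarrow> real^'d \<Rightarrow> real^'d) \<Rightarrow>
     ('k \<Rightarrow> real^'d) \<Rightarrow> (real^'p \<Rightarrow> real^'k) \<Rightarrow> 'k \<Rightarrow> real^'d^'d" where
  "weighted_score_covariance D g \<theta>s \<pi>bar a =
     (LINT (x, y)|D. (1 / \<pi>bar x $ a) *\<^sub>R outer (g x (y $ a) (\<theta>s a)))"

definition asymptotic_covariance ::
    "((real^'p) \<times> (real^'k)) measure \<Rightarrow> (real^'p \<Rightarrow> real \<Rightarrow> real^'d \<Rightarrow> real^'d) \<Rightarrow>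
     ('k \<Rightarrow> real^'d) \<Rightarrow> (real^'p \<Rightarrow> real^'k) \<Rightarrow> 'k \<Rightarrow> real^'d^'d" where
  "asymptotic_covariance D g \<theta>s \<pi>bar a =
     matrix_inv (score_jacobian_mean D g \<theta>s a) ** weighted_score_covariance D g \<theta>s \<pi>bar a **
     transpose (matrix_inv (score_jacobian_mean D g \<theta>s a))"

end

theory Submission
  imports Defs
begin

text \<open>At the true parameter, an inverse-probability-weighted summand of the score has conditional mean
  zero given the history, and its conditional variance converges in \<open>L\<^sup>1\<close> to a constant, because
  \<open>\<pi>\<^sub>t - \<pi>bar\<close> tends to zero in probability and the weights are bounded. As the limit variance is
  deterministic, \<open>E cos (S\<^sub>k / sqrt T + b)\<close> satisfies the recursion
  \<open>c\<^sub>k = (1 - v / (2 T)) c\<^sub>k\<^sub>-\<^sub>1 + error\<close> for every linear combination of the scores, with errors that sum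
  to \<open>o(1)\<close>; no stopping times are needed. Cosines suffice for weak convergence in several dimensions:
  a bounded continuous \<open>f\<close> is compared with \<open>x \<mapsto> f (L sin (x / L))\<close>, which is a uniform limit of
  trigonometric polynomials.

  The estimators are consistent by a uniform law of large numbers (finite nets and the envelope of
  the Jacobian). The envelope of the Hessian linearizes the score around the true parameter, so
  \<open>sqrt T (\<theta>h - \<theta>s) = - J\<^sup>-\<^sup>1 (sqrt T score (\<theta>s)) + o\<^sub>p(1)\<close>. Conversely, one Newton step from the true
  parameter solves the score equation up to \<open>o\<^sub>p(1 / sqrt T)\<close>.\<close>

section \<open>Gaussian vectors\<close>

text \<open>Past outcomes steer the policy, so the summands are neither independent nor identically
  distributed. One identity replaces independence: if \<open>W\<close> depends on the past and
  \<open>h\<close> on the current tuple, then E(\<open>W * ipw * h\<close>) = E(\<open>W\<close>)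
  E(\<open>h\<close>). The weight cancels against the policy by unconfoundedness, and the tuple is
  independent of the past. This gives the vanishing means and the orthogonality behind the laws of
  large numbers; in the variance only one of two weights cancels, which is where
  \<open>\<pi>bar\<close> comes in.

  The moment assumptions divide the labour. Second moments of score and Jacobian give laws of large
  numbers by Chebyshev. The Hessian envelope has a first moment only, so its weighted mean is merely
  bounded in probability; that suffices because it multiplies the squared error of the estimator.
  The fourth moment bounds the cubic Taylor remainder and controls the event where
  \<open>\<pi>\<close> is far from \<open>\<pi>bar\<close>. Linearization errors are kept relative
  to the distance from the true parameter and absorbed afterwards, so consistency needs no
  rate.\<close>

lemma psd_factor_support:
  fixes Q :: "real^'n^'n"
  assumes "finite S" and "\<And>i j. Q$i$j = Q$j$i" and "\<And>x. x \<bullet> (Q *v x) \<ge> 0"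
    and "\<And>i j. i \<notin> S \<Longrightarrow> Q$i$j = 0"
  shows "\<exists>B::real^'n^'n. (\<forall>i j. (\<Sum>k\<in>UNIV. B$i$k * B$j$k) = Q$i$j) \<and> (\<forall>i j. j \<notin> S \<longrightarrow> B$i$j = 0)"
  using assms
proof (induction S arbitrary: Q rule: finite_induct)
  case empty
  then show ?case by (intro exI[of _ 0]) auto
next
  case (insert s S)
  note sym = insert.prems(1) and psd = insert.prems(2) and supp = insert.prems(3)
  define e :: "real^'n" where "e = axis s 1"
  define c where "c = Q$s$s"
  have Qe: "(Q *v e) $ i = Q$i$s" for i
    by (simp add: e_def matrix_vector_mult_def axis_def if_distrib[of "(*) _"] cong: if_cong)
  have e_in: "e \<bullet> v = v$s" for v by (simp add: e_def inner_axis')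
  have in_Qe: "x \<bullet> (Q *v e) = (Q *v x)$s" for x
    by (simp add: inner_vec_def Qe) (simp add: matrix_vector_mult_def mult.commute sym[of s])
  have expand: "(x + t *\<^sub>R e) \<bullet> (Q *v (x + t *\<^sub>R e)) = x \<bullet> (Q *v x) + 2 * t * (Q *v x)$s + t^2 * c" for x t
    by (simp add: matrix_vector_right_distrib matrix_vector_mult_scaleR inner_add_left inner_add_right e_in in_Qe Qe
        c_def
        algebra_simps power2_eq_square)
  have c0: "c \<ge> 0" using psd[of e] by (simp add: e_in Qe c_def)
  show ?case
  proof (cases "c = 0")
    case True
    have "Q$s$j = 0" for j
    proof (rule ccontr)
      assume nz: "Q$s$j \<noteq> 0"
      let ?x = "axis j 1 :: real^'n"
      have Qx: "(Q *v ?x) $ s = Q$s$j"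
        by (simp add: matrix_vector_mult_def axis_def if_distrib[of "(*) _"] cong: if_cong)
      \<comment> \<open>With \<open>c = 0\<close> the form is affine in the coefficient of
        \<open>e\<close>; this coefficient brings its value down to -1.\<close>
      let ?t = "- (?x \<bullet> (Q *v ?x) + 1) / (2 * Q$s$j)"
      have "?x \<bullet> (Q *v ?x) + 2 * ?t * Q$s$j + ?t^2 * c \<ge> 0"
        using psd[of "?x + ?t *\<^sub>R e"] unfolding expand Qx by simp
      moreover have "2 * ?t * Q$s$j = - (?x \<bullet> (Q *v ?x) + 1)" using nz by (simp add: field_simps)
      ultimately show False using True by simp
    qed
    then obtain B :: "real^'n^'n" where B: "\<forall>i j. (\<Sum>k\<in>UNIV. B$i$k * B$j$k) = Q$i$j" "\<forall>i j. j \<notin> S \<longrightarrow> B$i$j = 0"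
      using insert.IH[OF sym psd] supp by (metis insert_iff)
    then show ?thesis by (intro exI[of _ B]) auto
  next
    case False
    with c0 have c: "c > 0" by simp
    \<comment> \<open>Schur complement: subtracting a rank-one matrix clears row and column
      \<open>s\<close>, so that the support shrinks to \<open>S\<close>.\<close>
    define Q' :: "real^'n^'n" where "Q' = (\<chi> i j. Q$i$j - Q$i$s * Q$j$s / c)"
    have Q'x: "Q' *v x = Q *v x - ((Q *v x)$s / c) *\<^sub>R (Q *v e)" for x
    proof -
      have "(\<Sum>j\<in>UNIV. Q$i$s * Q$j$s / c * x$j) = (\<Sum>j\<in>UNIV. Q$s$j * x$j) / c * Q$i$s" for i
        by (simp add: sum_distrib_right sum_distrib_left sum_divide_distrib sym[of _ s] mult_ac)
      then show ?thesis
        by (simp add: vec_eq_iff Qe) (simp add: matrix_vector_mult_def Q'_def left_diff_distrib sum_subtractf)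
    qed
    have "x \<bullet> (Q' *v x) \<ge> 0" for x
    proof -
      \<comment> \<open>The form of the complement at \<open>x\<close> is the minimum of the form of
        \<open>Q\<close> along the line through \<open>x\<close> in direction \<open>e\<close>,
        attained at coefficient \<open>- r / c\<close>; hence it is nonnegative.\<close>
      define r where "r = (Q *v x)$s"
      have "x \<bullet> (Q' *v x) = x \<bullet> (Q *v x) - r^2 / c"
        by (simp add: Q'x inner_diff_right in_Qe r_def power2_eq_square)
      also have "\<dots> = (x + (- r / c) *\<^sub>R e) \<bullet> (Q *v (x + (- r / c) *\<^sub>R e))"
        unfolding expand using c by (simp add: r_def[symmetric] field_simps power2_eq_square)
      finally show ?thesis using psd by simp
    qed
    moreover have "Q'$i$j = Q'$j$i" for i j by (simp add: Q'_def sym[of i j])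
    moreover have "Q'$i$j = 0" if "i \<notin> S" for i j
    proof (cases "i = s")
      case True then show ?thesis using c by (simp add: Q'_def c_def[symmetric]) (simp add: sym[of j])
    next
      case False then show ?thesis using supp[of i] that by (simp add: Q'_def)
    qed
    ultimately obtain B :: "real^'n^'n" where B: "\<forall>i j. (\<Sum>k\<in>UNIV. B$i$k * B$j$k) = Q'$i$j" "\<forall>i j. j \<notin> S \<longrightarrow> B$i$j = 0"
      using insert.IH[of Q'] by blast
    \<comment> \<open>Column \<open>s\<close> of \<open>B\<close> is zero because \<open>s\<close>
      lies outside \<open>S\<close>, so the rank-one part can be stored there without disturbing the
      other products.\<close>
    define B' :: "real^'n^'n" where "B' = (\<chi> i j. if j = s then Q$i$s / sqrt c else B$i$j)"
    have "(\<Sum>k\<in>UNIV. B'$i$k * B'$j$k) = Q$i$j" for i j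
    proof -
      have "(\<Sum>k\<in>UNIV. B'$i$k * B'$j$k) = (\<Sum>k\<in>UNIV. B$i$k * B$j$k + (if k = s then Q$i$s * Q$j$s / c else 0))"
        using B(2) insert.hyps c by (intro sum.cong) (auto simp: B'_def)
      also have "\<dots> = Q$i$j" by (simp add: sum.distrib B(1)) (simp add: Q'_def)
      finally show ?thesis .
    qed
    moreover have "\<forall>i j. j \<notin> insert s S \<longrightarrow> B'$i$j = 0" using B(2) by (simp add: B'_def)
    ultimately show ?thesis by blast
  qed
qed

text \<open>A semidefinite Cholesky factorization that eliminates one index at a time. The dimension
  is a type and cannot shrink in an induction, so \<open>psd_factor_support\<close> shrinks the set
  of nonzero rows instead. Singular matrices must be covered because nothing prevents the limit
  covariance from being singular.\<close>

lemma psd_factor: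
  fixes Q :: "real^'n^'n"
  assumes "transpose Q = Q" and "\<And>x. x \<bullet> (Q *v x) \<ge> 0"
  obtains B :: "real^'n^'n" where "B ** transpose B = Q"
proof -
  have "Q$i$j = Q$j$i" for i j using assms(1) by (metis transpose_def vec_lambda_beta)
  from psd_factor_support[OF finite_class.finite_UNIV this assms(2)]
  obtain B :: "real^'n^'n" where "\<forall>i j. (\<Sum>k\<in>UNIV. B$i$k * B$j$k) = Q$i$j" by auto
  then have "B ** transpose B = Q" by (simp add: vec_eq_iff matrix_matrix_mult_def transpose_def)
  then show thesis by (rule that)
qed

lemma measurable_vec_lambda:
  "(\<And>i. (\<lambda>x. f x i) \<in> borel_measurable M) \<Longrightarrow> (\<lambda>x. (\<chi> i. f x i) :: real^'n) \<in> borel_measurable M"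
  by (subst borel_measurable_euclidean_space) (auto simp: Basis_vec_def inner_axis)

lemma measurable_vec_nth: "(\<lambda>x :: real^'n. x $ i) \<in> borel_measurable borel"
  by (intro borel_measurable_continuous_onI continuous_intros)

lemma std_normal_vector_prob: "prob_space (std_normal_vector :: (real^'n) measure)"
proof -
  interpret product_prob_space "\<lambda>i::'n. density lborel std_normal_density" UNIV
    by (simp add: product_prob_space_def product_prob_space_axioms_def product_sigma_finite_def
        prob_space_normal_density prob_space_imp_sigma_finite)
  show ?thesis unfolding std_normal_vector_def
    by (rule prob_space_distr) (auto intro!: measurable_vec_lambda)
qed

lemma sets_std_normal_vector [measurable_cong, simp]: "sets std_normal_vector = sets borel"
  by (simp add: std_normal_vector_def)

text \<open>Under the product measure the coordinates are independent, so the exponential of the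
  inner product integrates to a product of one-dimensional characteristic functions.\<close>

lemma std_normal_vector_char:
  fixes v :: "real^'n"
  shows "(CLINT z|std_normal_vector. iexp (v \<bullet> z)) = exp (- (v \<bullet> v) / 2)"
proof -
  interpret product_prob_space "\<lambda>i::'n. density lborel std_normal_density" UNIV
    by (simp add: product_prob_space_def product_prob_space_axioms_def product_sigma_finite_def
        prob_space_normal_density prob_space_imp_sigma_finite)
  let ?P = "\<Pi>\<^sub>M i\<in>(UNIV :: 'n set). density lborel std_normal_density"
  have m: "(\<lambda>z. (\<chi> i. z i) :: real^'n) \<in> borel_measurable ?P"
    by (auto intro!: measurable_vec_lambda)
  have "(CLINT z|std_normal_vector. iexp (v \<bullet> z)) = (CLINT z|?P. iexp (v \<bullet> (\<chi> i. z i)))"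
    unfolding std_normal_vector_def by (rule integral_distr[OF m]) measurable
  also have "\<dots> = (CLINT z|?P. (\<Prod>i\<in>UNIV. iexp (v$i * z i)))"
    by (simp add: inner_vec_def sum_distrib_left exp_sum[symmetric])
  also have "\<dots> = (\<Prod>i\<in>UNIV. CLINT x|density lborel std_normal_density. iexp (v$i * x))"
  proof (rule product_integral_prod)
    fix i :: 'n
    show "integrable (density lborel (\<lambda>x. ennreal (std_normal_density x))) (\<lambda>x. iexp (v $ i * x))"
      by (rule prob_space.integrable_iexp[OF prob_space_normal_density]) auto
  qed simp
  also have "\<dots> = (\<Prod>i\<in>UNIV. complex_of_real (exp (- ((v$i)^2) / 2)))"
    using char_std_normal_distribution by (simp add: char_def fun_eq_iff)
  also have "\<dots> = exp (- (v \<bullet> v) / 2)"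
    by (simp add: inner_vec_def power2_eq_square exp_sum[symmetric] sum_negf sum_divide_distrib
        exp_of_real[symmetric] of_real_sum)
  finally show ?thesis .
qed

lemma multivariate_normal_sets: "multivariate_normal \<mu> \<Sigma> N \<Longrightarrow> sets N = sets borel"
  by (auto simp: multivariate_normal_def)

lemma measurable_affine: "(\<lambda>z. \<mu> + B *v z) \<in> borel_measurable (std_normal_vector :: (real^'n) measure)"
  by (subst measurable_cong_sets[OF sets_std_normal_vector refl])
     (intro borel_measurable_continuous_onI continuous_intros matrix_vector_mult_linear_continuous_on)

lemma multivariate_normal_prob: "multivariate_normal \<mu> \<Sigma> N \<Longrightarrow> prob_space N"
  unfolding multivariate_normal_def
  using prob_space.prob_space_distr[OF std_normal_vector_prob measurable_affine] by blast

text \<open>A cosine with phase is the real part of the complex exponential times a unimodular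
  constant. The factor \<open>B\<close> enters only through \<open>v \<bullet> v\<close> with
  \<open>v = transpose B *v u\<close>, which is the form of \<open>\<Sigma>\<close> at
  \<open>u\<close>.\<close>

lemma multivariate_normal_cos:
  fixes u :: "real^'n"
  assumes "multivariate_normal 0 \<Sigma> N"
  shows "(LINT x|N. cos (u \<bullet> x + b)) = cos b * exp (- (u \<bullet> (\<Sigma> *v u)) / 2)"
proof -
  from assms obtain B :: "real^'n^'n" where B: "B ** transpose B = \<Sigma>"
    and N: "N = distr std_normal_vector borel (\<lambda>z. 0 + B *v z)" by (auto simp: multivariate_normal_def)
  interpret sn: prob_space "std_normal_vector :: (real^'n) measure" by (rule std_normal_vector_prob)
  define v where "v = transpose B *v u"
  have vv: "v \<bullet> v = u \<bullet> (\<Sigma> *v u)"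
    by (simp add: v_def B[symmetric] matrix_vector_mul_assoc[symmetric] dot_lmul_matrix[symmetric])
  have uB: "u \<bullet> (B *v z) = v \<bullet> z" for z
    by (simp add: v_def dot_lmul_matrix[symmetric])
  have mv: "(\<lambda>z. v \<bullet> z) \<in> borel_measurable std_normal_vector" by measurable
  have "(LINT x|N. cos (u \<bullet> x + b)) = (LINT z|std_normal_vector. cos (v \<bullet> z + b))"
    unfolding N by (subst integral_distr[OF measurable_affine]) (simp_all add: uB)
  also have "\<dots> = (LINT z|std_normal_vector. Re (iexp b * iexp (v \<bullet> z)))"
    by (simp add: Re_exp mult_exp_exp add.commute)
  also have "\<dots> = Re (CLINT z|std_normal_vector. iexp b * iexp (v \<bullet> z))"
    by (intro integral_Re integrable_mult_right sn.integrable_iexp borel_measurable_of_real mv) simp_all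
  also have "\<dots> = Re (iexp b * exp (- (v \<bullet> v) / 2))"
    by (simp add: std_normal_vector_char)
  also have "\<dots> = cos b * exp (- (v \<bullet> v) / 2)"
    by (simp add: Re_exp mult_exp_exp exp_of_real[symmetric] flip: of_real_minus of_real_divide)
  finally show ?thesis by (simp add: vv)
qed

lemma multivariate_normal_exists:
  assumes "transpose \<Sigma> = \<Sigma>" and "\<And>x. x \<bullet> (\<Sigma> *v x) \<ge> 0"
  obtains N where "multivariate_normal \<mu> \<Sigma> N"
  using psd_factor[OF assms] unfolding multivariate_normal_def by metis

section \<open>Weak convergence from cosine test functions\<close>

text \<open>The phase \<open>b\<close> makes sines and, with \<open>u = 0\<close>, constants special
  cases, so one kind of generator is enough for an algebra of real functions.\<close>

inductive trig_poly :: "('a::real_inner \<Rightarrow> real) \<Rightarrow> bool" where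
  base: "trig_poly (\<lambda>x. c * cos (u \<bullet> x + b))"
| add: "trig_poly p \<Longrightarrow> trig_poly q \<Longrightarrow> trig_poly (\<lambda>x. p x + q x)"

lemma trig_poly_const: "trig_poly (\<lambda>x. c)"
  using trig_poly.base[of c 0 0] by simp

lemma trig_poly_sum:
  "finite I \<Longrightarrow> (\<And>i. i \<in> I \<Longrightarrow> trig_poly (p i)) \<Longrightarrow> trig_poly (\<lambda>x. \<Sum>i\<in>I. p i x)"
  by (induction I rule: finite_induct) (auto intro: trig_poly_const trig_poly.add)

text \<open>The product-to-sum formula. Closure under products is what substitution into a
  polynomial requires.\<close>

lemma trig_poly_mult_cos:
  assumes "trig_poly p" shows "trig_poly (\<lambda>x. p x * (c * cos (u \<bullet> x + b)))"
  using assms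
proof induction
  case (base c' u' b')
  have "(\<lambda>x. c' * cos (u' \<bullet> x + b') * (c * cos (u \<bullet> x + b)))
    = (\<lambda>x. c' * c / 2 * cos ((u' - u) \<bullet> x + (b' - b)) + c' * c / 2 * cos ((u' + u) \<bullet> x + (b' + b)))"
  proof
    fix x
    have "(u' - u) \<bullet> x + (b' - b) = (u' \<bullet> x + b') - (u \<bullet> x + b)"
      and "(u' + u) \<bullet> x + (b' + b) = (u' \<bullet> x + b') + (u \<bullet> x + b)"
      by (simp_all add: inner_diff_left inner_add_left)
    then have "cos (u' \<bullet> x + b') * cos (u \<bullet> x + b) =
        (cos ((u' - u) \<bullet> x + (b' - b)) + cos ((u' + u) \<bullet> x + (b' + b))) / 2"
      by (simp only: cos_times_cos)
    from this[THEN arg_cong[where f = "\<lambda>y. c' * c * y"]] show "c' * cos (u' \<bullet> x + b') * (c * cos (u \<bullet> x + b))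
      = c' * c / 2 * cos ((u' - u) \<bullet> x + (b' - b)) + c' * c / 2 * cos ((u' + u) \<bullet> x + (b' + b))"
      by (simp add: field_simps)
  qed
  then show ?case by (simp only:) (intro trig_poly.intros)
next
  case (add p q)
  from trig_poly.add[OF add.IH] show ?case by (simp add: distrib_right)
qed

lemma trig_poly_mult:
  assumes "trig_poly q" "trig_poly p" shows "trig_poly (\<lambda>x. p x * q x)"
  using assms
proof induction
  case (base c u b)
  then show ?case by (rule trig_poly_mult_cos)
next
  case (add q q')
  from trig_poly.add[OF add.IH] add.prems show ?case by (simp add: distrib_left)
qed

lemma trig_poly_continuous: "trig_poly p \<Longrightarrow> continuous_on UNIV p"
  by (induction rule: trig_poly.induct) (auto intro!: continuous_intros)

lemma trig_poly_measurable: "trig_poly p \<Longrightarrow> p \<in> borel_measurable borel"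
  by (rule borel_measurable_continuous_onI[OF trig_poly_continuous])

text \<open>A bounded surrogate of the identity: its polynomials are trigonometric polynomials, and it tends
  to the identity locally uniformly as \<open>L \<rightarrow> \<infinity>\<close>.\<close>

definition sin_cutoff :: "real \<Rightarrow> 'a::euclidean_space \<Rightarrow> 'a" where
  "sin_cutoff L x = (\<Sum>i\<in>Basis. (L * sin ((x \<bullet> i) / L)) *\<^sub>R i)"

text \<open>Polynomial functions are generated from linear functions and constants by sums and
  products, so only the linear case is specific to the cutoff: each coordinate is a sine, that is, a
  cosine with phase \<open>- pi / 2\<close>.\<close>

lemma trig_poly_polynomial_sin_cutoff:
  fixes p :: "'a::euclidean_space \<Rightarrow> real"
  assumes "real_polynomial_function p" shows "trig_poly (\<lambda>x. p (sin_cutoff L x))"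
  using assms
proof induction
  case (linear f)
  interpret bounded_linear f by fact
  have shift: "cos (y + (- pi / 2)) = sin y" for y :: real by (simp add: cos_diff)
  have "f (sin_cutoff L x) = (\<Sum>i\<in>Basis. (f i * L) * cos ((i /\<^sub>R L) \<bullet> x + (- pi / 2)))" for x
    unfolding sin_cutoff_def shift sum scaleR
    by (intro sum.cong refl) (simp add: inner_commute divide_inverse mult_ac)
  then show ?case by (simp only:) (intro trig_poly_sum trig_poly.base finite_Basis)
qed (auto intro: trig_poly_const trig_poly.add trig_poly_mult)

text \<open>The range lies in one ball independent of \<open>x\<close>. A polynomial close to
  \<open>f\<close> on this ball is therefore close to \<open>f\<close> along the cutoff at every
  point of the space.\<close>

lemma norm_sin_cutoff:
  assumes "L > 0" shows "norm (sin_cutoff L (x::'a::euclidean_space)) \<le> L * DIM('a)"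
proof -
  have "norm (sin_cutoff L x) \<le> (\<Sum>i\<in>(Basis::'a set). norm ((L * sin ((x \<bullet> i) / L)) *\<^sub>R i))"
    unfolding sin_cutoff_def by (rule norm_sum)
  also have "\<dots> \<le> (\<Sum>i\<in>(Basis::'a set). L)"
    using assms by (intro sum_mono) (simp add: abs_mult mult_left_le)
  finally show ?thesis by (simp add: mult.commute)
qed

lemma sin_cutoff_diff:
  assumes "L > 0" shows "norm (sin_cutoff L (x::'a::euclidean_space) - x) \<le> DIM('a) * (norm x)^2 / (2 * L)"
proof -
  have 1: "\<bar>L * sin (y / L) - y\<bar> \<le> y^2 / (2 * L)" for y :: real
  proof -
    have "\<bar>sin (y/L) - (y/L)\<bar> \<le> (y/L)^2 / 2"
      using Maclaurin_sin_bound[of "y/L" 2]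
      by (simp add: numeral_2_eq_2 sin_coeff_def power2_eq_square abs_mult_self_eq abs_mult[symmetric])
    then have "L * \<bar>sin (y/L) - (y/L)\<bar> \<le> L * ((y/L)^2 / 2)" using assms by (intro mult_left_mono) auto
    also have "L * \<bar>sin (y/L) - (y/L)\<bar> = \<bar>L * sin (y / L) - y\<bar>"
    proof -
      have "L * \<bar>sin (y/L) - (y/L)\<bar> = \<bar>L * (sin (y/L) - (y/L))\<bar>" using assms by (simp add: abs_mult)
      then show ?thesis using assms by (simp add: right_diff_distrib)
    qed
    finally show ?thesis using assms by (simp add: power2_eq_square field_simps)
  qed
  have "sin_cutoff L x - x = (\<Sum>i\<in>Basis. (L * sin ((x \<bullet> i) / L) - x \<bullet> i) *\<^sub>R i)"
    by (subst (2) euclidean_representation[symmetric]) (simp add: sin_cutoff_def sum_subtractf scaleR_diff_left)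
  also have "norm \<dots> \<le> (\<Sum>i\<in>(Basis::'a set). norm ((L * sin ((x \<bullet> i) / L) - x \<bullet> i) *\<^sub>R i))"
    by (rule norm_sum)
  also have "\<dots> \<le> (\<Sum>i\<in>(Basis::'a set). (norm x)^2 / (2 * L))"
  proof (rule sum_mono)
    fix i :: 'a assume i: "i \<in> Basis"
    have "(x \<bullet> i)^2 \<le> (norm x)^2" using Basis_le_norm[OF i] by (metis abs_le_square_iff abs_norm_cancel)
    then have "(x \<bullet> i)^2 / (2 * L) \<le> (norm x)^2 / (2 * L)" using assms by (intro divide_right_mono) auto
    with 1[of "x \<bullet> i"] show "norm ((L * sin ((x \<bullet> i) / L) - x \<bullet> i) *\<^sub>R i) \<le> (norm x)^2 / (2 * L)"
      using i by simp
  qed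
  finally show ?thesis by simp
qed

text \<open>On the ball of radius \<open>r\<close> the cutoff moves points so little that uniform
  continuity applies. Off the ball only the bound survives: there the polynomial is near the value
  of \<open>f\<close> at the cutoff point, which is at most \<open>C\<close> in absolute
  value.\<close>

lemma trig_poly_approx:
  fixes f :: "'a::euclidean_space \<Rightarrow> real"
  assumes cont: "continuous_on UNIV f" and bd: "\<And>x. \<bar>f x\<bar> \<le> C" and "\<epsilon> > 0" "r > 0"
  obtains q where "trig_poly q" "\<And>x. norm x \<le> r \<Longrightarrow> \<bar>f x - q x\<bar> \<le> \<epsilon>" "\<And>x. \<bar>q x\<bar> \<le> C + \<epsilon>"
proof -
  have "uniformly_continuous_on (cball 0 (r + 1)) f"
    using cont by (intro compact_uniformly_continuous) (auto intro: continuous_on_subset)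
  then obtain \<delta> where \<delta>: "\<delta> > 0"
    "\<And>x y. norm x \<le> r + 1 \<Longrightarrow> norm y \<le> r + 1 \<Longrightarrow> dist y x < \<delta> \<Longrightarrow> dist (f y) (f x) < \<epsilon> / 2"
    unfolding uniformly_continuous_on_def using \<open>\<epsilon> > 0\<close>
    by (metis half_gt_zero mem_cball_0)
  define \<eta> where "\<eta> = min \<delta> 1 / 2"
  have \<eta>: "\<eta> > 0" "\<eta> < \<delta>" "\<eta> < 1" using \<delta>(1) by (auto simp: \<eta>_def)
  \<comment> \<open>This \<open>L\<close> turns the bound of \<open>sin_cutoff_diff\<close> at
    radius \<open>r\<close> into exactly \<open>\<eta>\<close>. As \<open>\<eta> < 1\<close>, the
    moved points stay in the ball of radius \<open>r + 1\<close>.\<close>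
  define L where "L = DIM('a) * r^2 / (2 * \<eta>)"
  have L: "L > 0" using \<eta> \<open>r > 0\<close> by (simp add: L_def)
  have close: "norm (sin_cutoff L x - x) \<le> \<eta>" if "norm x \<le> r" for x :: 'a
  proof -
    have "norm (sin_cutoff L x - x) \<le> DIM('a) * (norm x)^2 / (2 * L)" by (rule sin_cutoff_diff[OF L])
    also have "\<dots> \<le> DIM('a) * r^2 / (2 * L)"
      using that L by (intro divide_right_mono mult_left_mono power_mono) auto
    also have "\<dots> = \<eta>" using \<eta> \<open>r > 0\<close> by (simp add: L_def field_simps)
    finally show ?thesis .
  qed
  let ?K = "cball (0::'a) (L * DIM('a))"
  obtain p where p: "real_polynomial_function p" "\<And>x. x \<in> ?K \<Longrightarrow> \<bar>f x - p x\<bar> < \<epsilon> / 2"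
    using Stone_Weierstrass_real_polynomial_function[of ?K f "\<epsilon> / 2"] cont \<open>\<epsilon> > 0\<close>
    by (metis compact_cball continuous_on_subset half_gt_zero subset_UNIV)
  have pK: "\<bar>f (sin_cutoff L x) - p (sin_cutoff L x)\<bar> < \<epsilon> / 2" for x :: 'a
    by (rule p(2)) (simp add: norm_sin_cutoff[OF L])
  show thesis
  proof
    show "trig_poly (\<lambda>x. p (sin_cutoff L x))" using p(1) by (rule trig_poly_polynomial_sin_cutoff)
    show "\<bar>p (sin_cutoff L x)\<bar> \<le> C + \<epsilon>" for x
      using pK[of x] bd[of "sin_cutoff L x"] \<open>\<epsilon> > 0\<close> by linarith
    show "\<bar>f x - p (sin_cutoff L x)\<bar> \<le> \<epsilon>" if "norm x \<le> r" for x
    proof -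
      have "norm (sin_cutoff L x) \<le> norm (sin_cutoff L x - x) + norm x"
        using norm_triangle_ineq[of "sin_cutoff L x - x" x] by simp
      then have "dist (f (sin_cutoff L x)) (f x) < \<epsilon> / 2"
        using close[OF that] that \<eta> by (intro \<delta>(2)) (auto simp: dist_norm)
      with pK[of x] show ?thesis unfolding dist_real_def by linarith
    qed
  qed
qed

lemma (in prob_space) expectation_approx:
  fixes f q :: "'b::euclidean_space \<Rightarrow> real"
  assumes Z: "Z \<in> borel_measurable M" and f: "f \<in> borel_measurable borel" and q: "q \<in> borel_measurable borel"
    and near: "\<And>x. norm x \<le> r \<Longrightarrow> \<bar>f x - q x\<bar> \<le> \<epsilon>" and bf: "\<And>x. \<bar>f x\<bar> \<le> C" and bq: "\<And>x. \<bar>q x\<bar> \<le> C + \<epsilon>"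
    and \<epsilon>: "\<epsilon> \<ge> 0"
  shows "\<bar>expectation (\<lambda>\<omega>. f (Z \<omega>)) - expectation (\<lambda>\<omega>. q (Z \<omega>))\<bar>
    \<le> \<epsilon> + (2 * C + \<epsilon>) * prob {\<omega> \<in> space M. norm (Z \<omega>) > r}"
proof -
  let ?B = "{\<omega> \<in> space M. norm (Z \<omega>) > r}"
  note [measurable] = Z f q
  have B: "?B \<in> sets M" by measurable
  have i: "integrable M (\<lambda>\<omega>. f (Z \<omega>))" "integrable M (\<lambda>\<omega>. q (Z \<omega>))"
    by (rule integrable_const_bound[where B = C], simp_all add: bf)
       (rule integrable_const_bound[where B = "C + \<epsilon>"], simp_all add: bq)
  have "\<bar>expectation (\<lambda>\<omega>. f (Z \<omega>)) - expectation (\<lambda>\<omega>. q (Z \<omega>))\<bar> = \<bar>expectation (\<lambda>\<omega>. f (Z \<omega>) - q (Z \<omega>))\<bar>"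
    using i by simp
  also have "\<dots> \<le> expectation (\<lambda>\<omega>. \<bar>f (Z \<omega>) - q (Z \<omega>)\<bar>)" by (rule integral_abs_bound)
  also have "\<dots> \<le> expectation (\<lambda>\<omega>. \<epsilon> + (2 * C + \<epsilon>) * indicator ?B \<omega>)"
  proof (rule integral_mono)
    show "integrable M (\<lambda>\<omega>. \<epsilon> + (2 * C + \<epsilon>) * indicator ?B \<omega>)"
      using B by (intro Bochner_Integration.integrable_add integrable_mult_right integrable_real_indicator) (auto
          simp: emeasure_eq_measure)
    fix \<omega> assume \<omega>: "\<omega> \<in> space M"
    have e: "0 \<le> C" "0 \<le> C + \<epsilon>" using bf[of 0] bq[of 0] by auto
    show "\<bar>f (Z \<omega>) - q (Z \<omega>)\<bar> \<le> \<epsilon> + (2 * C + \<epsilon>) * indicator ?B \<omega>"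
    proof (cases "norm (Z \<omega>) \<le> r")
      case True then show ?thesis using near[of "Z \<omega>"] by (simp add: indicator_def)
    next
      case False
      then show ?thesis using bf[of "Z \<omega>"] bq[of "Z \<omega>"] \<omega> e \<epsilon>
        by (auto simp: indicator_def)
    qed
  qed (use i in auto)
  also have "\<dots> = \<epsilon> + (2 * C + \<epsilon>) * prob ?B"
  proof -
    have "integrable M (indicator ?B :: 'a \<Rightarrow> real)"
      using B by (intro integrable_real_indicator) (auto simp: emeasure_eq_measure)
    then show ?thesis using B by (simp add: prob_space)
  qed
  finally show ?thesis .
qed

lemma (in prob_space) tight_vector:
  fixes Z :: "'a \<Rightarrow> 'b::euclidean_space"
  assumes [measurable]: "Z \<in> borel_measurable M" and "\<eta> > 0"
  obtains L where "prob {\<omega> \<in> space M. norm (Z \<omega>) > L} \<le> \<eta>"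
proof -
  have "(\<lambda>n. prob {\<omega> \<in> space M. norm (Z \<omega>) > real n}) \<longlonglongrightarrow> prob (\<Inter>n. {\<omega> \<in> space M. norm (Z \<omega>) > real n})"
  proof (rule finite_Lim_measure_decseq)
    show "range (\<lambda>n. {\<omega> \<in> space M. norm (Z \<omega>) > real n}) \<subseteq> events" by auto
    show "decseq (\<lambda>n. {\<omega> \<in> space M. norm (Z \<omega>) > real n})"
      by (rule decseq_SucI) auto
  qed
  also have "(\<Inter>n. {\<omega> \<in> space M. norm (Z \<omega>) > real n}) = {}"
  proof -
    have "\<exists>n. \<not> real n < norm (Z x)" for x using reals_Archimedean2[of "norm (Z x)"] by (meson less_asym)
    then show ?thesis by auto
  qed
  finally have "eventually (\<lambda>n. prob {\<omega> \<in> space M. norm (Z \<omega>) > real n} < \<eta>) sequentially"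
    using \<open>\<eta> > 0\<close> by (intro order_tendstoD) auto
  then obtain n where "prob {\<omega> \<in> space M. norm (Z \<omega>) > real n} < \<eta>" by (auto simp: eventually_sequentially)
  then show thesis by (intro that[of "real n"]) simp
qed

text \<open>Tightness is a hypothesis rather than a consequence of the convergence of cosines, since
  it is at hand in the application. On a large ball that carries nearly all mass of both laws,
  \<open>f\<close> is nearly a trigonometric polynomial, whose integrals converge by linearity;
  outside it only bounds matter. Measurability is asked for large \<open>n\<close> only, because
  estimators are unconstrained at time 0.\<close>

lemma converges_in_distribution_cosI:
  fixes Z :: "nat \<Rightarrow> 'w \<Rightarrow> 'b::euclidean_space"
  assumes M: "prob_space M" and N: "prob_space N" and sN: "sets N = sets borel"
    and meas: "eventually (\<lambda>n. Z n \<in> borel_measurable M) sequentially"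
    and tight: "\<And>\<eta>. \<eta> > 0 \<Longrightarrow> \<exists>L. eventually (\<lambda>n. measure M {\<omega> \<in> space M. norm (Z n \<omega>) > L} \<le> \<eta>) sequentially"
    and cos: "\<And>u b. (\<lambda>n. LINT \<omega>|M. cos (u \<bullet> Z n \<omega> + b)) \<longlonglongrightarrow> (LINT x|N. cos (u \<bullet> x + b))"
  shows "converges_in_distribution M Z N"
  unfolding converges_in_distribution_def
proof (intro allI impI)
  interpret M: prob_space M by (rule M)
  interpret N: prob_space N by (rule N)
  have Nid: "(\<lambda>x. x) \<in> borel_measurable N" by (subst measurable_cong_sets[OF sN refl]) simp
  have trig: "(\<lambda>n. LINT \<omega>|M. q (Z n \<omega>)) \<longlonglongrightarrow> (LINT x|N. q x) \<and>
      integrable N q \<and> (eventually (\<lambda>n. integrable M (\<lambda>\<omega>. q (Z n \<omega>))) sequentially)" if "trig_poly q" for q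
    using that
  proof induction
    case (base c u b)
    have bd: "\<bar>c * cos y\<bar> \<le> \<bar>c\<bar>" for y by (simp add: abs_mult mult_left_le)
    have "eventually (\<lambda>n. integrable M (\<lambda>\<omega>. c * cos (u \<bullet> Z n \<omega> + b))) sequentially"
      using meas
    proof eventually_elim
      case (elim n)
      note [measurable] = elim
      show ?case by (rule M.integrable_const_bound[where B = "\<bar>c\<bar>"], use bd in simp, measurable)
    qed
    moreover have "(\<lambda>x. c * cos (u \<bullet> x + b)) \<in> borel_measurable N"
      by (subst measurable_cong_sets[OF sN refl]) measurable
    then have "integrable N (\<lambda>x. c * cos (u \<bullet> x + b))"
      by (rule N.integrable_const_bound[where B = "\<bar>c\<bar>", rotated]) (use bd in simp)
    ultimately show ?case using tendsto_mult_left[OF cos[of u b], of c] by simp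
  next
    case (add p q)
    have ip: "eventually (\<lambda>n. integrable M (\<lambda>\<omega>. p (Z n \<omega>))) sequentially"
      and iq: "eventually (\<lambda>n. integrable M (\<lambda>\<omega>. q (Z n \<omega>))) sequentially"
      using add.IH by auto
    have ev: "eventually (\<lambda>n. (LINT \<omega>|M. p (Z n \<omega>)) + (LINT \<omega>|M. q (Z n \<omega>))
        = (LINT \<omega>|M. p (Z n \<omega>) + q (Z n \<omega>))) sequentially"
      using ip iq by eventually_elim simp
    have ipq: "eventually (\<lambda>n. integrable M (\<lambda>\<omega>. p (Z n \<omega>) + q (Z n \<omega>))) sequentially"
      using ip iq by eventually_elim simp
    have "(\<lambda>n. (LINT \<omega>|M. p (Z n \<omega>)) + (LINT \<omega>|M. q (Z n \<omega>))) \<longlonglongrightarrow> (LINT x|N. p x) + (LINT x|N. q x)"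
      using add.IH by (intro tendsto_add) auto
    from Lim_transform_eventually[OF this ev] show ?case
      using add.IH ipq by simp
  qed
  fix f :: "'b \<Rightarrow> real" assume cf: "continuous_on UNIV f" and bf: "bounded (range f)"
  obtain C where C: "\<And>x. \<bar>f x\<bar> \<le> C" using bf by (auto simp: bounded_iff)
  have C0: "C \<ge> 0" using C[of 0] by linarith
  have mf: "f \<in> borel_measurable borel" using cf by (rule borel_measurable_continuous_onI)
  show "(\<lambda>n. LINT \<omega>|M. f (Z n \<omega>)) \<longlonglongrightarrow> (LINT x|N. f x)"
  proof (rule LIMSEQ_I, unfold real_norm_def)
    fix e :: real assume e: "e > 0"
    \<comment> \<open>Both errors of \<open>expectation_approx\<close> become at most
      \<open>e / 8\<close>. The cap 1 on \<open>\<epsilon>\<close> allows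
      \<open>2 * C + \<epsilon>\<close> to be replaced by \<open>2 * C + 1\<close> in the choice of
      \<open>\<eta>\<close>.\<close>
    define \<epsilon> where "\<epsilon> = min 1 (e / 8)"
    define \<eta> where "\<eta> = e / (8 * (2 * C + 1))"
    have \<epsilon>: "\<epsilon> > 0" "\<epsilon> \<le> 1" "\<epsilon> \<le> e / 8" and \<eta>: "\<eta> > 0" using e C0 by (auto simp: \<epsilon>_def \<eta>_def)
    obtain L1 where L1: "eventually (\<lambda>n. M.prob {\<omega> \<in> space M. norm (Z n \<omega>) > L1} \<le> \<eta>) sequentially"
      using tight[OF \<eta>] by blast
    obtain L2 where L2: "N.prob {x \<in> space N. norm x > L2} \<le> \<eta>"
      using N.tight_vector[OF Nid \<eta>] by blast
    define r where "r = max 1 (max L1 L2)"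
    obtain q where q: "trig_poly q" "\<And>x. norm x \<le> r \<Longrightarrow> \<bar>f x - q x\<bar> \<le> \<epsilon>" "\<And>x. \<bar>q x\<bar> \<le> C + \<epsilon>"
      by (rule trig_poly_approx[OF cf C \<epsilon>(1), of r]) (auto simp: r_def)
    have mq: "q \<in> borel_measurable borel" by (rule trig_poly_measurable) fact
    have bnd: "\<epsilon> + (2 * C + \<epsilon>) * p \<le> e / 4" if "0 \<le> p" "p \<le> \<eta>" for p
    proof -
      have "(2 * C + \<epsilon>) * p \<le> (2 * C + 1) * \<eta>" using that \<epsilon> C0 by (intro mult_mono) auto
      also have "\<dots> = e / 8" using C0 by (simp add: \<eta>_def field_simps)
      finally show ?thesis using \<epsilon> by linarith
    qed
    have "N.prob {x \<in> space N. norm x > r} \<le> \<eta>"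
    proof -
      have "N.prob {x \<in> space N. norm x > r} \<le> N.prob {x \<in> space N. norm x > L2}"
      proof (rule N.finite_measure_mono)
        have "{x :: 'b. norm x > L2} \<in> sets borel" by measurable
        then show "{x \<in> space N. norm x > L2} \<in> sets N"
          using sN sets_eq_imp_space_eq[OF sN] by simp
      qed (auto simp: r_def)
      with L2 show ?thesis by linarith
    qed
    with N.expectation_approx[OF Nid mf mq q(2) C q(3) less_imp_le[OF \<epsilon>(1)], of r]
    have 1: "\<bar>(LINT x|N. f x) - (LINT x|N. q x)\<bar> \<le> e / 4"
      using bnd[OF measure_nonneg] by (meson order_trans)
    have 2: "eventually (\<lambda>n. \<bar>(LINT \<omega>|M. f (Z n \<omega>)) - (LINT \<omega>|M. q (Z n \<omega>))\<bar> \<le> e / 4) sequentially"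
      using meas L1
    proof eventually_elim
      case (elim n)
      note [measurable] = elim(1)
      have "M.prob {\<omega> \<in> space M. norm (Z n \<omega>) > r} \<le> M.prob {\<omega> \<in> space M. norm (Z n \<omega>) > L1}"
        by (intro M.finite_measure_mono) (auto simp: r_def)
      with elim(2) have "M.prob {\<omega> \<in> space M. norm (Z n \<omega>) > r} \<le> \<eta>" by simp
      with M.expectation_approx[OF elim(1) mf mq q(2) C q(3) less_imp_le[OF \<epsilon>(1)], of r] show ?case
        using bnd[OF measure_nonneg] by (meson order_trans)
    qed
    have "eventually (\<lambda>n. \<bar>(LINT \<omega>|M. q (Z n \<omega>)) - (LINT x|N. q x)\<bar> < e / 4) sequentially"
      using trig[OF q(1)] e by (auto simp: tendsto_iff dist_real_def dest: spec[of _ "e/4"])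
    with 2 have "eventually (\<lambda>n. \<bar>(LINT \<omega>|M. f (Z n \<omega>)) - (LINT x|N. f x)\<bar> < e) sequentially"
      by eventually_elim (use 1 e in linarith)
    then show "\<exists>no. \<forall>n\<ge>no. \<bar>(LINT \<omega>|M. f (Z n \<omega>)) - (LINT x|N. f x)\<bar> < e"
      by (simp add: eventually_sequentially)
  qed
qed

section \<open>A martingale central limit theorem\<close>

lemma cesaro_null:
  fixes \<delta> :: "nat \<Rightarrow> real"
  assumes "\<delta> \<longlonglongrightarrow> 0"
  shows "(\<lambda>n. (\<Sum>t=1..n. \<delta> t) / real n) \<longlonglongrightarrow> 0"
proof (rule LIMSEQ_I)
  fix e :: real assume e: "e > 0"
  obtain m where m: "\<And>t. t \<ge> m \<Longrightarrow> \<bar>\<delta> t\<bar> < e / 2"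
    using LIMSEQ_D[OF assms, of "e/2"] e by auto
  define C where "C = (\<Sum>t=1..m. \<bar>\<delta> t\<bar>)"
  have C: "C \<ge> 0" by (simp add: C_def sum_nonneg)
  have bound: "\<bar>\<Sum>t=1..n. \<delta> t\<bar> \<le> C + real n * (e / 2)" for n
  proof -
    have "\<bar>\<Sum>t=1..n. \<delta> t\<bar> \<le> (\<Sum>t=1..n. \<bar>\<delta> t\<bar>)" by (rule sum_abs)
    also have "\<dots> \<le> (\<Sum>t=1..n. (if t \<in> {1..m} then \<bar>\<delta> t\<bar> else 0) + e / 2)"
      using m e by (intro sum_mono) (auto simp: not_le less_imp_le)
    also have "\<dots> = (\<Sum>t\<in>{1..n} \<inter> {1..m}. \<bar>\<delta> t\<bar>) + real n * (e / 2)"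
      by (simp only: sum.distrib sum.inter_restrict[OF finite_atLeastAtMost] sum_constant card_atLeastAtMost) simp
    also have "\<dots> \<le> C + real n * (e / 2)"
      unfolding C_def by (intro add_mono sum_mono2) auto
    finally show ?thesis .
  qed
  obtain n0 where n0: "2 * C / e < real n0" using reals_Archimedean2 by blast
  show "\<exists>no. \<forall>n\<ge>no. norm ((\<Sum>t=1..n. \<delta> t) / real n - 0) < e"
  proof (intro exI allI impI)
    fix n assume n: "n \<ge> Suc n0"
    have "2 * C / e < real n" using n n0 by linarith
    then have "C < real n * (e / 2)" using e by (simp add: field_simps)
    then have "\<bar>\<Sum>t=1..n. \<delta> t\<bar> < real n * e" using bound[of n] by simp
    then show "norm ((\<Sum>t=1..n. \<delta> t) / real n - 0) < e" using n by (simp add: field_simps)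
  qed
qed

text \<open>The remainder bound for the complex exponential at 0 is rotated by the unimodular factor
  \<open>iexp a\<close>; the real part is taken at the end.\<close>

lemma cos_taylor2: "\<bar>cos (a + h) - cos a + h * sin a + h^2 / 2 * cos a\<bar> \<le> \<bar>h\<bar>^3 / 6" for a h :: real
proof -
  have "cmod (iexp h - (\<Sum>k\<le>2. (\<i> * h)^k / fact k)) \<le> \<bar>h\<bar>^3 / 6"
    using iexp_approx1[of h 2] by (simp add: eval_nat_numeral)
  then have "cmod (iexp a * (iexp h - (\<Sum>k\<le>2. (\<i> * h)^k / fact k))) \<le> \<bar>h\<bar>^3 / 6"
    by (simp add: norm_mult)
  then have "\<bar>Re (iexp a * (iexp h - (\<Sum>k\<le>2. (\<i> * h)^k / fact k)))\<bar> \<le> \<bar>h\<bar>^3 / 6"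
    using abs_Re_le_cmod order_trans by blast
  moreover have "Re (iexp a * (iexp h - (\<Sum>k\<le>2. (\<i> * h)^k / fact k)))
      = cos (a + h) - cos a + h * sin a + h^2 / 2 * cos a"
    by (simp add: eval_nat_numeral cos_add Re_exp Im_exp algebra_simps)
  ultimately show ?thesis by simp
qed

lemma integrable_dominated:
  fixes f w :: "'a \<Rightarrow> real"
  assumes "integrable M w" "f \<in> borel_measurable M" "AE x in M. \<bar>f x\<bar> \<le> w x"
  shows "integrable M f"
proof (rule Bochner_Integration.integrable_bound[OF assms(1,2)])
  show "AE x in M. norm (f x) \<le> norm (w x)" using assms(3) by eventually_elim simp
qed

lemma abs_power_le_one_plus_power:
  fixes x :: real
  assumes "m \<le> n" shows "\<bar>x\<bar>^m \<le> 1 + \<bar>x\<bar>^n"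
proof (cases "\<bar>x\<bar> \<le> 1")
  case True
  then have "\<bar>x\<bar>^m \<le> 1" by (intro power_le_one) auto
  moreover have "0 \<le> \<bar>x\<bar>^n" by simp
  ultimately show ?thesis by linarith
next
  case False
  then have "\<bar>x\<bar>^m \<le> \<bar>x\<bar>^n" using assms by (intro power_increasing) auto
  then show ?thesis by simp
qed

lemma abs_mult_le_sum_squares: "\<bar>x\<bar> * \<bar>y\<bar> \<le> x^2 + y^2" for x y :: real
proof -
  have "0 \<le> \<bar>x\<bar> * \<bar>y\<bar>" by simp
  then show ?thesis using sum_squares_bound[of "\<bar>x\<bar>" "\<bar>y\<bar>"] unfolding power2_abs by linarith
qed

text \<open>The martingale property and the conditional variance enter only through expectations
  against cosines of the past sum, which is all that the recursion uses. The bound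
  \<open>\<delta> t\<close> must be uniform in \<open>s\<close> and \<open>b\<close>, because
  \<open>s = 1 / sqrt T\<close> changes with the horizon \<open>T\<close>.\<close>

lemma (in prob_space) martingale_clt_cos:
  fixes \<xi> :: "nat \<Rightarrow> 'a \<Rightarrow> real"
  assumes meas [measurable]: "\<And>t. t \<ge> 1 \<Longrightarrow> \<xi> t \<in> borel_measurable M"
    and third: "\<And>t. t \<ge> 1 \<Longrightarrow> integrable M (\<lambda>\<omega>. \<bar>\<xi> t \<omega>\<bar>^3)"
      "\<And>t. t \<ge> 1 \<Longrightarrow> expectation (\<lambda>\<omega>. \<bar>\<xi> t \<omega>\<bar>^3) \<le> C"
    and mean: "\<And>t s b. t \<ge> 1 \<Longrightarrow> expectation (\<lambda>\<omega>. cos (s * (\<Sum>i\<in>{1..<t}. \<xi> i \<omega>) + b) * \<xi> t \<omega>) = 0"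
    and var: "\<And>t s b. t \<ge> 1 \<Longrightarrow> \<bar>expectation (\<lambda>\<omega>. cos (s * (\<Sum>i\<in>{1..<t}. \<xi> i \<omega>) + b) * (\<xi> t \<omega>)^2)
        - v * expectation (\<lambda>\<omega>. cos (s * (\<Sum>i\<in>{1..<t}. \<xi> i \<omega>) + b))\<bar> \<le> \<delta> t"
    and \<delta>: "\<delta> \<longlonglongrightarrow> 0" and v: "v \<ge> 0"
  shows "(\<lambda>T. expectation (\<lambda>\<omega>. cos ((\<Sum>t=1..T. \<xi> t \<omega>) / sqrt T + b))) \<longlonglongrightarrow> cos b * exp (- v / 2)"
proof -
  define S where "S k \<omega> = (\<Sum>i=1..k. \<xi> i \<omega>)" for k \<omega>
  have S_Suc: "S (Suc k) \<omega> = S k \<omega> + \<xi> (Suc k) \<omega>" for k \<omega> by (simp add: S_def)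
  have S_alt: "(\<Sum>i\<in>{1..<Suc k}. \<xi> i \<omega>) = S k \<omega>" for k \<omega> by (simp add: S_def atLeastLessThanSuc_atLeastAtMost)
  have Sm [measurable]: "S k \<in> borel_measurable M" for k unfolding S_def by measurable
  define c where "c s k b = expectation (\<lambda>\<omega>. cos (s * S k \<omega> + b))" for s k b
  have icos: "integrable M (\<lambda>\<omega>. cos (f \<omega>))" if [measurable]: "f \<in> borel_measurable M" for f :: "'a \<Rightarrow> real"
    by (rule integrable_const_bound[where B = 1]) auto
  have isin: "integrable M (\<lambda>\<omega>. sin (f \<omega>))" if [measurable]: "f \<in> borel_measurable M" for f :: "'a \<Rightarrow> real"
    by (rule integrable_const_bound[where B = 1]) auto
  have dom: "integrable M (\<lambda>\<omega>. 1 + \<bar>\<xi> t \<omega>\<bar>^3)" if "t \<ge> 1" for t using third(1)[OF that] by simp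
  have i1: "integrable M (\<lambda>\<omega>. sin (f \<omega>) * \<xi> t \<omega>)" if "t \<ge> 1" and [measurable]: "f \<in> borel_measurable M" for t f
  proof (rule integrable_dominated[OF dom[OF that(1)]])
    show "AE \<omega> in M. \<bar>sin (f \<omega>) * \<xi> t \<omega>\<bar> \<le> 1 + \<bar>\<xi> t \<omega>\<bar>^3"
    proof (rule AE_I2)
      fix \<omega>
      have "\<bar>sin (f \<omega>) * \<xi> t \<omega>\<bar> \<le> 1 * \<bar>\<xi> t \<omega>\<bar>" unfolding abs_mult by (intro mult_right_mono) auto
      then show "\<bar>sin (f \<omega>) * \<xi> t \<omega>\<bar> \<le> 1 + \<bar>\<xi> t \<omega>\<bar>^3"
        using abs_power_le_one_plus_power[of 1 3 "\<xi> t \<omega>"] by simp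
    qed
  qed (use that(1) in measurable)
  have i2: "integrable M (\<lambda>\<omega>. cos (f \<omega>) * (\<xi> t \<omega>)^2)" if "t \<ge> 1" and [measurable]: "f \<in> borel_measurable M" for t f
  proof (rule integrable_dominated[OF dom[OF that(1)]])
    show "AE \<omega> in M. \<bar>cos (f \<omega>) * (\<xi> t \<omega>)^2\<bar> \<le> 1 + \<bar>\<xi> t \<omega>\<bar>^3"
    proof (rule AE_I2)
      fix \<omega>
      have "\<bar>cos (f \<omega>)\<bar> * \<bar>(\<xi> t \<omega>)^2\<bar> \<le> 1 * \<bar>(\<xi> t \<omega>)^2\<bar>" by (intro mult_right_mono) auto
      then show "\<bar>cos (f \<omega>) * (\<xi> t \<omega>)^2\<bar> \<le> 1 + \<bar>\<xi> t \<omega>\<bar>^3"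
        using abs_power_le_one_plus_power[of 2 3 "\<xi> t \<omega>"] by (simp add: abs_mult)
    qed
  qed (use that(1) in measurable)
  have sin_cos': "sin y = cos (y - pi / 2)" for y :: real by (simp add: cos_diff)
  \<comment> \<open>The cosine is expanded around the past sum: the first-order term has mean zero,
    the second-order term reproduces the previous expectation with factor
    \<open>- v * s^2 / 2\<close>, and the third moment bounds the remainder.\<close>
  have step: "\<bar>c s (Suc k) b - (1 - v * s^2 / 2) * c s k b\<bar> \<le> s^2 / 2 * \<delta> (Suc k) + s^3 / 6 * C"
    if s: "s > 0" for s k b
  proof -
    define a where "a \<omega> = s * S k \<omega> + b" for \<omega>
    have am [measurable]: "a \<in> borel_measurable M" unfolding a_def by measurable
    let ?x = "\<xi> (Suc k)"
    let ?R = "\<lambda>\<omega>. cos (a \<omega> + s * ?x \<omega>) - cos (a \<omega>) + s * (sin (a \<omega>) * ?x \<omega>) + s^2 / 2 * (cos (a \<omega>) * (?x \<omega>)^2)"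
    have xm [measurable]: "?x \<in> borel_measurable M" by (rule meas) simp
    have iR: "integrable M ?R"
      by (intro Bochner_Integration.integrable_add Bochner_Integration.integrable_diff integrable_mult_right i1 i2
          icos) auto
    \<comment> \<open>A sine is a cosine with shifted phase; this is why \<open>mean\<close> is
      assumed for every \<open>b\<close>.\<close>
    have m0: "expectation (\<lambda>\<omega>. sin (a \<omega>) * ?x \<omega>) = 0"
      using mean[of "Suc k" s "b - pi / 2"] unfolding S_alt a_def by (simp add: sin_cos' add_diff_eq)
    have v0: "\<bar>expectation (\<lambda>\<omega>. cos (a \<omega>) * (?x \<omega>)^2) - v * c s k b\<bar> \<le> \<delta> (Suc k)"
      using var[of "Suc k" s b] unfolding S_alt a_def c_def by simp
    have "expectation ?R = expectation (\<lambda>\<omega>. cos (a \<omega> + s * ?x \<omega>)) - expectation (\<lambda>\<omega>. cos (a \<omega>))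
        + s * expectation (\<lambda>\<omega>. sin (a \<omega>) * ?x \<omega>) + s^2 / 2 * expectation (\<lambda>\<omega>. cos (a \<omega>) * (?x \<omega>)^2)"
      by (simp add: i1 i2 icos)
    also have "\<dots> = c s (Suc k) b - c s k b + s^2 / 2 * expectation (\<lambda>\<omega>. cos (a \<omega>) * (?x \<omega>)^2)"
      unfolding m0 by (simp add: c_def S_Suc a_def algebra_simps)
    finally have ER: "expectation ?R = c s (Suc k) b - c s k b + s^2 / 2 * expectation (\<lambda>\<omega>. cos (a \<omega>) * (?x \<omega>)^2)" .
    have "\<bar>expectation ?R\<bar> \<le> expectation (\<lambda>\<omega>. \<bar>?R \<omega>\<bar>)" by (rule integral_abs_bound)
    also have "\<dots> \<le> expectation (\<lambda>\<omega>. s^3 / 6 * \<bar>?x \<omega>\<bar>^3)"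
    proof (rule integral_mono)
      show "integrable M (\<lambda>\<omega>. \<bar>?R \<omega>\<bar>)" using iR by (rule integrable_abs)
      show "integrable M (\<lambda>\<omega>. s^3 / 6 * \<bar>?x \<omega>\<bar>^3)" by (intro integrable_mult_right third) simp
      show "\<bar>?R \<omega>\<bar> \<le> s^3 / 6 * \<bar>?x \<omega>\<bar>^3" for \<omega>
        using cos_taylor2[of "a \<omega>" "s * ?x \<omega>"] s by (simp add: power_mult_distrib abs_mult mult_ac)
    qed
    also have "\<dots> \<le> s^3 / 6 * C" using third(2)[of "Suc k"] s by (simp add: mult_left_mono)
    finally have "\<bar>expectation ?R\<bar> \<le> s^3 / 6 * C" .
    moreover have "\<bar>s^2 / 2 * (expectation (\<lambda>\<omega>. cos (a \<omega>) * (?x \<omega>)^2) - v * c s k b)\<bar> \<le> s^2 / 2 * \<delta> (Suc k)"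
      unfolding abs_mult using v0 by (simp add: mult_left_mono)
    moreover have "c s (Suc k) b - (1 - v * s^2 / 2) * c s k b = expectation ?R
        - s^2 / 2 * (expectation (\<lambda>\<omega>. cos (a \<omega>) * (?x \<omega>)^2) - v * c s k b)"
      unfolding ER by (simp add: field_simps)
    ultimately show ?thesis by linarith
  qed
  \<comment> \<open>The condition on \<open>v * s^2\<close> puts the factor between 0 and 1, so the
    errors of the steps are added and never amplified.\<close>
  have chain: "\<bar>c s k b - (1 - v * s^2 / 2)^k * cos b\<bar> \<le> (\<Sum>t=1..k. s^2 / 2 * \<delta> t + s^3 / 6 * C)"
    if s: "s > 0" "v * s^2 \<le> 2" for s k
  proof (induction k)
    case 0
    show ?case by (simp add: c_def S_def prob_space)
  next
    case (Suc k)
    let ?q = "1 - v * s^2 / 2"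
    have "\<bar>?q\<bar> \<le> 1" using s(2) v by (simp add: abs_le_iff)
    then have "\<bar>?q * (c s k b - ?q^k * cos b)\<bar> \<le> (\<Sum>t=1..k. s^2 / 2 * \<delta> t + s^3 / 6 * C)"
      unfolding abs_mult using Suc.IH by (meson abs_ge_zero mult_left_le_one_le order_trans)
    moreover have "c s (Suc k) b - ?q^Suc k * cos b = (c s (Suc k) b - ?q * c s k b) + ?q * (c s k b - ?q^k * cos b)"
      by (simp add: algebra_simps)
    ultimately show ?case using step[OF s(1), of k b] by simp
  qed
  have ev: "eventually (\<lambda>T. \<bar>expectation (\<lambda>\<omega>. cos ((\<Sum>t=1..T. \<xi> t \<omega>) / sqrt T + b)) - (1
      + (- v / 2) / real T)^T * cos b\<bar>
      \<le> (\<Sum>t=1..T. \<delta> t) / real T / 2 + C / 6 / sqrt T) sequentially"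
    using eventually_ge_at_top[of "Suc (nat \<lceil>v\<rceil>)"]
  proof eventually_elim
    case (elim T)
    \<comment> \<open>For these \<open>T\<close> the step size \<open>1 / sqrt T\<close> meets the
      condition of \<open>chain\<close>. Over \<open>T\<close> steps the terms with
      \<open>s^2\<close> add up to half a Cesaro mean of \<open>\<delta>\<close>, those with
      \<open>s^3\<close> to the order \<open>1 / sqrt T\<close>.\<close>
    have T: "T > 0" "v \<le> real T" using elim by linarith+
    let ?s = "1 / sqrt (real T)"
    have s2: "?s^2 = 1 / real T" using T by (simp add: power_divide)
    have s3: "?s^3 = ?s / real T" using s2 by (simp add: power3_eq_cube power2_eq_square)
    have "\<bar>c ?s T b - (1 - v * ?s^2 / 2)^T * cos b\<bar> \<le> (\<Sum>t=1..T. ?s^2 / 2 * \<delta> t + ?s^3 / 6 * C)"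
      using T v by (intro chain) (auto simp: s2 field_simps)
    also have "\<dots> = (\<Sum>t=1..T. \<delta> t) / real T / 2 + C / 6 / sqrt T"
    proof -
      have "(\<Sum>t=1..T. 1 / real T / 2 * \<delta> t + ?s / real T / 6 * C)
          = 1 / real T / 2 * (\<Sum>t=1..T. \<delta> t) + real T * (?s / real T / 6 * C)"
        by (simp only: sum.distrib sum_distrib_left[symmetric] sum_constant card_atLeastAtMost) simp
      then show ?thesis unfolding s2 s3 using T by simp
    qed
    finally show ?case unfolding s2 by (simp add: c_def S_def mult.commute)
  qed
  have lim: "(\<lambda>T. (\<Sum>t=1..T. \<delta> t) / real T / 2 + C / 6 / sqrt (real T)) \<longlonglongrightarrow> 0 / 2 + 0"
    by (intro tendsto_add tendsto_divide cesaro_null[OF \<delta>] tendsto_const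
        tendsto_divide_0[OF tendsto_const] filterlim_at_top_imp_at_infinity
        filterlim_compose[OF sqrt_at_top filterlim_real_sequentially]) auto
  have "(\<lambda>T. expectation (\<lambda>\<omega>. cos ((\<Sum>t=1..T. \<xi> t \<omega>) / sqrt T + b)) - (1 + (- v / 2) / real T)^T * cos b) \<longlonglongrightarrow> 0"
    by (rule Lim_null_comparison[OF _ lim[simplified]]) (use ev in simp)
  moreover have "(\<lambda>T. (1 + (- v / 2) / real T)^T * cos b) \<longlonglongrightarrow> exp (- v / 2) * cos b"
    by (intro tendsto_mult tendsto_exp_limit_sequentially tendsto_const)
  ultimately show ?thesis
    using tendsto_add by (fastforce simp: mult.commute)
qed

section \<open>Events of high asymptotic probability\<close>

text \<open>The exceptional sets are covered by measurable ones, so that no measurability of \<open>Q\<close> is required.\<close>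

definition asymp_prob_ge ::
    "'w measure \<Rightarrow> real \<Rightarrow> (nat \<Rightarrow> 'w \<Rightarrow> bool) \<Rightarrow> bool" where
  "asymp_prob_ge M \<eta> Q \<longleftrightarrow>
     eventually (\<lambda>n. \<exists>B\<in>sets M. measure M B \<le> \<eta> \<and> (\<forall>\<omega>\<in>space M - B. Q n \<omega>)) sequentially"

definition whp :: "'w measure \<Rightarrow> (nat \<Rightarrow> 'w \<Rightarrow> bool) \<Rightarrow> bool" where
  "whp M Q \<longleftrightarrow> (\<forall>\<eta>>0. asymp_prob_ge M \<eta> Q)"

lemma asymp_prob_ge_mono_ev:
  assumes "asymp_prob_ge M \<eta> Q" "eventually (\<lambda>n. \<forall>\<omega>\<in>space M. Q n \<omega> \<longrightarrow> Q' n \<omega>) sequentially" "\<eta> \<le> \<eta>'"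
  shows "asymp_prob_ge M \<eta>' Q'"
  using assms(1,2) unfolding asymp_prob_ge_def
proof eventually_elim
  case (elim n)
  then show ?case using assms(3) by (meson DiffD1 order_trans)
qed

lemma asymp_prob_ge_mono:
  "asymp_prob_ge M \<eta> Q \<Longrightarrow> (\<And>n \<omega>. \<omega> \<in> space M \<Longrightarrow> Q n \<omega> \<Longrightarrow> Q' n \<omega>) \<Longrightarrow> \<eta> \<le> \<eta>' \<Longrightarrow> asymp_prob_ge M \<eta>' Q'"
  by (rule asymp_prob_ge_mono_ev) auto

lemma (in prob_space) asymp_prob_ge_conj:
  assumes "asymp_prob_ge M \<eta> Q" "asymp_prob_ge M \<eta>' Q'"
  shows "asymp_prob_ge M (\<eta> + \<eta>') (\<lambda>n \<omega>. Q n \<omega> \<and> Q' n \<omega>)"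
  using assms unfolding asymp_prob_ge_def
proof eventually_elim
  case (elim n)
  then obtain B B' where B: "B \<in> sets M" "prob B \<le> \<eta>" "\<forall>\<omega>\<in>space M - B. Q n \<omega>"
    and B': "B' \<in> sets M" "prob B' \<le> \<eta>'" "\<forall>\<omega>\<in>space M - B'. Q' n \<omega>" by blast
  have "prob (B \<union> B') \<le> \<eta> + \<eta>'"
    using measure_Un_le[OF B(1) B'(1)] B(2) B'(2) by linarith
  then show ?case using B B' by (intro bexI[of _ "B \<union> B'"]) auto
qed

lemma whpD: "whp M Q \<Longrightarrow> \<eta> > 0 \<Longrightarrow> asymp_prob_ge M \<eta> Q"
  by (simp add: whp_def)

lemma whp_mono:
  assumes "whp M Q" "\<And>n \<omega>. \<omega> \<in> space M \<Longrightarrow> Q n \<omega> \<Longrightarrow> Q' n \<omega>" shows "whp M Q'"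
  unfolding whp_def using asymp_prob_ge_mono[OF whpD[OF assms(1)] assms(2) order_refl] by simp

lemma whp_mono_ev:
  "whp M Q \<Longrightarrow> eventually (\<lambda>n. \<forall>\<omega>\<in>space M. Q n \<omega> \<longrightarrow> Q' n \<omega>) sequentially \<Longrightarrow> whp M Q'"
  unfolding whp_def using asymp_prob_ge_mono_ev[OF _ _ order_refl] by blast

lemma (in prob_space) whp_conj:
  assumes "whp M Q" "whp M Q'" shows "whp M (\<lambda>n \<omega>. Q n \<omega> \<and> Q' n \<omega>)"
  unfolding whp_def
proof (intro allI impI)
  fix \<eta> :: real assume "\<eta> > 0"
  then show "asymp_prob_ge M \<eta> (\<lambda>n \<omega>. Q n \<omega> \<and> Q' n \<omega>)"
    using asymp_prob_ge_conj[OF whpD[OF assms(1), of "\<eta>/2"] whpD[OF assms(2), of "\<eta>/2"]] by simp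
qed

text \<open>The way in which boundedness in probability is used: \<open>Q'\<close> says that some
  average is at most \<open>L\<close>, where \<open>L\<close> depends on \<open>\<eta>\<close>, so
  \<open>Q'\<close> itself need not hold with probability tending to one.\<close>

lemma (in prob_space) whp_of_asymp_prob_ge:
  assumes "\<And>\<eta>. \<eta> > 0 \<Longrightarrow> \<exists>Q'. asymp_prob_ge M \<eta> Q' \<and> whp M (\<lambda>n \<omega>. Q' n \<omega> \<longrightarrow> Q n \<omega>)"
  shows "whp M Q"
  unfolding whp_def
proof (intro allI impI)
  fix \<eta> :: real assume "\<eta> > 0"
  then obtain Q' where Q': "asymp_prob_ge M (\<eta>/2) Q'" "whp M (\<lambda>n \<omega>. Q' n \<omega> \<longrightarrow> Q n \<omega>)"
    using assms[of "\<eta>/2"] by auto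
  from asymp_prob_ge_conj[OF Q'(1) whpD[OF Q'(2), of "\<eta>/2"]] \<open>\<eta> > 0\<close>
  have "asymp_prob_ge M \<eta> (\<lambda>n \<omega>. Q' n \<omega> \<and> (Q' n \<omega> \<longrightarrow> Q n \<omega>))" by simp
  then show "asymp_prob_ge M \<eta> Q" by (rule asymp_prob_ge_mono) auto
qed

lemma asymp_prob_ge_True: "\<eta> \<ge> 0 \<Longrightarrow> (\<And>n \<omega>. \<omega> \<in> space M \<Longrightarrow> Q n \<omega>) \<Longrightarrow> asymp_prob_ge M \<eta> Q"
  unfolding asymp_prob_ge_def by (intro always_eventually allI bexI[of _ "{}"]) auto

lemma (in prob_space) whp_finite_ball:
  assumes "finite I" "\<And>i. i \<in> I \<Longrightarrow> whp M (Q i)"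
  shows "whp M (\<lambda>n \<omega>. \<forall>i\<in>I. Q i n \<omega>)"
  using assms
proof (induction I rule: finite_induct)
  case empty
  then show ?case by (simp add: whp_def asymp_prob_ge_True)
next
  case (insert i I)
  have "whp M (\<lambda>n \<omega>. Q i n \<omega> \<and> (\<forall>i\<in>I. Q i n \<omega>))" using insert by (intro whp_conj) auto
  then show ?case by (rule whp_mono) auto
qed

lemma (in prob_space) asymp_prob_geD:
  assumes "asymp_prob_ge M \<eta> Q" "\<eta> \<ge> 0"
  shows "eventually (\<lambda>n. prob {\<omega> \<in> space M. \<not> Q n \<omega>} \<le> \<eta>) sequentially"
  using assms(1) unfolding asymp_prob_ge_def
proof eventually_elim
  case (elim n)
  then obtain B where B: "B \<in> sets M" "prob B \<le> \<eta>" "\<forall>\<omega>\<in>space M - B. Q n \<omega>" by blast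
  then have "prob {\<omega> \<in> space M. \<not> Q n \<omega>} \<le> prob B" by (intro finite_measure_mono) auto
  then show ?case using B by simp
qed

lemma (in prob_space) tends_to_zero_in_probI:
  assumes "\<And>\<epsilon>. \<epsilon> > 0 \<Longrightarrow> whp M (\<lambda>n \<omega>. norm (Z n \<omega>) \<le> \<epsilon>)"
  shows "tends_to_zero_in_prob M Z"
  unfolding tends_to_zero_in_prob_def
proof (intro allI impI, rule LIMSEQ_I)
  fix \<epsilon> r :: real assume "\<epsilon> > 0" "r > 0"
  then have "eventually (\<lambda>n. prob {\<omega> \<in> space M. \<not> norm (Z n \<omega>) \<le> \<epsilon>} \<le> r / 2) sequentially"
    using whpD[OF assms] by (intro asymp_prob_geD) auto
  then have "eventually (\<lambda>n. norm (prob {\<omega> \<in> space M. norm (Z n \<omega>) > \<epsilon>} - 0) < r) sequentially"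
    by eventually_elim (use \<open>r > 0\<close> in \<open>simp add: not_le\<close>)
  then show "\<exists>no. \<forall>n\<ge>no. norm (prob {\<omega> \<in> space M. norm (Z n \<omega>) > \<epsilon>} - 0) < r"
    by (simp add: eventually_sequentially)
qed

text \<open>Measurability matters in this direction: \<open>measure\<close> is 0 on sets that are
  not measurable, so a small value alone would not yield a covering event.\<close>

lemma (in prob_space) whp_of_tends_to_zero:
  assumes Z: "tends_to_zero_in_prob M Z" and \<epsilon>: "\<epsilon> > 0"
    and meas: "eventually (\<lambda>n. Z n \<in> borel_measurable M) sequentially"
  shows "whp M (\<lambda>n \<omega>. norm (Z n \<omega>) \<le> \<epsilon>)"
  unfolding whp_def asymp_prob_ge_def
proof (intro allI impI)
  fix \<eta> :: real assume "\<eta> > 0"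
  then have "eventually (\<lambda>n. prob {\<omega> \<in> space M. norm (Z n \<omega>) > \<epsilon>} < \<eta>) sequentially"
    using Z \<epsilon> unfolding tends_to_zero_in_prob_def by (intro order_tendstoD) auto
  with meas show "eventually (\<lambda>n. \<exists>B\<in>events. prob B \<le> \<eta> \<and> (\<forall>\<omega>\<in>space M - B. norm (Z n \<omega>) \<le> \<epsilon>)) sequentially"
  proof eventually_elim
    case (elim n)
    note [measurable] = elim(1)
    have "{\<omega> \<in> space M. norm (Z n \<omega>) > \<epsilon>} \<in> events" by measurable
    then show ?case using elim(2) by (intro bexI[of _ "{\<omega> \<in> space M. norm (Z n \<omega>) > \<epsilon>}"]) auto
  qed
qed

lemma (in prob_space) asymp_prob_ge_Markov:
  fixes Z :: "nat \<Rightarrow> 'a \<Rightarrow> real"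
  assumes "eventually (\<lambda>n. integrable M (Z n) \<and> (AE \<omega> in M. Z n \<omega> \<ge> 0) \<and> expectation (Z n) \<le> C) sequentially"
      and "L > 0"
  shows "asymp_prob_ge M (C / L) (\<lambda>n \<omega>. Z n \<omega> \<le> L)"
  using assms(1) unfolding asymp_prob_ge_def
proof eventually_elim
  case (elim n)
  let ?B = "{\<omega> \<in> space M. Z n \<omega> \<ge> L}"
  have [measurable]: "Z n \<in> borel_measurable M" using elim by auto
  have B: "?B \<in> events" by measurable
  have "prob ?B \<le> expectation (Z n) / L"
    using elim \<open>L > 0\<close> by (intro integral_Markov_inequality_measure[of M _ "{}"]) auto
  also have "\<dots> \<le> C / L" using elim \<open>L > 0\<close> by (simp add: divide_right_mono)
  finally show ?case using B by (intro bexI[of _ ?B]) auto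
qed

text \<open>This is O_p(1), stochastic boundedness; finitely many initial indices are
  ignored.\<close>

definition bounded_in_prob :: "'w measure \<Rightarrow> (nat \<Rightarrow> 'w \<Rightarrow> 'b::real_normed_vector) \<Rightarrow> bool" where
  "bounded_in_prob M Z \<longleftrightarrow> (\<forall>\<eta>>0. \<exists>L>0. asymp_prob_ge M \<eta> (\<lambda>n \<omega>. norm (Z n \<omega>) \<le> L))"

lemma bounded_in_probD:
  assumes "bounded_in_prob M Z" "\<eta> > 0"
  obtains L where "L > 0" "asymp_prob_ge M \<eta> (\<lambda>n \<omega>. norm (Z n \<omega>) \<le> L)"
  using assms unfolding bounded_in_prob_def by blast

text \<open>The function \<open>u\<close> converts a bound on the quantity to which Markov's
  inequality applies into one on \<open>Z\<close>: a square root for second moments, the identity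
  for nonnegative averages.\<close>

lemma bounded_in_prob_of_Markov:
  assumes "C \<ge> 0" "\<And>L. L > 0 \<Longrightarrow> asymp_prob_ge M (C / L) (\<lambda>n \<omega>. f n \<omega> \<le> L)"
    and "\<And>L n \<omega>. \<omega> \<in> space M \<Longrightarrow> f n \<omega> \<le> L \<Longrightarrow> norm (Z n \<omega>) \<le> u L"
  shows "bounded_in_prob M Z"
  unfolding bounded_in_prob_def
proof (intro allI impI)
  fix \<eta> :: real assume \<eta>: "\<eta> > 0"
  \<comment> \<open>The summand 1 keeps \<open>L\<close> positive when \<open>C = 0\<close>.\<close>
  define L where "L = C / \<eta> + 1"
  have L: "L > 0" using assms(1) \<eta> by (simp add: L_def add_nonneg_pos)
  have "C / L \<le> \<eta>" using L \<eta> assms(1) by (simp add: L_def field_simps)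
  then have "asymp_prob_ge M \<eta> (\<lambda>n \<omega>. norm (Z n \<omega>) \<le> max 1 (u L))"
    by (rule asymp_prob_ge_mono[OF assms(2)[OF L], rotated]) (use assms(3) in \<open>auto simp: le_max_iff_disj\<close>)
  then show "\<exists>L>0. asymp_prob_ge M \<eta> (\<lambda>n \<omega>. norm (Z n \<omega>) \<le> L)"
    by (intro exI[of _ "max 1 (u L)"]) auto
qed

lemma (in prob_space) bounded_in_prob_sum:
  assumes "finite I" "\<And>i. i \<in> I \<Longrightarrow> bounded_in_prob M (Z i)"
  shows "bounded_in_prob M (\<lambda>n \<omega>. \<Sum>i\<in>I. norm (Z i n \<omega>))"
  using assms
proof (induction I rule: finite_induct)
  case empty
  then show ?case unfolding bounded_in_prob_def by (auto intro!: exI[of _ 1] asymp_prob_ge_True)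
next
  case (insert i I)
  show ?case unfolding bounded_in_prob_def
  proof (intro allI impI)
    fix \<eta> :: real assume "\<eta> > 0"
    then have h: "\<eta> / 2 > 0" by simp
    obtain L1 where L1: "L1 > 0" "asymp_prob_ge M (\<eta>/2) (\<lambda>n \<omega>. norm (Z i n \<omega>) \<le> L1)"
      by (rule bounded_in_probD[OF insert.prems[OF insertI1] h])
    obtain L2 where L2: "L2 > 0" "asymp_prob_ge M (\<eta>/2) (\<lambda>n \<omega>. norm (\<Sum>i\<in>I. norm (Z i n \<omega>)) \<le> L2)"
      by (rule bounded_in_probD[OF insert.IH[OF insert.prems[OF insertI2]] h])
    have "asymp_prob_ge M \<eta> (\<lambda>n \<omega>. norm (\<Sum>i\<in>insert i I. norm (Z i n \<omega>)) \<le> L1 + L2)"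
      by (rule asymp_prob_ge_mono[OF asymp_prob_ge_conj[OF L1(2) L2(2)]])
         (use insert.hyps in \<open>auto simp: sum_nonneg\<close>)
    then show "\<exists>L>0. asymp_prob_ge M \<eta> (\<lambda>n \<omega>. norm (\<Sum>i\<in>insert i I. norm (Z i n \<omega>)) \<le> L)"
      using L1 L2 by (intro exI[of _ "L1 + L2"]) auto
  qed
qed

lemma (in prob_space) bounded_in_prob_whp_le:
  assumes Z: "bounded_in_prob M Z" and w: "whp M (\<lambda>n \<omega>. norm (Z' n \<omega>) \<le> C * norm (Z n \<omega>) + C')" and "C \<ge> 0"
  shows "bounded_in_prob M Z'"
  unfolding bounded_in_prob_def
proof (intro allI impI)
  fix \<eta> :: real assume "\<eta> > 0"
  then have h: "\<eta> / 2 > 0" by simp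
  obtain L where L: "L > 0" "asymp_prob_ge M (\<eta>/2) (\<lambda>n \<omega>. norm (Z n \<omega>) \<le> L)" by (rule bounded_in_probD[OF Z h])
  have "asymp_prob_ge M \<eta> (\<lambda>n \<omega>. norm (Z' n \<omega>) \<le> max 1 (C * L + C'))"
  proof (rule asymp_prob_ge_mono[OF asymp_prob_ge_conj[OF L(2) whpD[OF w h]]])
    fix n \<omega> assume *: "norm (Z n \<omega>) \<le> L \<and> norm (Z' n \<omega>) \<le> C * norm (Z n \<omega>) + C'"
    then have "C * norm (Z n \<omega>) \<le> C * L" using \<open>C \<ge> 0\<close> by (simp add: mult_left_mono)
    with * show "norm (Z' n \<omega>) \<le> max 1 (C * L + C')" by linarith
  qed simp
  then show "\<exists>L>0. asymp_prob_ge M \<eta> (\<lambda>n \<omega>. norm (Z' n \<omega>) \<le> L)"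
    by (intro exI[of _ "max 1 (C * L + C')"]) auto
qed

text \<open>Slutsky's argument for one test function: the cosine is 1-Lipschitz off the exceptional
  event, and on it the difference is at most 2.\<close>

lemma (in prob_space) cos_expectation_close:
  fixes f h :: "nat \<Rightarrow> 'a \<Rightarrow> real"
  assumes f: "eventually (\<lambda>n. f n \<in> borel_measurable M) sequentially"
    and h: "eventually (\<lambda>n. h n \<in> borel_measurable M) sequentially"
    and close: "\<And>\<epsilon>. \<epsilon> > 0 \<Longrightarrow> whp M (\<lambda>n \<omega>. \<bar>f n \<omega> - h n \<omega>\<bar> \<le> \<epsilon>)"
  shows "(\<lambda>n. expectation (\<lambda>\<omega>. cos (f n \<omega>)) - expectation (\<lambda>\<omega>. cos (h n \<omega>))) \<longlonglongrightarrow> 0"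
proof (rule LIMSEQ_I)
  fix e :: real assume e: "e > 0"
  have "asymp_prob_ge M (e / 8) (\<lambda>n \<omega>. \<bar>f n \<omega> - h n \<omega>\<bar> \<le> e / 4)"
    using e by (intro whpD[OF close]) auto
  then have "eventually (\<lambda>n. \<exists>B\<in>events. prob B \<le> e / 8 \<and> (\<forall>\<omega>\<in>space M - B. \<bar>f n \<omega> - h n \<omega>\<bar> \<le> e / 4)) sequentially"
    by (simp add: asymp_prob_ge_def)
  with f h have "eventually (\<lambda>n. norm (expectation (\<lambda>\<omega>. cos (f n \<omega>)) - expectation (\<lambda>\<omega>. cos (h n \<omega>)) - 0)
      < e) sequentially"
  proof eventually_elim
    case (elim n)
    note [measurable] = elim(1,2)
    obtain B where B [measurable]: "B \<in> events" and pB: "prob B \<le> e / 8"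
        and le: "\<forall>\<omega>\<in>space M - B. \<bar>f n \<omega> - h n \<omega>\<bar> \<le> e / 4"
      using elim(3) by blast
    have ic: "integrable M (\<lambda>\<omega>. cos (f n \<omega>))" "integrable M (\<lambda>\<omega>. cos (h n \<omega>))"
      by (rule integrable_const_bound[where B = 1], simp, measurable)+
    have iB: "integrable M (indicator B :: 'a \<Rightarrow> real)"
        by (rule integrable_real_indicator) (auto simp: emeasure_eq_measure)
    have "\<bar>expectation (\<lambda>\<omega>. cos (f n \<omega>)) - expectation (\<lambda>\<omega>. cos (h n \<omega>))\<bar>
        = \<bar>expectation (\<lambda>\<omega>. cos (f n \<omega>) - cos (h n \<omega>))\<bar>"
      using ic by simp
    also have "\<dots> \<le> expectation (\<lambda>\<omega>. \<bar>cos (f n \<omega>) - cos (h n \<omega>)\<bar>)" by (rule integral_abs_bound)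
    also have "\<dots> \<le> expectation (\<lambda>\<omega>. e / 4 + 2 * indicator B \<omega>)"
    proof (rule integral_mono)
      show "integrable M (\<lambda>\<omega>. \<bar>cos (f n \<omega>) - cos (h n \<omega>)\<bar>)" using ic
          by (intro integrable_abs Bochner_Integration.integrable_diff)
      show "integrable M (\<lambda>\<omega>. e / 4 + 2 * indicator B \<omega>)" using iB by simp
      fix \<omega> assume \<omega>: "\<omega> \<in> space M"
      show "\<bar>cos (f n \<omega>) - cos (h n \<omega>)\<bar> \<le> e / 4 + 2 * indicator B \<omega>"
      proof (cases "\<omega> \<in> B")
        case True
        have "\<bar>cos (f n \<omega>) - cos (h n \<omega>)\<bar> \<le> \<bar>cos (f n \<omega>)\<bar> + \<bar>cos (h n \<omega>)\<bar>" by (rule abs_triangle_ineq4)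
        also have "\<dots> \<le> 1 + 1" by (intro add_mono abs_cos_le_one)
        finally show ?thesis using True e by simp
      next
        case False
        have "\<bar>cos (f n \<omega>) - cos (h n \<omega>)\<bar> = 2 * (\<bar>sin ((f n \<omega> + h n \<omega>) / 2)\<bar> * \<bar>sin ((h n \<omega> - f n \<omega>) / 2)\<bar>)"
          by (simp add: cos_diff_cos abs_mult)
        also have "\<dots> \<le> 2 * (1 * \<bar>(h n \<omega> - f n \<omega>) / 2\<bar>)"
          by (intro mult_left_mono mult_mono abs_sin_x_le_abs_x) auto
        also have "\<dots> = \<bar>f n \<omega> - h n \<omega>\<bar>" by simp
        also have "\<dots> \<le> e / 4" using le \<omega> False by blast
        finally show ?thesis using False by simp
      qed
    qed
    also have "\<dots> = e / 4 + 2 * prob B" using iB by (simp add: prob_space)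
    also have "\<dots> < e" using pB e by simp
    finally show ?case by simp
  qed
  then show "\<exists>no. \<forall>n\<ge>no. norm (expectation (\<lambda>\<omega>. cos (f n \<omega>)) - expectation (\<lambda>\<omega>. cos (h n \<omega>)) - 0) < e"
    by (simp add: eventually_sequentially)
qed

section \<open>Measurability and differential calculus\<close>

text \<open>Joint measurability in parameter and sample point is not assumed for the score.
  Continuity in the parameter replaces it: \<open>h\<close> is approximated by functions with
  finitely many values, for which measurability at each fixed parameter is enough.\<close>

lemma borel_measurable_caratheodory:
  fixes F :: "'c::{metric_space,second_countable_topology} \<Rightarrow> 'w \<Rightarrow> 'b::{metric_space,second_countable_topology}"
  assumes F: "\<And>\<theta>. F \<theta> \<in> borel_measurable N"
    and cont: "\<And>\<omega>. \<omega> \<in> space N \<Longrightarrow> continuous_on UNIV (\<lambda>\<theta>. F \<theta> \<omega>)"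
    and h: "h \<in> borel_measurable N"
  shows "(\<lambda>\<omega>. F (h \<omega>) \<omega>) \<in> borel_measurable N"
proof -
  obtain s where s: "\<And>i. simple_function N (s i)" "\<And>\<omega>. \<omega> \<in> space N \<Longrightarrow> (\<lambda>i. s i \<omega>) \<longlonglongrightarrow> h \<omega>"
    using borel_measurable_implies_sequence_metric[OF h] by blast
  show ?thesis
  proof (rule borel_measurable_LIMSEQ_metric)
    show "(\<lambda>\<omega>. F (s i \<omega>) \<omega>) \<in> borel_measurable N" for i
    proof (rule measurable_compose_countable'[where I = "s i ` space N"])
      show "s i \<in> measurable N (count_space (s i ` space N))"
        using s(1)[of i] by (subst measurable_count_space_eq2) (auto simp: simple_function_def)
      show "countable (s i ` space N)" using s(1)[of i] by (simp add: simple_function_def countable_finite)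
    qed (rule F)
    show "(\<lambda>i. F (s i \<omega>) \<omega>) \<longlonglongrightarrow> F (h \<omega>) \<omega>" if "\<omega> \<in> space N" for \<omega>
      by (rule continuous_on_tendsto_compose[OF cont[OF that] s(2)[OF that]]) auto
  qed
qed

text \<open>The entry type is an arbitrary Euclidean space, so two applications treat
  matrices.\<close>

lemma integrable_vec:
  fixes f :: "'x \<Rightarrow> 'c::euclidean_space^'n"
  assumes "\<And>i. integrable N (\<lambda>x. f x $ i)" shows "integrable N f"
proof -
  have eq: "f x = (\<Sum>b\<in>Basis. (f x \<bullet> b) *\<^sub>R b)" for x by (simp add: euclidean_representation)
  have "integrable N (\<lambda>x. f x \<bullet> b)" if "b \<in> Basis" for b
    using that assms by (auto simp: Basis_vec_def inner_axis)
  then have "integrable N (\<lambda>x. \<Sum>b\<in>Basis. (f x \<bullet> b) *\<^sub>R b)"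
      by (intro Bochner_Integration.integrable_sum integrable_scaleR_left)
  then show ?thesis by (simp add: euclidean_representation)
qed

lemma integral_vec_nth:
  fixes f :: "'x \<Rightarrow> 'c::euclidean_space^'n"
  assumes "integrable N f" shows "(LINT x|N. f x) $ i = (LINT x|N. f x $ i)"
  using integral_bounded_linear[OF bounded_linear_vec_nth assms] by simp

section \<open>Operator norms, Jacobians and Hessians\<close>

lemma norm_mult_spectral_norm: "norm (B *v x) \<le> spectral_norm B * norm x"
  unfolding spectral_norm_def by (intro onorm matrix_vector_mul_bounded_linear)

lemma spectral_norm_nonneg: "0 \<le> spectral_norm B"
  unfolding spectral_norm_def by (intro onorm_pos_le matrix_vector_mul_bounded_linear)

lemma matrix_entry: "B $ i $ j = (B *v axis j 1) $ i"
  by (simp add: matrix_vector_mult_def axis_def if_distrib[of "(*) _"] cong: if_cong)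

lemma entry_le_spectral_norm: "\<bar>B $ i $ j\<bar> \<le> spectral_norm B"
  using component_le_norm_cart[of "B *v axis j 1" i] norm_mult_spectral_norm[of B "axis j 1"]
  unfolding matrix_entry by (simp add: norm_axis_1)

lemma norm_mult_entrywise:
  fixes B :: "real^'n^'m"
  assumes "\<And>i j. \<bar>B $ i $ j\<bar> \<le> e"
  shows "norm (B *v x) \<le> real (CARD('m) * CARD('n)) * e * norm x"
proof -
  have "norm (B *v x) \<le> (\<Sum>i\<in>UNIV. \<bar>(B *v x) $ i\<bar>)" by (rule norm_le_l1_cart)
  also have "\<dots> \<le> (\<Sum>i\<in>(UNIV :: 'm set). \<Sum>j\<in>(UNIV :: 'n set). e * norm x)"
  proof (rule sum_mono)
    fix i
    have "\<bar>(B *v x) $ i\<bar> \<le> (\<Sum>j\<in>UNIV. \<bar>B $ i $ j * x $ j\<bar>)"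
      unfolding matrix_vector_mult_def by (simp add: sum_abs)
    also have "\<dots> \<le> (\<Sum>j\<in>(UNIV :: 'n set). e * norm x)"
    proof (rule sum_mono)
      fix j
      have "0 \<le> e" using assms[of i j] by linarith
      then show "\<bar>B $ i $ j * x $ j\<bar> \<le> e * norm x"
        unfolding abs_mult using assms[of i j] component_le_norm_cart[of x j] by (intro mult_mono) auto
    qed
    finally show "\<bar>(B *v x) $ i\<bar> \<le> (\<Sum>j\<in>(UNIV :: 'n set). e * norm x)" .
  qed
  finally show ?thesis by (simp add: mult_ac)
qed

lemma jacobian_lipschitz:
  fixes f :: "real^'n \<Rightarrow> real^'m"
  assumes "convex S" "\<And>z. z \<in> S \<Longrightarrow> f differentiable (at z)"
    and "\<And>z. z \<in> S \<Longrightarrow> spectral_norm (jacobian f (at z)) \<le> B" and "x \<in> S" "y \<in> S"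
  shows "norm (f x - f y) \<le> B * norm (x - y)"
  by (rule differentiable_bound[OF assms(1) _ _ assms(4,5), of _ "\<lambda>z v. jacobian f (at z) *v v"])
     (use assms(2,3) in \<open>auto simp: jacobian_works spectral_norm_def intro: has_derivative_at_withinI\<close>)

lemma has_derivative_component:
  fixes f :: "real^'n \<Rightarrow> real^'m"
  assumes "f differentiable (at x)"
  shows "((\<lambda>z. f z $ i) has_derivative (\<lambda>v. jacobian f (at x) $ i \<bullet> v)) (at x)"
proof -
  have "((\<lambda>z. f z $ i) has_derivative (\<lambda>v. (jacobian f (at x) *v v) $ i)) (at x)"
    using assms unfolding jacobian_works by (rule bounded_linear.has_derivative[OF bounded_linear_vec_nth])
  then show ?thesis by (simp add: matrix_vector_mult_def inner_vec_def)
qed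

text \<open>Identifies the function whose Jacobian is the Hessian with a row of the Jacobian of
  \<open>f\<close>, so that Hessian bounds control how the rows vary.\<close>

lemma gradient_component:
  fixes f :: "real^'n \<Rightarrow> real^'m"
  assumes "f differentiable (at x)"
  shows "gradient (\<lambda>z. f z $ i) x = jacobian f (at x) $ i"
  using frechet_derivative_at[OF has_derivative_component[OF assms], of i]
  by (simp add: gradient_def vec_eq_iff fun_eq_iff inner_axis) (metis inner_axis inner_real_def mult.right_neutral)

text \<open>The mean value inequality is applied twice: the Hessian bound makes each row of the
  Jacobian Lipschitz, and the component minus its linear part at \<open>c\<close> then has small
  derivative. Continuity of second derivatives is not involved; the price is the lost factor 1/2.
  The factor \<open>CARD('m)\<close> comes from summing over components.\<close>

lemma second_order_remainder:
  fixes f :: "real^'n \<Rightarrow> real^'m"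
  assumes f: "twice_differentiable f"
    and hess: "\<And>\<theta> i. norm (\<theta> - c) \<le> e0 \<Longrightarrow> spectral_norm (hessian (\<lambda>\<theta>'. f \<theta>' $ i) \<theta>) \<le> B"
    and \<theta>: "norm (\<theta> - c) \<le> e0"
  shows "norm (f \<theta> - f c - jacobian f (at c) *v (\<theta> - c)) \<le> real CARD('m) * B * (norm (\<theta> - c))^2"
proof -
  have d1: "f differentiable (at x)" and d2: "(\<lambda>z. jacobian f (at z)) differentiable (at x)" for x
    using f by (auto simp: twice_differentiable_def)
  define r where "r = norm (\<theta> - c)"
  have comp: "\<bar>(f \<theta> - f c - jacobian f (at c) *v (\<theta> - c)) $ i\<bar> \<le> B * r * r" for i
  proof -
    let ?h = "\<lambda>z. f z $ i"
    let ?g = "\<lambda>z. jacobian f (at z) $ i"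
    have grad: "gradient ?h = ?g" using gradient_component[OF d1] by auto
    have dg: "?g differentiable (at x)" for x
      using d2[of x] bounded_linear.has_derivative[OF bounded_linear_vec_nth]
      unfolding differentiable_def by blast
    have lip: "norm (?g x - ?g c) \<le> B * norm (x - c)" if "norm (x - c) \<le> e0" for x
    proof (rule jacobian_lipschitz[of "cball c e0"])
      fix z assume "z \<in> cball c e0"
      then show "spectral_norm (jacobian ?g (at z)) \<le> B"
        using hess[of z i] by (simp add: hessian_def grad dist_norm norm_minus_commute)
    qed (use dg that \<theta> in \<open>auto simp: dist_norm norm_minus_commute intro: order_trans[OF norm_ge_zero]\<close>)
    \<comment> \<open>On the ball whose radius \<open>r\<close> is exactly the distance of
      \<open>\<theta>\<close> from \<open>c\<close>, the gradient of the recentred component is at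
      most \<open>B * r\<close>.\<close>
    have "norm ((?h \<theta> - ?g c \<bullet> \<theta>) - (?h c - ?g c \<bullet> c)) \<le> B * r * norm (\<theta> - c)"
    proof (rule differentiable_bound[where S = "cball c r" and f' = "\<lambda>z v. (?g z - ?g c) \<bullet> v"])
      fix z assume z: "z \<in> cball c r"
      show "((\<lambda>z. ?h z - ?g c \<bullet> z) has_derivative (\<lambda>v. (?g z - ?g c) \<bullet> v)) (at z within cball c r)"
        unfolding inner_diff_left
        by (intro has_derivative_diff has_derivative_at_withinI[OF has_derivative_component[OF d1]]
            bounded_linear_imp_has_derivative bounded_linear_inner_right)
      have zc: "norm (z - c) \<le> r" using z by (simp add: dist_norm norm_minus_commute)
      have B: "0 \<le> B" using hess[OF \<theta>, of i] spectral_norm_nonneg order_trans by blast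
      show "onorm (\<lambda>v. (?g z - ?g c) \<bullet> v) \<le> B * r"
      proof (rule onorm_bound)
        show "0 \<le> B * r" using B by (simp add: r_def)
        fix v
        have "norm (?g z - ?g c) \<le> B * norm (z - c)" using zc \<theta> by (intro lip) (simp add: r_def)
        also have "\<dots> \<le> B * r" using zc B by (rule mult_left_mono)
        finally show "norm ((?g z - ?g c) \<bullet> v) \<le> B * r * norm v"
          using Cauchy_Schwarz_ineq2[of "?g z - ?g c" v]
          by (simp add: order_trans[OF _ mult_right_mono])
      qed
    qed (auto simp: r_def dist_norm norm_minus_commute)
    moreover have "(jacobian f (at c) *v (\<theta> - c)) $ i = ?g c \<bullet> (\<theta> - c)"
      by (simp add: matrix_vector_mult_def inner_vec_def)
    ultimately show ?thesis by (simp add: r_def inner_diff_right algebra_simps)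
  qed
  have "norm (f \<theta> - f c - jacobian f (at c) *v (\<theta> - c))
      \<le> (\<Sum>i\<in>UNIV. \<bar>(f \<theta> - f c - jacobian f (at c) *v (\<theta> - c)) $ i\<bar>)" by (rule norm_le_l1_cart)
  also have "\<dots> \<le> (\<Sum>i\<in>(UNIV :: 'm set). B * r * r)" by (intro sum_mono comp)
  finally show ?thesis by (simp add: r_def power2_eq_square mult_ac)
qed

text \<open>A partial derivative is the limit of difference quotients along the sequence 1/(n+1),
  each of which is measurable in \<open>x\<close>.\<close>

lemma jacobian_entry_measurable:
  fixes f :: "'x \<Rightarrow> real^'n \<Rightarrow> real^'m"
  assumes f: "\<And>\<theta>. (\<lambda>x. f x \<theta>) \<in> borel_measurable N"
    and d: "\<And>x. x \<in> space N \<Longrightarrow> f x differentiable (at c)"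
  shows "(\<lambda>x. jacobian (f x) (at c) $ i $ j) \<in> borel_measurable N"
proof (rule borel_measurable_LIMSEQ_real)
  let ?q = "\<lambda>n x. (f x (c + inverse (real (Suc n)) *\<^sub>R axis j 1) $ i - f x c $ i) / inverse (real (Suc n))"
  show "?q n \<in> borel_measurable N" for n
    using measurable_compose[OF f measurable_vec_nth] by measurable
  fix x assume x: "x \<in> space N"
  let ?l = "\<lambda>t::real. f x (c + t *\<^sub>R axis j 1) $ i"
  have l1: "((\<lambda>t::real. c + t *\<^sub>R axis j 1) has_derivative (\<lambda>t. t *\<^sub>R axis j 1)) (at 0)"
    by (auto intro!: derivative_eq_intros)
  have "(?l has_derivative (\<lambda>t. jacobian (f x) (at c) $ i \<bullet> (t *\<^sub>R axis j 1))) (at 0)"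
    by (rule has_derivative_compose[OF l1]) (use has_derivative_component[OF d[OF x], of i] in simp)
  then have "DERIV ?l 0 :> jacobian (f x) (at c) $ i $ j"
    by (simp add: has_field_derivative_def inner_axis mult.commute[of _ "jacobian (f x) (at c) $ i $ j"] fun_eq_iff)
  then have "((\<lambda>h. (?l h - ?l 0) / h) \<longlongrightarrow> jacobian (f x) (at c) $ i $ j) (at 0)"
    by (simp add: DERIV_def)
  moreover have "filterlim (\<lambda>n. inverse (real (Suc n))) (at 0) sequentially"
    using LIMSEQ_inverse_real_of_nat by (auto simp: filterlim_at)
  ultimately have "(\<lambda>n. (?l (inverse (real (Suc n))) - ?l 0) / inverse (real (Suc n)))
      \<longlonglongrightarrow> jacobian (f x) (at c) $ i $ j"
    by (rule filterlim_compose)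
  then show "(\<lambda>n. ?q n x) \<longlonglongrightarrow> jacobian (f x) (at c) $ i $ j" by simp
qed

section \<open>Inverse probability weighting\<close>

context contextual_bandit
begin

section \<open>The observed history and its sigma-algebras\<close>

abbreviation "hist \<equiv> history X \<pi> A Y"
abbreviation "\<F> \<equiv> history_algebra M X \<pi> A Y"
abbreviation "\<G> \<equiv> decision_algebra M X \<pi> A Y"
abbreviation "TS \<equiv> (restrict_space borel \<X> \<Otimes>\<^sub>M borel :: ((real^'p) \<times> (real^'k)) measure)"
abbreviation "XP t \<omega> \<equiv> (X t \<omega>, P t \<omega>)"

lemma XP_measurable [measurable]: "t \<ge> 1 \<Longrightarrow> XP t \<in> measurable M TS"
  using context_measurable potential_outcomes_measurable by (intro measurable_Pair) auto

lemma X_in: "t \<ge> 1 \<Longrightarrow> \<omega> \<in> space M \<Longrightarrow> X t \<omega> \<in> \<X>"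
  using context_measurable by (auto simp: measurable_restrict_space2_iff)

lemma X_borel: "t \<ge> 1 \<Longrightarrow> X t \<in> borel_measurable M"
  using context_measurable by (auto simp: measurable_restrict_space2_iff)

lemma D_eq: "t \<ge> 1 \<Longrightarrow> D = distr M TS (XP t)"
  using tuples_identically_distributed by simp

lemma prob_space_D: "prob_space D"
  using prob_space_distr[OF XP_measurable[of 1]] D_eq[of 1] by simp

lemma sets_D [measurable_cong]: "sets D = sets TS" using D_eq[of 1] by simp

lemma space_D: "space D = \<X> \<times> UNIV"
  using D_eq[of 1] by (simp add: space_pair_measure space_restrict_space)

lemma Y_measurable:
  assumes "t \<ge> 1" shows "Y t \<in> borel_measurable M"
proof -
  have "(\<lambda>\<omega>. P t \<omega> $ A t \<omega>) \<in> borel_measurable M"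
    by (rule measurable_compose_countable'[where I = UNIV])
       (use assms action_measurable potential_outcomes_measurable in
        \<open>auto intro: measurable_compose[OF _ measurable_vec_nth]\<close>)
  then show ?thesis by (rule measurable_cong[THEN iffD1, rotated]) (simp add: observed_outcome[OF assms])
qed

lemma history_measurable:
  assumes "\<And>\<tau>. \<tau> \<in> {1..t} \<Longrightarrow> \<pi> \<tau> \<in> borel_measurable M"
  shows "hist t \<in> measurable M (history_space t)"
proof -
  have "(\<lambda>\<omega>. \<lambda>\<tau>\<in>{1..t}. (X \<tau> \<omega>, \<pi> \<tau> \<omega>, A \<tau> \<omega>, Y \<tau> \<omega>)) \<in> measurable M (history_space t)"
    unfolding history_space_def
    by (intro measurable_restrict measurable_Pair)
       (use assms X_borel action_measurable Y_measurable in auto)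
  then show ?thesis by (simp add: history_def[abs_def])
qed

lemma space_algebras [simp]: "space (\<F> t) = space M" "space (\<G> t) = space M"
  by (simp_all add: history_algebra_def decision_algebra_def)

lemma decision_subalgebra_aux:
  assumes "hist (t - 1) \<in> measurable M (history_space (t - 1))" "t \<ge> 1"
  shows "subalgebra M (\<G> t)"
proof -
  have "(\<lambda>\<omega>. (hist (t - 1) \<omega>, X t \<omega>)) \<in> measurable M (history_space (t - 1) \<Otimes>\<^sub>M borel)"
    using assms X_borel by (intro measurable_Pair) auto
  then show ?thesis
    unfolding subalgebra_def decision_algebra_def by (auto dest: sets_image_in_sets[OF refl])
qed

text \<open>By assumption \<open>\<pi> t\<close> is measurable for \<open>\<G> t\<close>, but
  \<open>\<G> t\<close> is known to lie inside \<open>M\<close> only once the earlier policies,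
  which belong to the history, are measurable. Hence the induction over all earlier times.\<close>

lemma \<pi>_measurable: "t \<ge> 1 \<Longrightarrow> \<pi> t \<in> borel_measurable M"
proof (induction t rule: less_induct)
  case (less t)
  have "hist (t - 1) \<in> measurable M (history_space (t - 1))"
    by (rule history_measurable) (use less in auto)
  from decision_subalgebra_aux[OF this less.prems] policy_measurable[OF less.prems]
  show ?case by (rule measurable_from_subalg)
qed

lemma hist_measurable: "hist t \<in> measurable M (history_space t)"
  by (rule history_measurable) (simp add: \<pi>_measurable)

lemma subalgebra_G: "t \<ge> 1 \<Longrightarrow> subalgebra M (\<G> t)"
  by (rule decision_subalgebra_aux[OF hist_measurable])

lemma subalgebra_F: "subalgebra M (\<F> t)"
  using sets_image_in_sets[OF refl hist_measurable, of t] by (simp add: subalgebra_def history_algebra_def)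

lemma sigma_finite_subalgebra_G: "t \<ge> 1 \<Longrightarrow> sigma_finite_subalgebra M (\<G> t)"
  using finite_measure_subalgebra_is_sigma_finite[OF finite_measure_subalgebra.intro]
    subalgebra_G finite_measure_axioms finite_measure_subalgebra_axioms.intro by blast

lemma hist_F: "hist t \<in> measurable (\<F> t) (history_space t)"
  unfolding history_algebra_def
  by (rule measurable_vimage_algebra1) (use measurable_space[OF hist_measurable] in auto)

lemma hist_X_G: "t \<ge> 1 \<Longrightarrow> (\<lambda>\<omega>. (hist (t - 1) \<omega>, X t \<omega>)) \<in> measurable (\<G> t) (history_space (t - 1) \<Otimes>\<^sub>M borel)"
  unfolding decision_algebra_def
  by (rule measurable_vimage_algebra1)
     (use measurable_space[OF hist_measurable] in \<open>auto simp: space_pair_measure\<close>)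

lemma measurable_F_G: "f \<in> measurable (\<F> (t - 1)) N \<Longrightarrow> t \<ge> 1 \<Longrightarrow> f \<in> measurable (\<G> t) N"
proof (rule measurable_from_subalg)
  assume t: "t \<ge> 1"
  have "hist (t - 1) \<in> measurable (\<G> t) (history_space (t - 1))"
    using measurable_compose[OF hist_X_G[OF t] measurable_fst] by simp
  then show "subalgebra (\<G> t) (\<F> (t - 1))"
    unfolding subalgebra_def history_algebra_def by (auto dest: sets_image_in_sets[rotated])
qed

lemma X_G: "t \<ge> 1 \<Longrightarrow> X t \<in> measurable (\<G> t) (restrict_space borel \<X>)"
  using measurable_compose[OF hist_X_G measurable_snd] X_in
  by (auto simp: measurable_restrict_space2_iff)

lemma observation_F:
  assumes "\<tau> \<in> {1..t}"
  shows "(\<lambda>\<omega>. (X \<tau> \<omega>, \<pi> \<tau> \<omega>, A \<tau> \<omega>, Y \<tau> \<omega>))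
    \<in> measurable (\<F> t) (borel \<Otimes>\<^sub>M borel \<Otimes>\<^sub>M count_space UNIV \<Otimes>\<^sub>M borel)"
proof -
  have "(\<lambda>\<omega>. hist t \<omega> \<tau>) \<in> measurable (\<F> t) (borel \<Otimes>\<^sub>M borel \<Otimes>\<^sub>M count_space UNIV \<Otimes>\<^sub>M borel)"
    by (rule measurable_compose[OF hist_F[unfolded history_space_def] measurable_component_singleton[OF assms]])
  then show ?thesis using assms by (simp add: history_def)
qed

lemma adapted:
  assumes "\<tau> \<in> {1..t}"
  shows "X \<tau> \<in> measurable (\<F> t) (restrict_space borel \<X>)" "\<pi> \<tau> \<in> borel_measurable (\<F> t)"
    "A \<tau> \<in> measurable (\<F> t) (count_space UNIV)" "Y \<tau> \<in> borel_measurable (\<F> t)"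
proof -
  note o = observation_F[OF assms]
  have "X \<tau> \<in> borel_measurable (\<F> t)" using measurable_compose[OF o measurable_fst] by simp
  then show "X \<tau> \<in> measurable (\<F> t) (restrict_space borel \<X>)"
    using X_in[of \<tau>] assms by (auto simp: measurable_restrict_space2_iff)
  note o2 = measurable_compose[OF o measurable_snd]
  show "\<pi> \<tau> \<in> borel_measurable (\<F> t)" using measurable_compose[OF o2 measurable_fst] by simp
  note o3 = measurable_compose[OF o2 measurable_snd]
  show "A \<tau> \<in> measurable (\<F> t) (count_space UNIV)" using measurable_compose[OF o3 measurable_fst] by simp
  show "Y \<tau> \<in> borel_measurable (\<F> t)" using measurable_compose[OF o3 measurable_snd] by simp
qed

definition ipw :: "'k \<Rightarrow> nat \<Rightarrow> 'w \<Rightarrow> real" where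
  "ipw a t \<omega> = (if A t \<omega> = a then 1 else 0) / \<pi> t \<omega> $ A t \<omega>"

text \<open>In this form the denominator no longer involves the action and is measurable for
  \<open>\<G> t\<close>.\<close>

lemma ipw_alt: "ipw a t \<omega> = (if A t \<omega> = a then 1 else 0) / \<pi> t \<omega> $ a"
  by (simp add: ipw_def)

lemma ipw_F:
  assumes "\<tau> \<in> {1..t}" shows "ipw a \<tau> \<in> borel_measurable (\<F> t)"
proof -
  have "(\<lambda>\<omega>. if A \<tau> \<omega> = a then 1 else 0 :: real) \<in> borel_measurable (\<F> t)"
    by (rule measurable_compose[OF adapted(3)[OF assms]]) simp
  then show ?thesis
    unfolding ipw_alt[abs_def]
    by (rule borel_measurable_divide) (rule measurable_compose[OF adapted(2)[OF assms] measurable_vec_nth])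
qed

lemma ipw_measurable [measurable]: "t \<ge> 1 \<Longrightarrow> ipw a t \<in> borel_measurable M"
  using measurable_from_subalg[OF subalgebra_F ipw_F[of t t]] by simp

lemma ipw_nonneg: "t \<ge> 1 \<Longrightarrow> \<omega> \<in> space M \<Longrightarrow> ipw a t \<omega> \<ge> 0"
  using policy_simplex[of t \<omega>] by (simp add: ipw_def prob_simplex_def)

section \<open>The current tuple and its independence of the past\<close>

lemma tuple_integral:
  fixes h :: "_ \<Rightarrow> 'b::{banach,second_countable_topology}"
  assumes "h \<in> borel_measurable TS" "t \<ge> 1"
  shows "integrable M (\<lambda>\<omega>. h (XP t \<omega>)) \<longleftrightarrow> integrable D h" "expectation (\<lambda>\<omega>. h (XP t \<omega>)) = (LINT z|D. h z)"
  using assms integrable_distr_eq[OF XP_measurable[OF assms(2)], of h] integral_distr[OF XP_measurable[OF assms(2)],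
      of h]
  by (simp_all add: D_eq[OF assms(2)])

text \<open>Independence of the generated sigma-algebras passes to the sub-sigma-algebras generated
  by \<open>W\<close> and by \<open>h\<close> of the tuple; then the product rule applies. The bound
  on \<open>W\<close> serves integrability.\<close>

lemma history_independence:
  assumes t: "t \<ge> 1" and W: "W \<in> borel_measurable (\<F> (t - 1))" and b: "\<And>\<omega>. \<bar>W \<omega>\<bar> \<le> (c::real)"
    and h: "h \<in> borel_measurable TS" and i: "integrable D h"
  shows "expectation (\<lambda>\<omega>. W \<omega> * h (XP t \<omega>)) = expectation W * (LINT z|D. h z)"
proof -
  have WM [measurable]: "W \<in> borel_measurable M" by (rule measurable_from_subalg[OF subalgebra_F W])
  have hM: "(\<lambda>\<omega>. h (XP t \<omega>)) \<in> borel_measurable M" by (rule measurable_compose[OF XP_measurable[OF t] h])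
  define V where "V = vimage_algebra (space M) (XP t) TS"
  have hV: "(\<lambda>\<omega>. h (XP t \<omega>)) \<in> borel_measurable V"
    unfolding V_def using measurable_space[OF XP_measurable[OF t]]
    by (intro measurable_compose[OF measurable_vimage_algebra1 h]) auto
  have "indep_set (sets V) (sets (\<F> (t - 1)))" using tuple_independent_of_history[OF t] by (simp add: V_def)
  moreover have "sigma_sets (space (\<F> (t - 1))) {W -` B \<inter> space M |B. B \<in> sets borel} \<subseteq> sets (\<F> (t - 1))"
    by (rule sets.sigma_sets_subset) (use measurable_sets[OF W] in auto)
  moreover have "sigma_sets (space V) {(\<lambda>\<omega>. h (XP t \<omega>)) -` B \<inter> space M |B. B \<in> sets borel} \<subseteq> sets V"
    by (rule sets.sigma_sets_subset) (use measurable_sets[OF hV] in \<open>auto simp: V_def\<close>)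
  moreover have "space V = space M" by (simp add: V_def)
  ultimately have "indep_set (sigma_sets (space M) {(\<lambda>\<omega>. h (XP t \<omega>)) -` B \<inter> space M |B. B \<in> sets borel})
      (sigma_sets (space M) {W -` B \<inter> space M |B. B \<in> sets borel})"
    unfolding indep_set_def by (elim indep_sets_mono_sets) (auto split: bool.split)
  then have "indep_var borel (\<lambda>\<omega>. h (XP t \<omega>)) borel W"
    unfolding indep_var_eq using hM WM by blast
  moreover have "integrable M (\<lambda>\<omega>. h (XP t \<omega>))" using tuple_integral(1)[OF h t] i by simp
  moreover have "integrable M W" by (rule integrable_const_bound[where B = c]) (use b in auto)
  ultimately have "expectation (\<lambda>\<omega>. h (XP t \<omega>) * W \<omega>) = expectation (\<lambda>\<omega>. h (XP t \<omega>)) * expectation W"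
    by (rule indep_var_lebesgue_integral)
  then show ?thesis using tuple_integral(2)[OF h t] by (simp add: mult.commute)
qed

end

section \<open>Cancellation of the inverse probability weights\<close>

locale overlap_bandit = contextual_bandit M \<X> D X P \<pi> A Y
  for M :: "'w measure" and \<X> :: "(real^'p) set" and D :: "((real^'p) \<times> (real^'k)) measure"
    and X P \<pi> A Y +
  fixes \<pi>min :: real
  assumes unconfounded: "\<And>t. t \<ge> 1 \<Longrightarrow>
      cond_indep_var M (decision_algebra M X \<pi> A Y t) (count_space UNIV) (A t) borel (P t)"
    and \<pi>min_pos: "0 < \<pi>min"
    and overlap: "\<And>t a. t \<ge> 1 \<Longrightarrow> AE \<omega> in M. \<pi> t \<omega> $ a \<ge> \<pi>min"
begin

lemma ipw_bound: "t \<ge> 1 \<Longrightarrow> AE \<omega> in M. ipw a t \<omega> \<le> 1 / \<pi>min"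
proof -
  assume "t \<ge> 1"
  from overlap[OF this, of a] show ?thesis
    by eventually_elim (use \<pi>min_pos in \<open>auto simp: ipw_alt frac_le\<close>)
qed

text \<open>Conditioning on \<open>\<G> t\<close>, unconfoundedness splits the probability of
  playing \<open>a\<close> and having outcomes in \<open>C\<close> into a product; the first factor
  is \<open>\<pi> t $ a\<close>, which cancels the denominator of the weight.\<close>

lemma ipw_rectangle:
  assumes t: "t \<ge> 1" and H: "H \<in> borel_measurable (\<G> t)" and b: "AE \<omega> in M. \<bar>H \<omega>\<bar> \<le> (c::real)" and C: "C \<in> sets borel"
  shows "expectation (\<lambda>\<omega>. H \<omega> * ipw a t \<omega> * indicator C (P t \<omega>)) = expectation (\<lambda>\<omega>. H \<omega> * indicator C (P t \<omega>))"
proof -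
  interpret G: sigma_finite_subalgebra M "\<G> t" by (rule sigma_finite_subalgebra_G[OF t])
  note from_G = measurable_from_subalg[OF subalgebra_G[OF t]]
  have \<pi>a: "(\<lambda>\<omega>. \<pi> t \<omega> $ a) \<in> borel_measurable (\<G> t)"
    using policy_measurable[OF t] by (rule measurable_compose[OF _ measurable_vec_nth])
  define K where "K \<omega> = H \<omega> / \<pi> t \<omega> $ a" for \<omega>
  have K: "K \<in> borel_measurable (\<G> t)" unfolding K_def using H \<pi>a by (rule borel_measurable_divide)
  have KM [measurable]: "K \<in> borel_measurable M" and HM [measurable]: "H \<in> borel_measurable M"
    using K H from_G by auto
  let ?SA = "A t -` {a} \<inter> space M" and ?SC = "P t -` C \<inter> space M" and ?S = "A t -` {a} \<inter> P t -` C \<inter> space M"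
  have SA: "?SA \<in> sets M" using measurable_sets[OF action_measurable[OF t], of "{a}"] by simp
  have SC: "?SC \<in> sets M" using measurable_sets[OF potential_outcomes_measurable[OF t] C] by simp
  have S: "?S \<in> sets M" using sets.Int[OF SA SC] by (simp add: Int_ac)
  have c0: "AE \<omega> in M. \<bar>K \<omega>\<bar> \<le> c / \<pi>min"
    using b overlap[OF t, of a]
  proof eventually_elim
    case (elim \<omega>)
    then show ?case using \<pi>min_pos by (simp add: K_def abs_divide frac_le)
  qed
  have "integrable M K" "integrable M H"
    by (rule integrable_const_bound[OF _ KM], use c0 in simp) (rule integrable_const_bound[OF _ HM], use b in simp)
  then have iS: "integrable M (\<lambda>\<omega>. K \<omega> * indicator ?S \<omega>)" and iC: "integrable M (\<lambda>\<omega>. H \<omega> * indicator ?SC \<omega>)"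
    using integrable_real_mult_indicator S SC by blast+
  have ci: "AE \<omega> in M. real_cond_exp M (\<G> t) (indicator ?S) \<omega> =
        real_cond_exp M (\<G> t) (indicator ?SA) \<omega> * real_cond_exp M (\<G> t) (indicator ?SC) \<omega>"
    using unconfounded[OF t] C unfolding cond_indep_var_def by auto
  have SA_eq: "?SA = {\<omega> \<in> space M. A t \<omega> = a}" by auto
  have "expectation (\<lambda>\<omega>. H \<omega> * ipw a t \<omega> * indicator C (P t \<omega>)) = expectation (\<lambda>\<omega>. K \<omega> * indicator ?S \<omega>)"
    by (intro Bochner_Integration.integral_cong refl) (auto simp: K_def ipw_alt indicator_def)
  also have "\<dots> = expectation (\<lambda>\<omega>. K \<omega> * real_cond_exp M (\<G> t) (indicator ?S) \<omega>)"
    by (rule G.real_cond_exp_intg(2)[symmetric]) (use iS K S in auto)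
  also have "\<dots> = expectation (\<lambda>\<omega>. H \<omega> * real_cond_exp M (\<G> t) (indicator ?SC) \<omega>)"
  proof (rule integral_cong_AE)
    show "AE \<omega> in M. K \<omega> * real_cond_exp M (\<G> t) (indicator ?S) \<omega> = H \<omega> * real_cond_exp M (\<G> t) (indicator ?SC) \<omega>"
      using ci action_drawn_from_policy[OF t, of a] overlap[OF t, of a]
    proof eventually_elim
      case (elim \<omega>)
      then show ?case using \<pi>min_pos unfolding SA_eq by (simp add: K_def)
    qed
  qed auto
  also have "\<dots> = expectation (\<lambda>\<omega>. H \<omega> * indicator ?SC \<omega>)"
    by (rule G.real_cond_exp_intg(2)) (use iC H SC in auto)
  also have "\<dots> = expectation (\<lambda>\<omega>. H \<omega> * indicator C (P t \<omega>))"
    by (intro Bochner_Integration.integral_cong refl) (auto simp: indicator_def)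
  finally show ?thesis .
qed

text \<open>Unconfoundedness is a statement about rectangles; uniqueness of measures extends the cancellation
  of the weights to all functions of the tuple.\<close>

lemma ipw_distr:
  assumes t: "t \<ge> 1" and U: "U \<in> borel_measurable (\<G> t)" and U0: "\<And>\<omega>. \<omega> \<in> space M \<Longrightarrow> U \<omega> \<ge> 0"
    and b: "AE \<omega> in M. \<bar>U \<omega>\<bar> \<le> (c::real)"
  shows "distr (density M (\<lambda>\<omega>. ennreal (U \<omega> * ipw a t \<omega>))) TS (XP t)
      = distr (density M (\<lambda>\<omega>. ennreal (U \<omega>))) TS (XP t)"
    (is "distr ?M1 TS _ = distr ?M2 TS _")
proof -
  have UM [measurable]: "U \<in> borel_measurable M" by (rule measurable_from_subalg[OF subalgebra_G[OF t] U])
  note [measurable] = XP_measurable[OF t] ipw_measurable[OF t]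
  let ?E = "{B \<times> C | B C. B \<in> sets (restrict_space borel \<X>) \<and> C \<in> sets (borel :: (real^'k) measure)}"
  have em: "emeasure (distr (density M (\<lambda>\<omega>. ennreal (V \<omega>))) TS (XP t)) (B \<times> C)
      = ennreal (expectation (\<lambda>\<omega>. V \<omega> * indicator B (X t \<omega>) * indicator C (P t \<omega>)))"
    if [measurable]: "V \<in> borel_measurable M" and V0: "\<And>\<omega>. \<omega> \<in> space M \<Longrightarrow> V \<omega> \<ge> 0" and Vb: "AE \<omega> in M. \<bar>V \<omega>\<bar> \<le> c'"
      and B: "B \<in> sets (restrict_space borel \<X>)" and C: "C \<in> sets borel" for V B C c'
  proof -
    have S: "XP t -` (B \<times> C) \<inter> space M \<in> sets M"
      using B C by (intro measurable_sets[OF XP_measurable[OF t]]) auto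
    have eq: "ennreal (V \<omega>) * indicator (XP t -` (B \<times> C) \<inter> space M) \<omega>
        = ennreal (V \<omega> * indicator B (X t \<omega>) * indicator C (P t \<omega>))" if "\<omega> \<in> space M" for \<omega>
      using that by (auto simp: indicator_def)
    have "emeasure (distr (density M (\<lambda>\<omega>. ennreal (V \<omega>))) TS (XP t)) (B \<times> C)
        = (\<integral>\<^sup>+\<omega>. ennreal (V \<omega> * indicator B (X t \<omega>) * indicator C (P t \<omega>)) \<partial>M)"
      using B C S by (subst emeasure_distr) (auto simp: emeasure_density eq intro!: nn_integral_cong)
    also have "\<dots> = ennreal (expectation (\<lambda>\<omega>. V \<omega> * indicator B (X t \<omega>) * indicator C (P t \<omega>)))"
    proof (rule nn_integral_eq_integral)
      have "(\<lambda>\<omega>. V \<omega> * indicator (XP t -` (B \<times> C) \<inter> space M) \<omega>) \<in> borel_measurable M" using S by measurable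
      then have "(\<lambda>\<omega>. V \<omega> * indicator B (X t \<omega>) * indicator C (P t \<omega>)) \<in> borel_measurable M"
        by (rule measurable_cong[THEN iffD1, rotated]) (auto simp: indicator_def)
      then show "integrable M (\<lambda>\<omega>. V \<omega> * indicator B (X t \<omega>) * indicator C (P t \<omega>))"
      proof (rule integrable_const_bound[where B = c', rotated])
        show "AE \<omega> in M. norm (V \<omega> * indicator B (X t \<omega>) * indicator C (P t \<omega>)) \<le> c'"
          using Vb by eventually_elim (auto simp: indicator_def)
      qed
    qed (auto simp: indicator_def intro!: AE_I2 V0)
    finally show ?thesis .
  qed
  have b1: "AE \<omega> in M. \<bar>U \<omega> * ipw a t \<omega>\<bar> \<le> c * (1 / \<pi>min)"
    using b ipw_bound[OF t, of a] AE_space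
  proof eventually_elim
    case (elim \<omega>)
    then show ?case unfolding abs_mult using ipw_nonneg[OF t, of \<omega> a] by (intro mult_mono) auto
  qed
  have rect: "emeasure (distr ?M1 TS (XP t)) (B \<times> C) = emeasure (distr ?M2 TS (XP t)) (B \<times> C)"
    if B: "B \<in> sets (restrict_space borel \<X>)" and C: "C \<in> sets borel" for B C
  proof -
    \<comment> \<open>The context is part of \<open>\<G> t\<close>, so the context side of the
      rectangle is absorbed into the factor \<open>H\<close> of
      \<open>ipw_rectangle\<close>.\<close>
    have "(\<lambda>\<omega>. U \<omega> * indicator B (X t \<omega>)) \<in> borel_measurable (\<G> t)"
      using U measurable_compose[OF X_G[OF t] borel_measurable_indicator[OF B]] by (rule borel_measurable_times)
    moreover have "AE \<omega> in M. \<bar>U \<omega> * indicator B (X t \<omega>)\<bar> \<le> c"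
      using b by eventually_elim (auto simp: indicator_def)
    ultimately have "expectation (\<lambda>\<omega>. U \<omega> * indicator B (X t \<omega>) * ipw a t \<omega> * indicator C (P t \<omega>))
        = expectation (\<lambda>\<omega>. U \<omega> * indicator B (X t \<omega>) * indicator C (P t \<omega>))"
      using C by (intro ipw_rectangle[OF t])
    then show ?thesis
      by (subst em[OF _ _ b1 B C], use U0 ipw_nonneg[OF t] in simp_all)
         (subst em[OF _ _ b B C], use U0 in \<open>simp_all add: mult_ac\<close>)
  qed
  show ?thesis
  proof (rule measure_eqI_generator_eq[where E = ?E and \<Omega> = "\<X> \<times> UNIV" and A = "\<lambda>_. \<X> \<times> UNIV"])
    show "Int_stable ?E" by (rule Int_stable_pair_measure_generator)
    show "?E \<subseteq> Pow (\<X> \<times> UNIV)"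
      using sets.sets_into_space[of _ "restrict_space borel \<X>"] by (auto simp: space_restrict_space)
    show "emeasure (distr ?M1 TS (XP t)) Z = emeasure (distr ?M2 TS (XP t)) Z" if "Z \<in> ?E" for Z
      using that rect by auto
    have "sets TS = sigma_sets (\<X> \<times> UNIV) ?E"
      unfolding sets_pair_measure by (simp add: space_restrict_space)
    then show "sets (distr ?M1 TS (XP t)) = sigma_sets (\<X> \<times> UNIV) ?E"
      "sets (distr ?M2 TS (XP t)) = sigma_sets (\<X> \<times> UNIV) ?E" by simp_all
    have "\<X> \<in> sets (restrict_space borel \<X>)"
      using sets.top[of "restrict_space borel \<X>"] by (simp add: space_restrict_space)
    then have X_E: "\<X> \<times> UNIV \<in> ?E"
      unfolding mem_Collect_eq by (intro exI[of _ \<X>] exI[of _ UNIV] conjI refl) simp_all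
    show "range (\<lambda>_. \<X> \<times> UNIV) \<subseteq> ?E" by (intro image_subsetI X_E)
    have "(\<lambda>\<omega>. U \<omega> * ipw a t \<omega>) \<in> borel_measurable M" "\<And>\<omega>. \<omega> \<in> space M \<Longrightarrow> U \<omega> * ipw a t \<omega> \<ge> 0"
      using U0 ipw_nonneg[OF t] by simp_all
    from em[OF this b1 \<open>\<X> \<in> sets _\<close>, of UNIV]
    show "emeasure (distr ?M1 TS (XP t)) (\<X> \<times> UNIV) \<noteq> \<infinity>" by simp
    show "(\<Union>i. (\<lambda>_::nat. \<X> \<times> UNIV) i) = \<X> \<times> UNIV" by simp
  qed
qed

text \<open>Equal image measures have equal integrals. \<open>U\<close> may look at the current
  context as well as at the past, which the variance computation needs for
  \<open>1 / \<pi> t\<close>.\<close>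

lemma ipw_integral:
  fixes h :: "_ \<Rightarrow> real"
  assumes t: "t \<ge> 1" and U: "U \<in> borel_measurable (\<G> t)" and b: "AE \<omega> in M. \<bar>U \<omega>\<bar> \<le> (c::real)"
    and h: "h \<in> borel_measurable TS" and i: "integrable D h"
  shows "integrable M (\<lambda>\<omega>. U \<omega> * h (XP t \<omega>))" "integrable M (\<lambda>\<omega>. U \<omega> * ipw a t \<omega> * h (XP t \<omega>))"
    "expectation (\<lambda>\<omega>. U \<omega> * ipw a t \<omega> * h (XP t \<omega>)) = expectation (\<lambda>\<omega>. U \<omega> * h (XP t \<omega>))"
proof -
  have hM [measurable]: "(\<lambda>\<omega>. h (XP t \<omega>)) \<in> borel_measurable M" by (rule measurable_compose[OF XP_measurable[OF t] h])
  have ih: "integrable M (\<lambda>\<omega>. h (XP t \<omega>))" using tuple_integral(1)[OF h t] i by simp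
  note [measurable] = ipw_measurable[OF t]
  have iV: "integrable M (\<lambda>\<omega>. V \<omega> * h (XP t \<omega>))"
    if [measurable]: "V \<in> borel_measurable M" and Vb: "AE \<omega> in M. \<bar>V \<omega>\<bar> \<le> c'" for V c'
  proof (rule Bochner_Integration.integrable_bound[OF integrable_mult_right[OF ih, of c']])
    show "AE \<omega> in M. norm (V \<omega> * h (XP t \<omega>)) \<le> norm (c' * h (XP t \<omega>))"
      using Vb by eventually_elim (simp add: abs_mult mult_right_mono)
  qed measurable
  have UM [measurable]: "U \<in> borel_measurable M" by (rule measurable_from_subalg[OF subalgebra_G[OF t] U])
  show "integrable M (\<lambda>\<omega>. U \<omega> * h (XP t \<omega>))" by (rule iV[OF UM b])
  have iw: "integrable M (\<lambda>\<omega>. V \<omega> * ipw a t \<omega> * h (XP t \<omega>))"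
    if Vm [measurable]: "V \<in> borel_measurable M" and Vb: "AE \<omega> in M. \<bar>V \<omega>\<bar> \<le> c'" for V c'
  proof (rule iV)
    show "AE \<omega> in M. \<bar>V \<omega> * ipw a t \<omega>\<bar> \<le> c' * (1 / \<pi>min)"
      using Vb ipw_bound[OF t, of a] AE_space
    proof eventually_elim
      case (elim \<omega>)
      then show ?case unfolding abs_mult using ipw_nonneg[OF t, of \<omega> a] by (intro mult_mono) auto
    qed
  qed measurable
  show "integrable M (\<lambda>\<omega>. U \<omega> * ipw a t \<omega> * h (XP t \<omega>))" by (rule iw[OF UM b])
  have pos: "expectation (\<lambda>\<omega>. V \<omega> * ipw a t \<omega> * h (XP t \<omega>)) = expectation (\<lambda>\<omega>. V \<omega> * h (XP t \<omega>))"
    if V: "V \<in> borel_measurable (\<G> t)" and V0: "\<And>\<omega>. \<omega> \<in> space M \<Longrightarrow> V \<omega> \<ge> 0" and Vb: "AE \<omega> in M. \<bar>V \<omega>\<bar> \<le> c'" for V c'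
  proof -
    have VM [measurable]: "V \<in> borel_measurable M" by (rule measurable_from_subalg[OF subalgebra_G[OF t] V])
    have dens: "(LINT z|distr (density M (\<lambda>\<omega>. ennreal (V' \<omega>))) TS (XP t). h z) = expectation (\<lambda>\<omega>. V' \<omega> * h (XP t \<omega>))"
      if [measurable]: "V' \<in> borel_measurable M" and "\<And>\<omega>. \<omega> \<in> space M \<Longrightarrow> V' \<omega> \<ge> 0" for V'
    proof -
      have "(LINT z|distr (density M (\<lambda>\<omega>. ennreal (V' \<omega>))) TS (XP t). h z)
          = (LINT \<omega>|density M (\<lambda>\<omega>. ennreal (V' \<omega>)). h (XP t \<omega>))"
        using XP_measurable[OF t] h by (intro integral_distr) auto
      also have "\<dots> = expectation (\<lambda>\<omega>. V' \<omega> *\<^sub>R h (XP t \<omega>))"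
        using that by (intro integral_density) auto
      finally show ?thesis by simp
    qed
    show ?thesis
      using dens[of "\<lambda>\<omega>. V \<omega> * ipw a t \<omega>"] dens[OF VM V0] ipw_distr[OF t V V0 Vb, of a] V0 ipw_nonneg[OF t]
      by simp
  qed
  \<comment> \<open>Densities must be nonnegative on the whole space, whereas the bound on
    \<open>U\<close> holds almost everywhere only. \<open>U\<close> is therefore clipped and shifted
    by a constant, and the constant is subtracted again by linearity.\<close>
  define c' where "c' = \<bar>c\<bar>"
  define V where "V \<omega> = max (- c') (min c' (U \<omega>)) + c'" for \<omega>
  have VG: "V \<in> borel_measurable (\<G> t)" unfolding V_def using U by measurable
  have VM [measurable]: "V \<in> borel_measurable M" by (rule measurable_from_subalg[OF subalgebra_G[OF t] VG])
  have VU: "AE \<omega> in M. V \<omega> = U \<omega> + c'" using b by eventually_elim (auto simp: V_def c'_def)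
  have Vb: "AE \<omega> in M. \<bar>V \<omega>\<bar> \<le> 2 * c'" by (auto simp: V_def c'_def)
  have V0: "V \<omega> \<ge> 0" for \<omega> by (auto simp: V_def c'_def)
  have "expectation (\<lambda>\<omega>. U \<omega> * ipw a t \<omega> * h (XP t \<omega>))
      = expectation (\<lambda>\<omega>. V \<omega> * ipw a t \<omega> * h (XP t \<omega>) - c' * ipw a t \<omega> * h (XP t \<omega>))"
  proof (rule integral_cong_AE)
    show "AE \<omega> in M. U \<omega> * ipw a t \<omega> * h (XP t \<omega>) = V \<omega> * ipw a t \<omega> * h (XP t \<omega>) - c' * ipw a t \<omega> * h (XP t \<omega>)"
      using VU by eventually_elim (simp add: algebra_simps)
  qed simp_all
  also have "\<dots> = expectation (\<lambda>\<omega>. V \<omega> * ipw a t \<omega> * h (XP t \<omega>)) - expectation (\<lambda>\<omega>. c' * ipw a t \<omega> * h (XP t \<omega>))"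
    by (rule Bochner_Integration.integral_diff) (rule iw[OF VM Vb], rule iw[of "\<lambda>_. c'" c'], auto simp: c'_def)
  also have "\<dots> = expectation (\<lambda>\<omega>. V \<omega> * h (XP t \<omega>)) - expectation (\<lambda>\<omega>. c' * h (XP t \<omega>))"
    using pos[OF VG V0 Vb] pos[of "\<lambda>_. c'" c'] by (simp add: c'_def)
  also have "\<dots> = expectation (\<lambda>\<omega>. V \<omega> * h (XP t \<omega>) - c' * h (XP t \<omega>))"
    by (rule Bochner_Integration.integral_diff[symmetric]) (rule iV[OF VM Vb], rule iV[of "\<lambda>_. c'" c'], auto simp:
        c'_def)
  also have "\<dots> = expectation (\<lambda>\<omega>. U \<omega> * h (XP t \<omega>))"
  proof (rule integral_cong_AE)
    show "AE \<omega> in M. V \<omega> * h (XP t \<omega>) - c' * h (XP t \<omega>) = U \<omega> * h (XP t \<omega>)"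
      using VU by eventually_elim (simp add: algebra_simps)
  qed simp_all
  finally show "expectation (\<lambda>\<omega>. U \<omega> * ipw a t \<omega> * h (XP t \<omega>)) = expectation (\<lambda>\<omega>. U \<omega> * h (XP t \<omega>))" .
qed

end

context overlap_bandit
begin

abbreviation "OS \<equiv> (restrict_space borel \<X> \<Otimes>\<^sub>M borel :: ((real^'p) \<times> real) measure)"
text \<open>Only functions of the context and the outcome of arm \<open>a\<close> give weighted summands that are
  measurable with respect to the observed history.\<close>

abbreviation "arm a h \<equiv> (\<lambda>(x, p). h x (p $ a))"

lemma arm_measurable:
  assumes "(\<lambda>(x, y). h x y) \<in> measurable OS N"
  shows "arm a h \<in> measurable TS N"
proof -
  have "(\<lambda>z. (fst z, snd z $ a)) \<in> measurable TS OS"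
    by (intro measurable_Pair measurable_fst measurable_compose[OF measurable_snd measurable_vec_nth])
  from measurable_compose[OF this assms] show ?thesis by (simp add: case_prod_unfold)
qed

text \<open>Sending \<open>y\<close> to the constant vector is a right inverse of the projection to
  coordinate \<open>a\<close>. Measurability of an envelope in the pair of context and outcome is
  thus recovered from integrability under \<open>D\<close>, where the envelope occurs only after the
  projection.\<close>

lemma measurable_of_arm:
  assumes "arm a h \<in> measurable TS N"
  shows "(\<lambda>(x, y). h x y) \<in> measurable OS N"
proof -
  have "(\<lambda>z. (fst z, (\<chi> i. snd z) :: real^'k)) \<in> measurable OS TS"
    by (intro measurable_Pair measurable_fst measurable_vec_lambda) measurable
  from measurable_compose[OF this assms] show ?thesis by (simp add: case_prod_unfold)
qed

text \<open>Where another arm is played, both sides vanish; where \<open>a\<close> is played, the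
  observed outcome is the potential one.\<close>

lemma ipw_observed: "t \<ge> 1 \<Longrightarrow> \<omega> \<in> space M \<Longrightarrow> ipw a t \<omega> * h (X t \<omega>) (Y t \<omega>) = ipw a t \<omega> * arm a h (XP t \<omega>)"
  by (simp add: ipw_def observed_outcome)

lemma observed_F:
  assumes "(\<lambda>(x, y). h x y) \<in> measurable OS N" "\<tau> \<in> {1..t}"
  shows "(\<lambda>\<omega>. h (X \<tau> \<omega>) (Y \<tau> \<omega>)) \<in> measurable (\<F> t) N"
  using measurable_compose[OF measurable_Pair[OF adapted(1,4)[OF assms(2)]] assms(1)] by simp

text \<open>Weight cancellation followed by independence of the past: the substitute for independent
  summands.\<close>

lemma ipw_martingale_bounded:
  assumes t: "t \<ge> 1" and W: "W \<in> borel_measurable (\<F> (t - 1))" and b: "\<And>\<omega>. \<bar>W \<omega>\<bar> \<le> (c::real)"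
    and h: "h \<in> borel_measurable TS" and i: "integrable D h"
  shows "expectation (\<lambda>\<omega>. W \<omega> * ipw a t \<omega> * h (XP t \<omega>)) = expectation W * (LINT z|D. h z)"
  using ipw_integral(3)[OF t measurable_F_G[OF W t] AE_I2[OF b] h i] history_independence[OF t W b h i] by simp

text \<open>In second moments of sums, \<open>W\<close> is a partial sum and only square integrable.
  It is truncated, and dominated convergence with
  \<open>\<bar>W\<bar> * \<bar>h\<bar> \<le> W^2 + h^2\<close> removes the truncation.\<close>

lemma ipw_martingale_L2:
  assumes t: "t \<ge> 1" and W: "W \<in> borel_measurable (\<F> (t - 1))" and W2: "integrable M (\<lambda>\<omega>. (W \<omega>)^2 :: real)"
    and h: "h \<in> borel_measurable TS" and h2: "integrable D (\<lambda>z. (h z)^2)"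
  shows "integrable M (\<lambda>\<omega>. W \<omega> * ipw a t \<omega> * h (XP t \<omega>))"
    "expectation (\<lambda>\<omega>. W \<omega> * ipw a t \<omega> * h (XP t \<omega>)) = expectation W * (LINT z|D. h z)"
proof -
  interpret D: prob_space D by (rule prob_space_D)
  have hD [measurable]: "h \<in> borel_measurable D" using h by (simp add: measurable_cong_sets[OF sets_D refl])
  have hM [measurable]: "(\<lambda>\<omega>. h (XP t \<omega>)) \<in> borel_measurable M" by (rule measurable_compose[OF XP_measurable[OF t] h])
  have WM [measurable]: "W \<in> borel_measurable M" by (rule measurable_from_subalg[OF subalgebra_F W])
  note [measurable] = ipw_measurable[OF t]
  have ih: "integrable D h" by (rule D.square_integrable_imp_integrable[OF hD h2])
  have ihM: "integrable M (\<lambda>\<omega>. (h (XP t \<omega>))^2)" using tuple_integral(1)[of "\<lambda>z. (h z)^2" t] h h2 t by simp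
  have iW: "integrable M W" by (rule square_integrable_imp_integrable[OF WM W2])
  let ?w = "\<lambda>\<omega>. ((W \<omega>)^2 + (h (XP t \<omega>))^2) * (1 / \<pi>min)"
  have iw: "integrable M ?w" using W2 ihM by (intro integrable_mult_left Bochner_Integration.integrable_add)
  \<comment> \<open>Stated for all \<open>V\<close> below \<open>\<bar>W\<bar>\<close>, so that one
    null set and one majorant serve \<open>W\<close> and all its truncations.\<close>
  have dom: "AE \<omega> in M. \<forall>V. \<bar>V\<bar> \<le> \<bar>W \<omega>\<bar> \<longrightarrow> \<bar>V * ipw a t \<omega> * h (XP t \<omega>)\<bar> \<le> ?w \<omega>"
    using ipw_bound[OF t, of a] AE_space
  proof eventually_elim
    case (elim \<omega>)
    show ?case
    proof (intro allI impI)
      fix V assume "\<bar>V\<bar> \<le> \<bar>W \<omega>\<bar>"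
      then have "\<bar>V\<bar> * \<bar>h (XP t \<omega>)\<bar> \<le> \<bar>W \<omega>\<bar> * \<bar>h (XP t \<omega>)\<bar>" by (rule mult_right_mono) simp
      also have "\<dots> \<le> (W \<omega>)^2 + (h (XP t \<omega>))^2" by (rule abs_mult_le_sum_squares)
      finally have "\<bar>V\<bar> * \<bar>h (XP t \<omega>)\<bar> * ipw a t \<omega> \<le> ?w \<omega>"
        using elim(1) ipw_nonneg[OF t elim(2), of a] by (intro mult_mono) auto
      then show "\<bar>V * ipw a t \<omega> * h (XP t \<omega>)\<bar> \<le> ?w \<omega>"
        using ipw_nonneg[OF t elim(2), of a] by (simp add: abs_mult mult_ac)
    qed
  qed
  define clip where "clip n \<omega> = max (- real n) (min (real n) (W \<omega>))" for n \<omega>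
  have clipF: "clip n \<in> borel_measurable (\<F> (t - 1))" for n unfolding clip_def using W by measurable
  have clipM [measurable]: "clip n \<in> borel_measurable M" for n by (rule measurable_from_subalg[OF subalgebra_F clipF])
  have clip_le: "\<bar>clip n \<omega>\<bar> \<le> real n" "\<bar>clip n \<omega>\<bar> \<le> \<bar>W \<omega>\<bar>" for n \<omega> by (auto simp: clip_def)
  have clip_lim: "(\<lambda>n. clip n \<omega>) \<longlonglongrightarrow> W \<omega>" for \<omega>
  proof (rule tendsto_eventually)
    show "eventually (\<lambda>n. clip n \<omega> = W \<omega>) sequentially"
      using eventually_ge_at_top[of "nat \<lceil>\<bar>W \<omega>\<bar>\<rceil>"]
    proof eventually_elim
      case (elim n)
      then have "\<bar>W \<omega>\<bar> \<le> real n" by linarith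
      then show ?case by (auto simp: clip_def)
    qed
  qed
  show "integrable M (\<lambda>\<omega>. W \<omega> * ipw a t \<omega> * h (XP t \<omega>))"
    by (rule integrable_dominated[OF iw]) (use dom in \<open>measurable, auto elim: eventually_mono\<close>)
  have "(\<lambda>n. expectation (\<lambda>\<omega>. clip n \<omega> * ipw a t \<omega> * h (XP t \<omega>))) \<longlonglongrightarrow> expectation (\<lambda>\<omega>. W \<omega> * ipw a t \<omega> * h (XP t \<omega>))"
  proof (rule integral_dominated_convergence[OF _ _ iw])
    show "AE \<omega> in M. (\<lambda>n. clip n \<omega> * ipw a t \<omega> * h (XP t \<omega>)) \<longlonglongrightarrow> W \<omega> * ipw a t \<omega> * h (XP t \<omega>)"
      by (intro AE_I2 tendsto_intros clip_lim)
    show "AE \<omega> in M. norm (clip n \<omega> * ipw a t \<omega> * h (XP t \<omega>)) \<le> ?w \<omega>" for n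
      using dom by eventually_elim (use clip_le in auto)
  qed measurable
  moreover have "expectation (\<lambda>\<omega>. clip n \<omega> * ipw a t \<omega> * h (XP t \<omega>)) = expectation (clip n) * (LINT z|D. h z)" for n
    by (rule ipw_martingale_bounded[OF t clipF clip_le(1) h ih])
  moreover have "(\<lambda>n. expectation (clip n) * (LINT z|D. h z)) \<longlonglongrightarrow> expectation W * (LINT z|D. h z)"
  proof (intro tendsto_mult_right integral_dominated_convergence)
    show "integrable M (\<lambda>\<omega>. \<bar>W \<omega>\<bar>)" using iW by simp
  qed (use clip_lim clip_le in auto)
  ultimately show "expectation (\<lambda>\<omega>. W \<omega> * ipw a t \<omega> * h (XP t \<omega>)) = expectation W * (LINT z|D. h z)"
    by (intro LIMSEQ_unique) simp_all
qed

section \<open>Laws of large numbers for weighted averages\<close>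

definition ipw_mean :: "'k \<Rightarrow> (real^'p \<Rightarrow> real \<Rightarrow> real) \<Rightarrow> nat \<Rightarrow> 'w \<Rightarrow> real" where
  "ipw_mean a h T \<omega> = (\<Sum>t=1..T. ipw a t \<omega> * h (X t \<omega>) (Y t \<omega>)) / real T"

text \<open>The centered summands are orthogonal martingale differences, so second moments add up
  although the summands are dependent.\<close>

lemma ipw_sum_second_moment:
  fixes h :: "real^'p \<Rightarrow> real \<Rightarrow> real"
  assumes h: "(\<lambda>(x, y). h x y) \<in> borel_measurable OS" and h2: "integrable D (\<lambda>z. (arm a h z)^2)"
  defines "m \<equiv> LINT z|D. arm a h z"
  defines "S \<equiv> \<lambda>T \<omega>. \<Sum>t=1..T. ipw a t \<omega> * h (X t \<omega>) (Y t \<omega>) - m"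
  obtains C where "C \<ge> 0" "\<And>T. integrable M (\<lambda>\<omega>. (S T \<omega>)^2)" "\<And>T. expectation (\<lambda>\<omega>. (S T \<omega>)^2) \<le> real T * C"
    "\<And>T. S T \<in> borel_measurable (\<F> T)"
proof -
  interpret D: prob_space D by (rule prob_space_D)
  note hA = arm_measurable[OF h, of a]
  have hD [measurable]: "arm a h \<in> borel_measurable D" using hA by (simp add: measurable_cong_sets[OF sets_D refl])
  have ih: "integrable D (arm a h)" by (rule D.square_integrable_imp_integrable[OF hD h2])
  define \<zeta> where "\<zeta> t \<omega> = ipw a t \<omega> * h (X t \<omega>) (Y t \<omega>) - m" for t \<omega>
  have \<zeta>F: "\<zeta> \<tau> \<in> borel_measurable (\<F> t)" if "\<tau> \<in> {1..t}" for \<tau> t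
    unfolding \<zeta>_def using ipw_F[OF that] observed_F[OF h that] by measurable
  have SF: "S T \<in> borel_measurable (\<F> T)" for T
  proof -
    have "S T = (\<lambda>\<omega>. \<Sum>t=1..T. \<zeta> t \<omega>)" by (simp add: S_def \<zeta>_def fun_eq_iff)
    then show ?thesis using \<zeta>F by simp
  qed
  have SM [measurable]: "S T \<in> borel_measurable M" for T by (rule measurable_from_subalg[OF subalgebra_F SF])
  \<comment> \<open>From \<open>(x - m)^2 \<le> 2 * x^2 + 2 * m^2\<close>, with the weight bounded
    by \<open>1 / \<pi>min\<close>.\<close>
  define C where "C = 2 * (1 / \<pi>min)^2 * (LINT z|D. (arm a h z)^2) + 2 * m^2"
  have C: "C \<ge> 0" unfolding C_def by (intro add_nonneg_nonneg mult_nonneg_nonneg integral_nonneg_AE) auto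
  have \<zeta>2: "integrable M (\<lambda>\<omega>. (\<zeta> t \<omega>)^2) \<and> expectation (\<lambda>\<omega>. (\<zeta> t \<omega>)^2) \<le> C" if t: "t \<ge> 1" for t
  proof -
    have [measurable]: "\<zeta> t \<in> borel_measurable M"
        by (rule measurable_from_subalg[OF subalgebra_F \<zeta>F[of t t]]) (use t in simp)
    have e2: "integrable M (\<lambda>\<omega>. (arm a h (XP t \<omega>))^2)" "expectation (\<lambda>\<omega>. (arm a h (XP t \<omega>))^2)
        = (LINT z|D. (arm a h z)^2)"
      using tuple_integral[of "\<lambda>z. (arm a h z)^2" t] hA h2 t by simp_all
    let ?w = "\<lambda>\<omega>. 2 * (1 / \<pi>min)^2 * (arm a h (XP t \<omega>))^2 + 2 * m^2"
    have iw: "integrable M ?w" using e2(1) by simp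
    have le: "AE \<omega> in M. (\<zeta> t \<omega>)^2 \<le> ?w \<omega>"
      using ipw_bound[OF t, of a] AE_space
    proof eventually_elim
      case (elim \<omega>)
      let ?x = "ipw a t \<omega> * arm a h (XP t \<omega>)"
      have "(\<zeta> t \<omega>)^2 = (?x - m)^2" by (simp only: \<zeta>_def ipw_observed[OF t elim(2), of a h])
      also have "\<dots> \<le> 2 * ?x^2 + 2 * m^2" using zero_le_power2[of "?x + m"]
          by (simp add: power2_eq_square algebra_simps)
      also have "?x^2 \<le> (1 / \<pi>min)^2 * (arm a h (XP t \<omega>))^2"
        unfolding power_mult_distrib using elim ipw_nonneg[OF t elim(2), of a]
            by (intro mult_right_mono power_mono) auto
      finally show ?case by simp
    qed
    have i: "integrable M (\<lambda>\<omega>. (\<zeta> t \<omega>)^2)"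
      by (rule integrable_dominated[OF iw]) (use le in simp_all)
    have "expectation (\<lambda>\<omega>. (\<zeta> t \<omega>)^2) \<le> expectation ?w" by (rule integral_mono_AE[OF i iw le])
    also have "\<dots> = C" using e2 by (simp add: C_def prob_space)
    finally show ?thesis using i by simp
  qed
  have main: "integrable M (\<lambda>\<omega>. (S T \<omega>)^2) \<and> expectation (\<lambda>\<omega>. (S T \<omega>)^2) \<le> real T * C" for T
  proof (induction T)
    case 0
    then show ?case by (simp add: S_def)
  next
    case (Suc T)
    let ?t = "Suc T"
    have t: "?t \<ge> 1" by simp
    have WF: "S T \<in> borel_measurable (\<F> (?t - 1))" using SF[of T] by simp
    have iS: "integrable M (S T)" by (rule square_integrable_imp_integrable[OF SM conjunct1[OF Suc]])
    have S_Suc: "S ?t \<omega> = S T \<omega> + \<zeta> ?t \<omega>" for \<omega> by (simp add: S_def \<zeta>_def)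
    note L2 = ipw_martingale_L2[OF t WF conjunct1[OF Suc] hA h2, of a]
    \<comment> \<open>\<open>S T\<close> is known before time \<open>Suc T\<close>, so the cross
      term falls under \<open>ipw_martingale_L2\<close>; the two multiples of \<open>m\<close> then
      cancel in expectation.\<close>
    have cross: "S T \<omega> * \<zeta> ?t \<omega> = S T \<omega> * ipw a ?t \<omega> * arm a h (XP ?t \<omega>) - m * S T \<omega>" if "\<omega> \<in> space M" for \<omega>
    proof -
      have "\<zeta> ?t \<omega> = ipw a ?t \<omega> * arm a h (XP ?t \<omega>) - m" 
        unfolding \<zeta>_def by (rule arg_cong[where f = "\<lambda>y. y - m"]) (rule ipw_observed[OF t that])
      then show ?thesis by (simp only: right_diff_distrib mult.assoc mult.commute[of m])
    qed
    let ?g = "\<lambda>\<omega>. S T \<omega> * ipw a ?t \<omega> * arm a h (XP ?t \<omega>) - m * S T \<omega>"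
    have "integrable M ?g"
      by (rule Bochner_Integration.integrable_diff[OF L2(1) integrable_mult_right[OF iS]])
    moreover have "integrable M (\<lambda>\<omega>. S T \<omega> * \<zeta> ?t \<omega>) = integrable M ?g"
      by (rule Bochner_Integration.integrable_cong[OF refl]) (erule cross)
    ultimately have icr: "integrable M (\<lambda>\<omega>. S T \<omega> * \<zeta> ?t \<omega>)" by (simp only:)
    have "expectation (\<lambda>\<omega>. S T \<omega> * \<zeta> ?t \<omega>) = expectation ?g"
      by (rule Bochner_Integration.integral_cong[OF refl]) (erule cross)
    also have "\<dots> = expectation (\<lambda>\<omega>. S T \<omega> * ipw a ?t \<omega> * arm a h (XP ?t \<omega>)) - m * expectation (S T)"
      by (subst Bochner_Integration.integral_diff[OF L2(1) integrable_mult_right[OF iS]]) (simp only: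
          integral_mult_right_zero)
    also have "\<dots> = 0" by (simp only: L2(2) m_def mult.commute cancel_comm_monoid_add_class.diff_cancel)
    finally have c0: "expectation (\<lambda>\<omega>. S T \<omega> * \<zeta> ?t \<omega>) = 0" .
    have sq: "(S ?t \<omega>)^2 = (S T \<omega>)^2 + 2 * (S T \<omega> * \<zeta> ?t \<omega>) + (\<zeta> ?t \<omega>)^2" for \<omega>
      unfolding S_Suc by (simp add: power2_eq_square algebra_simps)
    have "expectation (\<lambda>\<omega>. (S ?t \<omega>)^2) = expectation (\<lambda>\<omega>. (S T \<omega>)^2) + expectation (\<lambda>\<omega>. (\<zeta> ?t \<omega>)^2)"
      unfolding sq using Suc icr \<zeta>2[OF t] c0 by simp
    moreover have "integrable M (\<lambda>\<omega>. (S ?t \<omega>)^2)" unfolding sq using Suc icr \<zeta>2[OF t] by simp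
    ultimately show ?case using Suc \<zeta>2[OF t] by (simp add: distrib_right)
  qed
  show thesis by (rule that[OF C _ _ SF]) (use main in auto)
qed

lemma ipw_mean_centered:
  "T \<ge> 1 \<Longrightarrow> ipw_mean a h T \<omega> - m = (\<Sum>t=1..T. ipw a t \<omega> * h (X t \<omega>) (Y t \<omega>) - m) / real T"
  by (simp add: ipw_mean_def sum_subtractf diff_divide_distrib)

lemma ipw_mean_F:
  assumes h: "(\<lambda>(x, y). h x y) \<in> borel_measurable OS"
  shows "ipw_mean a h T \<in> borel_measurable (\<F> T)"
proof -
  have "(\<lambda>\<omega>. ipw a t \<omega> * h (X t \<omega>) (Y t \<omega>)) \<in> borel_measurable (\<F> T)" if "t \<in> {1..T}" for t
    by (intro borel_measurable_times ipw_F[OF that] observed_F[OF h that])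
  then show ?thesis unfolding ipw_mean_def by (intro borel_measurable_divide borel_measurable_sum) auto
qed

text \<open>Chebyshev at the scale of the square root. It yields the law of large numbers and also
  the tightness of the normalized score.\<close>

lemma ipw_mean_root_bounded:
  fixes h :: "real^'p \<Rightarrow> real \<Rightarrow> real"
  assumes h: "(\<lambda>(x, y). h x y) \<in> borel_measurable OS" and h2: "integrable D (\<lambda>z. (arm a h z)^2)"
  shows "bounded_in_prob M (\<lambda>T \<omega>. sqrt (real T) * (ipw_mean a h T \<omega> - (LINT z|D. arm a h z)))"
proof -
  let ?m = "LINT z|D. arm a h z"
  let ?S = "\<lambda>T \<omega>. \<Sum>t=1..T. ipw a t \<omega> * h (X t \<omega>) (Y t \<omega>) - ?m"
  obtain C where C: "C \<ge> 0" "\<And>T. integrable M (\<lambda>\<omega>. (?S T \<omega>)^2)" "\<And>T. expectation (\<lambda>\<omega>. (?S T \<omega>)^2) \<le> real T * C"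
    by (rule ipw_sum_second_moment[OF h h2]) (rule that; assumption)
  show ?thesis
  proof (rule bounded_in_prob_of_Markov[OF C(1), of M "\<lambda>T \<omega>. (?S T \<omega>)^2 / real T" _ sqrt])
    fix L :: real assume L: "L > 0"
    show "asymp_prob_ge M (C / L) (\<lambda>T \<omega>. (?S T \<omega>)^2 / real T \<le> L)"
    proof (rule asymp_prob_ge_Markov[OF _ L], rule eventually_mono[OF eventually_ge_at_top[of 1]], intro conjI)
      fix T :: nat assume T: "1 \<le> T"
      show "integrable M (\<lambda>\<omega>. (?S T \<omega>)^2 / real T)" using C(2)[of T] by simp
      show "expectation (\<lambda>\<omega>. (?S T \<omega>)^2 / real T) \<le> C" using C(3)[of T] T by (simp add: field_simps)
    qed simp
  next
    fix L :: real and T \<omega> assume le: "(?S T \<omega>)^2 / real T \<le> L"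
    show "norm (sqrt (real T) * (ipw_mean a h T \<omega> - ?m)) \<le> sqrt L"
    \<comment> \<open>At \<open>T = 0\<close> division by zero gives 0, so the assumption says
      \<open>0 \<le> L\<close> and the left side vanishes.\<close>
    proof (cases "T = 0")
      case True then show ?thesis using le by simp
    next
      case False
      have "norm (sqrt (real T) * (ipw_mean a h T \<omega> - ?m)) = \<bar>?S T \<omega>\<bar> * (sqrt (real T) / real T)"
        using False ipw_mean_centered[of T a h \<omega> ?m] by (simp add: abs_mult)
      also have "\<dots> = sqrt ((?S T \<omega>)^2 / real T)"
        unfolding real_sqrt_divide real_sqrt_abs sqrt_divide_self_eq[OF of_nat_0_le_iff] by (simp add: divide_inverse)
      finally have "norm (sqrt (real T) * (ipw_mean a h T \<omega> - ?m)) = sqrt ((?S T \<omega>)^2 / real T)" .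
      then show ?thesis using le by simp
    qed
  qed
qed

lemma ipw_mean_lln:
  fixes h :: "real^'p \<Rightarrow> real \<Rightarrow> real"
  assumes h: "(\<lambda>(x, y). h x y) \<in> borel_measurable OS" and h2: "integrable D (\<lambda>z. (arm a h z)^2)" and \<epsilon>: "\<epsilon> > 0"
  shows "whp M (\<lambda>T \<omega>. \<bar>ipw_mean a h T \<omega> - (LINT z|D. arm a h z)\<bar> \<le> \<epsilon>)"
  unfolding whp_def
proof (intro allI impI)
  let ?m = "LINT z|D. arm a h z"
  fix \<eta> :: real assume "\<eta> > 0"
  then obtain L where L: "L > 0" "asymp_prob_ge M \<eta> (\<lambda>T \<omega>. norm (sqrt (real T) * (ipw_mean a h T \<omega> - ?m)) \<le> L)"
    by (rule bounded_in_probD[OF ipw_mean_root_bounded[OF h h2]])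
  have "eventually (\<lambda>T. L / \<epsilon> < sqrt (real T)) sequentially"
    using filterlim_compose[OF sqrt_at_top filterlim_real_sequentially] by (simp add: filterlim_at_top_dense)
  then have "eventually (\<lambda>T. \<forall>\<omega>\<in>space M. norm (sqrt (real T) * (ipw_mean a h T \<omega> - ?m)) \<le> L
      \<longrightarrow> \<bar>ipw_mean a h T \<omega> - ?m\<bar> \<le> \<epsilon>) sequentially"
  proof eventually_elim
    case (elim T)
    show ?case
    proof (intro ballI impI)
      fix \<omega> assume "norm (sqrt (real T) * (ipw_mean a h T \<omega> - ?m)) \<le> L"
      then have "sqrt (real T) * \<bar>ipw_mean a h T \<omega> - ?m\<bar> \<le> L" by (simp add: abs_mult)
      also have "L < sqrt (real T) * \<epsilon>" using elim \<epsilon> by (simp add: field_simps)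
      finally have "sqrt (real T) * \<bar>ipw_mean a h T \<omega> - ?m\<bar> < sqrt (real T) * \<epsilon>" .
      then show "\<bar>ipw_mean a h T \<omega> - ?m\<bar> \<le> \<epsilon>" by (simp add: mult_less_cancel_left split: if_splits)
    qed
  qed
  from asymp_prob_ge_mono_ev[OF L(2) this order_refl] show "asymp_prob_ge M \<eta> (\<lambda>T \<omega>. \<bar>ipw_mean a h T \<omega> - ?m\<bar> \<le> \<epsilon>)" .
qed

text \<open>Serves the envelopes: a nonnegative function with only a first moment has no Chebyshev
  bound, but Markov's inequality applies because every weighted summand has the unweighted
  mean.\<close>

lemma ipw_mean_bounded:
  fixes h :: "real^'p \<Rightarrow> real \<Rightarrow> real"
  assumes h: "(\<lambda>(x, y). h x y) \<in> borel_measurable OS" and i: "integrable D (arm a h)" and h0: "\<And>x y. h x y \<ge> 0"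
  shows "bounded_in_prob M (ipw_mean a h)"
proof -
  note hA = arm_measurable[OF h, of a]
  let ?m = "LINT z|D. arm a h z"
  have m: "?m \<ge> 0" by (intro integral_nonneg_AE) (auto simp: h0)
  show ?thesis
  proof (rule bounded_in_prob_of_Markov[OF m, of M "ipw_mean a h" _ "\<lambda>L. L"])
    fix L :: real assume L: "L > 0"
    show "asymp_prob_ge M (?m / L) (\<lambda>T \<omega>. ipw_mean a h T \<omega> \<le> L)"
    proof (rule asymp_prob_ge_Markov[OF _ L], rule eventually_mono[OF eventually_ge_at_top[of 1]])
      fix T :: nat assume T: "1 \<le> T"
      have one: "(\<lambda>_. 1) \<in> borel_measurable (\<G> t)" "AE \<omega> in M. \<bar>1\<bar> \<le> (1::real)" for t by simp_all
      have each: "integrable M (\<lambda>\<omega>. ipw a t \<omega> * h (X t \<omega>) (Y t \<omega>))" "expectation (\<lambda>\<omega>. ipw a t \<omega> * h (X t \<omega>) (Y t \<omega>))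
          = ?m"
        if t: "t \<ge> 1" for t
      proof -
        note ip = ipw_integral(2,3)[OF t one hA i, of a]
        have "integrable M (\<lambda>\<omega>. ipw a t \<omega> * h (X t \<omega>) (Y t \<omega>)) = integrable M (\<lambda>\<omega>. ipw a t \<omega> * arm a h (XP t \<omega>))"
          by (rule Bochner_Integration.integrable_cong[OF refl]) (erule ipw_observed[OF t])
        then show "integrable M (\<lambda>\<omega>. ipw a t \<omega> * h (X t \<omega>) (Y t \<omega>))" using ip(1) by simp
        have "expectation (\<lambda>\<omega>. ipw a t \<omega> * h (X t \<omega>) (Y t \<omega>)) = expectation (\<lambda>\<omega>. ipw a t \<omega> * arm a h (XP t \<omega>))"
          by (rule Bochner_Integration.integral_cong[OF refl]) (erule ipw_observed[OF t])
        also have "\<dots> = ?m" using ip(2) tuple_integral(2)[OF hA t] by simp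
        finally show "expectation (\<lambda>\<omega>. ipw a t \<omega> * h (X t \<omega>) (Y t \<omega>)) = ?m" .
      qed
      have "integrable M (ipw_mean a h T)" unfolding ipw_mean_def
          by (intro integrable_divide Bochner_Integration.integrable_sum each) simp
      moreover have "expectation (ipw_mean a h T) \<le> ?m"
        unfolding ipw_mean_def using T by (simp add: Bochner_Integration.integral_sum each)
      moreover have "AE \<omega> in M. 0 \<le> ipw_mean a h T \<omega>"
        unfolding ipw_mean_def by (intro AE_I2 divide_nonneg_nonneg sum_nonneg mult_nonneg_nonneg ipw_nonneg h0) auto
      ultimately show "integrable M (ipw_mean a h T) \<and> (AE \<omega> in M. 0
          \<le> ipw_mean a h T \<omega>) \<and> expectation (ipw_mean a h T) \<le> ?m" by simp
    qed
  next
    fix L T \<omega> assume \<omega>: "\<omega> \<in> space M" and "ipw_mean a h T \<omega> \<le> L"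
    moreover have "0 \<le> ipw_mean a h T \<omega>"
      unfolding ipw_mean_def by (intro divide_nonneg_nonneg sum_nonneg mult_nonneg_nonneg ipw_nonneg h0 \<omega>) auto
    ultimately show "norm (ipw_mean a h T \<omega>) \<le> L" by simp
  qed
qed

end

section \<open>Consistency and linearization\<close>

locale ipw_estimation = overlap_bandit M \<X> D X P \<pi> A Y \<pi>min
  for M :: "'w measure" and \<X> :: "(real^'p) set" and D :: "((real^'p) \<times> (real^'k)) measure"
    and X P \<pi> A Y \<pi>min +
  fixes g :: "real^'p \<Rightarrow> real \<Rightarrow> real^'d \<Rightarrow> real^'d" and \<theta>s :: "'k \<Rightarrow> real^'d" and R :: real
  assumes g_measurable: "\<And>\<theta>. (\<lambda>(x, y). g x y \<theta>) \<in> borel_measurable (restrict_space borel \<X> \<Otimes>\<^sub>M borel)"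
    and target: "\<And>a. (LINT (x, y)|D. g x (y $ a) (\<theta>s a)) = 0"
    and identified: "\<And>a \<epsilon>. \<epsilon> > 0 \<Longrightarrow>
         (INF \<theta>\<in>{\<theta>. norm (\<theta> - \<theta>s a) > \<epsilon>}. norm (LINT (x, y)|D. g x (y $ a) \<theta>)) > 0"
    and radius: "\<And>a. norm (\<theta>s a) < R"
    and second_moment: "\<And>a. (SUP \<theta>\<in>{\<theta>. norm \<theta> \<le> R}. \<integral>\<^sup>+(x, y). ennreal ((norm (g x (y $ a) \<theta>))^2) \<partial>D) < \<infinity>"
    and twice_diff: "\<And>x y. x \<in> \<X> \<Longrightarrow> twice_differentiable (g x y)"
    and nonsingular: "\<And>a. invertible (score_jacobian_mean D g \<theta>s a)"
    and jacobian_envelope: "\<And>a. \<exists>\<phi> :: real^'p \<Rightarrow> real \<Rightarrow> real.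
         (\<forall>x\<in>\<X>. \<forall>y \<theta>. norm \<theta> \<le> R \<longrightarrow> spectral_norm (jacobian (g x y) (at \<theta>)) \<le> \<phi> x y) \<and>
         integrable D (\<lambda>(x, y). (\<phi> x (y $ a))^2)"
    and hessian_envelope: "\<And>a. \<exists>\<epsilon>0>0. \<exists>\<Phi> :: real^'p \<Rightarrow> real \<Rightarrow> real.
         (\<forall>x\<in>\<X>. \<forall>y \<theta> i. norm (\<theta> - \<theta>s a) \<le> \<epsilon>0 \<longrightarrow>
            spectral_norm (hessian (\<lambda>\<theta>'. g x y \<theta>' $ i) \<theta>) \<le> \<Phi> x y) \<and>
         integrable D (\<lambda>(x, y). \<Phi> x (y $ a))"
begin

sublocale D: prob_space D by (rule prob_space_D)

abbreviation "score \<equiv> ipw_score g X \<pi> A Y"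
abbreviation "J \<equiv> score_jacobian_mean D g \<theta>s"

section \<open>Measurability and integrability of the score\<close>

lemma borel_D: "h \<in> borel_measurable TS \<Longrightarrow> h \<in> borel_measurable D"
  by (simp add: measurable_cong_sets[OF sets_D refl])

lemma g_diff: "x \<in> \<X> \<Longrightarrow> g x y differentiable (at \<theta>)"
  using twice_diff by (simp add: twice_differentiable_def)

lemma g_component: "(\<lambda>(x, y). g x y \<theta> $ i) \<in> borel_measurable OS"
  using measurable_compose[OF g_measurable measurable_vec_nth] by (simp add: case_prod_unfold)

lemma jacobian_component: "(\<lambda>(x, y). jacobian (g x y) (at c) $ i $ j) \<in> borel_measurable OS"
proof -
  have "(\<lambda>z. jacobian ((\<lambda>(x, y). g x y) z) (at c) $ i $ j) \<in> borel_measurable OS"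
  proof (rule jacobian_entry_measurable)
    show "(\<lambda>z. (case z of (x, y) \<Rightarrow> g x y) \<theta>) \<in> borel_measurable OS" for \<theta>
      using g_measurable[of \<theta>] by (simp add: case_prod_unfold)
    show "(case z of (x, y) \<Rightarrow> g x y) differentiable (at c)" if "z \<in> space OS" for z
      using that by (auto simp: space_pair_measure space_restrict_space intro: g_diff)
  qed
  then show ?thesis by (simp add: case_prod_unfold)
qed

lemma g_norm_square_integrable:
  assumes "norm \<theta> \<le> R" shows "integrable D (\<lambda>(x, p). (norm (g x (p $ a) \<theta>))^2)"
proof (rule integrableI_bounded)
  have "(\<lambda>(x, p). g x (p $ a) \<theta>) \<in> borel_measurable D"
    by (rule borel_D[OF arm_measurable[OF g_measurable]])
  from borel_measurable_power[OF measurable_compose[OF this borel_measurable_norm], of 2]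
  show "(\<lambda>(x, p). (norm (g x (p $ a) \<theta>))^2) \<in> borel_measurable D" by (simp add: case_prod_unfold id_def)
  have "(\<integral>\<^sup>+(x, y). ennreal ((norm (g x (y $ a) \<theta>))^2) \<partial>D)
      \<le> (SUP \<theta>\<in>{\<theta>. norm \<theta> \<le> R}. \<integral>\<^sup>+(x, y). ennreal ((norm (g x (y $ a) \<theta>))^2) \<partial>D)"
    using assms by (intro SUP_upper) simp
  also have "\<dots> < \<infinity>" by (rule second_moment)
  finally show "(\<integral>\<^sup>+z. ennreal (norm (case z of (x, p) \<Rightarrow> (norm (g x (p $ a) \<theta>))^2)) \<partial>D) < \<infinity>"
    by (simp add: case_prod_unfold)
qed

lemma g_component_square_integrable:
  assumes "norm \<theta> \<le> R" shows "integrable D (\<lambda>z. (arm a (\<lambda>x y. g x y \<theta> $ i) z)^2)"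
proof (rule Bochner_Integration.integrable_bound[OF g_norm_square_integrable[OF assms, of a]])
  show "(\<lambda>z. (arm a (\<lambda>x y. g x y \<theta> $ i) z)^2) \<in> borel_measurable D"
    by (intro borel_measurable_power borel_D[OF arm_measurable[OF g_component]])
  have "(v $ i)^2 \<le> (norm v)^2" for v :: "real^'d"
    using component_le_norm_cart[of v i] by (metis abs_le_square_iff abs_norm_cancel)
  then show "AE z in D. norm ((arm a (\<lambda>x y. g x y \<theta> $ i) z)^2) \<le> norm (case z of (x, p) \<Rightarrow> (norm (g x (p $ a) \<theta>))^2)"
    by (simp add: case_prod_unfold)
qed

lemma g_integrable:
  assumes "norm \<theta> \<le> R" shows "integrable D (\<lambda>(x, p). g x (p $ a) \<theta>)"
proof (rule integrable_vec)
  fix i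
  have "integrable D (arm a (\<lambda>x y. g x y \<theta> $ i))"
    by (rule D.square_integrable_imp_integrable[OF borel_D[OF arm_measurable[OF g_component]]
        g_component_square_integrable[OF assms]])
  then show "integrable D (\<lambda>z. (case z of (x, p) \<Rightarrow> g x (p $ a) \<theta>) $ i)" by (simp add: case_prod_unfold)
qed

definition "G a \<theta> = (LINT (x, p)|D. g x (p $ a) \<theta>)"

lemma G_component:
  assumes "norm \<theta> \<le> R" shows "G a \<theta> $ i = (LINT z|D. arm a (\<lambda>x y. g x y \<theta> $ i) z)"
  unfolding G_def integral_vec_nth[OF g_integrable[OF assms]] by (simp add: case_prod_unfold)

lemma score_alt: "score a T \<theta> \<omega> = (1 / real T) *\<^sub>R (\<Sum>t=1..T. ipw a t \<omega> *\<^sub>R g (X t \<omega>) (Y t \<omega>) \<theta>)"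
  by (simp add: ipw_score_def ipw_def)

lemma score_component: "score a T \<theta> \<omega> $ i = ipw_mean a (\<lambda>x y. g x y \<theta> $ i) T \<omega>"
  by (simp add: score_alt ipw_mean_def)

lemma score_F: "score a T \<theta> \<in> borel_measurable (\<F> T)"
proof -
  have "score a T \<theta> = (\<lambda>\<omega>. \<chi> i. ipw_mean a (\<lambda>x y. g x y \<theta> $ i) T \<omega>)"
    by (simp add: fun_eq_iff vec_eq_iff score_component)
  then show ?thesis using measurable_vec_lambda[OF ipw_mean_F[OF g_component]] by simp
qed

text \<open>Differentiability makes the score continuous in the parameter. The result is needed to
  turn the assumed \<open>small_o_p\<close> into covering events by
  \<open>whp_of_tends_to_zero\<close>.\<close>

lemma score_estimator_measurable:
  assumes "\<theta>h \<in> borel_measurable (\<F> T)" shows "(\<lambda>\<omega>. score a T (\<theta>h \<omega>) \<omega>) \<in> borel_measurable (\<F> T)"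
proof (rule borel_measurable_caratheodory[OF score_F _ assms])
  fix \<omega> assume "\<omega> \<in> space (\<F> T)"
  then have "continuous_on UNIV (\<lambda>\<theta>. g (X t \<omega>) (Y t \<omega>) \<theta>)" if "t \<in> {1..T}" for t
    using X_in[of t \<omega>] that
    by (intro continuous_at_imp_continuous_on ballI differentiable_imp_continuous_within g_diff) auto
  then show "continuous_on UNIV (\<lambda>\<theta>. score a T \<theta> \<omega>)"
    unfolding score_alt by (intro continuous_on_scaleR continuous_on_const continuous_on_sum) auto
qed

lemma score_lln:
  assumes "norm \<theta> \<le> R" "\<epsilon> > 0" shows "whp M (\<lambda>T \<omega>. norm (score a T \<theta> \<omega> - G a \<theta>) \<le> \<epsilon>)"
proof -
  have "whp M (\<lambda>T \<omega>. \<forall>i\<in>(UNIV :: 'd set). \<bar>ipw_mean a (\<lambda>x y. g x y \<theta> $ i) T \<omega>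
      - (LINT z|D. arm a (\<lambda>x y. g x y \<theta> $ i) z)\<bar> \<le> \<epsilon> / CARD('d))"
    using assms by (intro whp_finite_ball ipw_mean_lln g_component g_component_square_integrable) auto
  then show ?thesis
  proof (rule whp_mono)
    fix T \<omega> assume *: "\<forall>i\<in>(UNIV :: 'd set). \<bar>ipw_mean a (\<lambda>x y. g x y \<theta> $ i) T \<omega>
        - (LINT z|D. arm a (\<lambda>x y. g x y \<theta> $ i) z)\<bar> \<le> \<epsilon> / CARD('d)"
    have "norm (score a T \<theta> \<omega> - G a \<theta>) \<le> (\<Sum>i\<in>UNIV. \<bar>(score a T \<theta> \<omega> - G a \<theta>) $ i\<bar>)" by (rule norm_le_l1_cart)
    also have "\<dots> \<le> (\<Sum>i\<in>(UNIV :: 'd set). \<epsilon> / CARD('d))"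
      using * by (intro sum_mono) (simp add: score_component G_component[OF assms(1)])
    finally show "norm (score a T \<theta> \<omega> - G a \<theta>) \<le> \<epsilon>" by simp
  qed
qed

lemma score_root_bounded:
  "bounded_in_prob M (\<lambda>T \<omega>. sqrt (real T) *\<^sub>R score a T (\<theta>s a) \<omega>)"
proof -
  let ?c = "\<lambda>i T \<omega>. sqrt (real T) * (ipw_mean a (\<lambda>x y. g x y (\<theta>s a) $ i) T \<omega>
      - (LINT z|D. arm a (\<lambda>x y. g x y (\<theta>s a) $ i) z))"
  have R: "norm (\<theta>s a) \<le> R" using radius[of a] by simp
  have zero: "(LINT z|D. arm a (\<lambda>x y. g x y (\<theta>s a) $ i) z) = 0" for i
    using target[of a] G_component[OF R, of a i] by (simp add: G_def)
  have "bounded_in_prob M (\<lambda>T \<omega>. \<Sum>i\<in>UNIV. norm (?c i T \<omega>))"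
    by (intro bounded_in_prob_sum ipw_mean_root_bounded g_component g_component_square_integrable R) simp
  then show ?thesis
  proof (rule bounded_in_prob_whp_le[where C = 1 and C' = 0])
    have "norm (sqrt (real T) *\<^sub>R score a T (\<theta>s a) \<omega>) \<le> norm (\<Sum>i\<in>UNIV. norm (?c i T \<omega>))" for T \<omega>
    proof -
      have "norm (sqrt (real T) *\<^sub>R score a T (\<theta>s a) \<omega>) \<le> (\<Sum>i\<in>UNIV. \<bar>(sqrt (real T) *\<^sub>R score a T (\<theta>s a) \<omega>) $ i\<bar>)"
        by (rule norm_le_l1_cart)
      also have "\<dots> = (\<Sum>i\<in>UNIV. norm (?c i T \<omega>))" by (simp add: score_component zero)
      also have "\<dots> \<le> norm (\<Sum>i\<in>UNIV. norm (?c i T \<omega>))" by simp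
      finally show ?thesis .
    qed
    then show "whp M (\<lambda>T \<omega>. norm (sqrt (real T) *\<^sub>R score a T (\<theta>s a) \<omega>) \<le> 1 * norm (\<Sum>i\<in>UNIV. norm (?c i T \<omega>)) + 0)"
      by (simp add: whp_def asymp_prob_ge_True)
  qed simp
qed

text \<open>Integrability of the square yields measurability of the square only; the absolute value
  of the envelope is its square root, hence measurable. It is also nonnegative outside
  \<open>\<X>\<close>, where nothing is assumed about the envelope.\<close>

lemma jacobian_envelope':
  obtains \<phi> :: "real^'p \<Rightarrow> real \<Rightarrow> real" where "\<forall>x y. \<phi> x y \<ge> 0" "(\<lambda>(x, y). \<phi> x y) \<in> borel_measurable OS"
    "\<forall>x\<in>\<X>. \<forall>y \<theta>. norm \<theta> \<le> R \<longrightarrow> spectral_norm (jacobian (g x y) (at \<theta>)) \<le> \<phi> x y"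
    "integrable D (\<lambda>z. (arm a \<phi> z)^2)" "integrable D (arm a \<phi>)"
proof -
  obtain \<psi> :: "real^'p \<Rightarrow> real \<Rightarrow> real" where
    \<psi>: "\<And>x y \<theta>. x \<in> \<X> \<Longrightarrow> norm \<theta> \<le> R \<Longrightarrow> spectral_norm (jacobian (g x y) (at \<theta>)) \<le> \<psi> x y"
      "integrable D (\<lambda>(x, y). (\<psi> x (y $ a))^2)"
    using jacobian_envelope[of a] by blast
  define \<phi> where "\<phi> x y = \<bar>\<psi> x y\<bar>" for x y
  have "arm a (\<lambda>x y. (\<psi> x y)^2) \<in> borel_measurable TS"
    using borel_measurable_integrable[OF \<psi>(2)] by (simp add: measurable_cong_sets[OF sets_D refl])
  from measurable_compose[OF measurable_of_arm[OF this] borel_measurable_sqrt]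
  have m: "(\<lambda>(x, y). \<phi> x y) \<in> borel_measurable OS" by (simp add: \<phi>_def case_prod_unfold id_def)
  have i2: "integrable D (\<lambda>z. (arm a \<phi> z)^2)" using \<psi>(2) by (simp add: \<phi>_def case_prod_unfold)
  have i: "integrable D (arm a \<phi>)"
    by (rule D.square_integrable_imp_integrable[OF borel_D[OF arm_measurable[OF m]] i2])
  show thesis
    by (rule that[OF _ m _ i2 i]) (use \<psi>(1) in \<open>auto simp: \<phi>_def intro: order_trans[OF _ abs_ge_self]\<close>)
qed

lemma hessian_envelope':
  obtains e0 and \<Phi> :: "real^'p \<Rightarrow> real \<Rightarrow> real"
      where "e0 > 0" "\<forall>x y. \<Phi> x y \<ge> 0" "(\<lambda>(x, y). \<Phi> x y) \<in> borel_measurable OS"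
    "\<forall>x\<in>\<X>. \<forall>y \<theta> i. norm (\<theta> - \<theta>s a) \<le> e0 \<longrightarrow> spectral_norm (hessian (\<lambda>\<theta>'. g x y \<theta>' $ i) \<theta>) \<le> \<Phi> x y"
    "integrable D (arm a \<Phi>)"
proof -
  obtain e0 and \<psi> :: "real^'p \<Rightarrow> real \<Rightarrow> real" where e0: "e0 > 0" and
    \<psi>: "\<And>x y \<theta> i. x \<in> \<X> \<Longrightarrow> norm (\<theta> - \<theta>s a) \<le> e0 \<Longrightarrow> spectral_norm (hessian (\<lambda>\<theta>'. g x y \<theta>' $ i) \<theta>) \<le> \<psi> x y"
      "integrable D (\<lambda>(x, y). \<psi> x (y $ a))"
    using hessian_envelope[of a] by blast
  define \<Phi> where "\<Phi> x y = \<bar>\<psi> x y\<bar>" for x y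
  have "arm a \<psi> \<in> borel_measurable TS"
    using borel_measurable_integrable[OF \<psi>(2)] by (simp add: measurable_cong_sets[OF sets_D refl])
  from borel_measurable_abs[OF measurable_of_arm[OF this]]
  have m: "(\<lambda>(x, y). \<Phi> x y) \<in> borel_measurable OS" by (simp add: \<Phi>_def case_prod_unfold)
  have i: "integrable D (arm a \<Phi>)" using integrable_abs[OF \<psi>(2)] by (simp add: \<Phi>_def case_prod_unfold)
  show thesis
    by (rule that[OF e0 _ m _ i]) (use \<psi>(1) in \<open>auto simp: \<Phi>_def intro: order_trans[OF _ abs_ge_self]\<close>)
qed

text \<open>Separates the random envelope from the factor \<open>c\<close> that carries the distance
  between parameters; used for the Lipschitz bound and for the quadratic remainder alike.\<close>

lemma ipw_sum_norm_bound:
  fixes v :: "nat \<Rightarrow> 'b::real_normed_vector"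
  assumes \<omega>: "\<omega> \<in> space M" and b: "\<And>t. t \<in> {1..T} \<Longrightarrow> norm (v t) \<le> h (X t \<omega>) (Y t \<omega>) * c"
  shows "norm ((1 / real T) *\<^sub>R (\<Sum>t=1..T. ipw a t \<omega> *\<^sub>R v t)) \<le> ipw_mean a h T \<omega> * c"
proof -
  have "norm (\<Sum>t=1..T. ipw a t \<omega> *\<^sub>R v t) \<le> (\<Sum>t=1..T. norm (ipw a t \<omega> *\<^sub>R v t))" by (rule norm_sum)
  also have "\<dots> \<le> (\<Sum>t=1..T. ipw a t \<omega> * h (X t \<omega>) (Y t \<omega>) * c)"
  proof (rule sum_mono)
    fix t assume t: "t \<in> {1..T}"
    then show "norm (ipw a t \<omega> *\<^sub>R v t) \<le> ipw a t \<omega> * h (X t \<omega>) (Y t \<omega>) * c"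
      using b[OF t] ipw_nonneg[of t \<omega> a] \<omega> by (simp add: mult.assoc mult_left_mono)
  qed
  finally have "norm (\<Sum>t=1..T. ipw a t \<omega> *\<^sub>R v t) / real T \<le> (\<Sum>t=1..T. ipw a t \<omega> * h (X t \<omega>) (Y t \<omega>) * c) / real T"
    by (rule divide_right_mono) simp
  then show ?thesis by (simp add: ipw_mean_def sum_distrib_right[symmetric])
qed

section \<open>Consistency\<close>

lemma score_lipschitz:
  assumes \<phi>: "\<And>x y \<theta>. x \<in> \<X> \<Longrightarrow> norm \<theta> \<le> R \<Longrightarrow> spectral_norm (jacobian (g x y) (at \<theta>)) \<le> \<phi> x y"
    and \<omega>: "\<omega> \<in> space M" and \<theta>: "norm \<theta> \<le> R" "norm \<theta>' \<le> R"
  shows "norm (score a T \<theta> \<omega> - score a T \<theta>' \<omega>) \<le> ipw_mean a \<phi> T \<omega> * norm (\<theta> - \<theta>')"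
proof -
  have "score a T \<theta> \<omega> - score a T \<theta>' \<omega>
      = (1 / real T) *\<^sub>R (\<Sum>t=1..T. ipw a t \<omega> *\<^sub>R (g (X t \<omega>) (Y t \<omega>) \<theta> - g (X t \<omega>) (Y t \<omega>) \<theta>'))"
    by (simp add: score_alt scaleR_diff_right sum_subtractf)
  also have "norm \<dots> \<le> ipw_mean a \<phi> T \<omega> * norm (\<theta> - \<theta>')"
  proof (rule ipw_sum_norm_bound[OF \<omega>])
    fix t assume "t \<in> {1..T}"
    then have "X t \<omega> \<in> \<X>" using X_in \<omega> by simp
    then show "norm (g (X t \<omega>) (Y t \<omega>) \<theta> - g (X t \<omega>) (Y t \<omega>) \<theta>') \<le> \<phi> (X t \<omega>) (Y t \<omega>) * norm (\<theta> - \<theta>')"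
      using \<theta> \<phi> by (intro jacobian_lipschitz[of "cball 0 R"] g_diff) auto
  qed
  finally show ?thesis .
qed

lemma G_lipschitz:
  assumes \<phi>: "\<And>x y \<theta>. x \<in> \<X> \<Longrightarrow> norm \<theta> \<le> R \<Longrightarrow> spectral_norm (jacobian (g x y) (at \<theta>)) \<le> \<phi> x y"
    and i: "integrable D (arm a \<phi>)" and \<theta>: "norm \<theta> \<le> R" "norm \<theta>' \<le> R"
  shows "norm (G a \<theta> - G a \<theta>') \<le> (LINT z|D. arm a \<phi> z) * norm (\<theta> - \<theta>')"
proof -
  let ?f = "\<lambda>\<theta> (x, p). g x (p $ a) \<theta>"
  have "G a \<theta> - G a \<theta>' = (LINT z|D. ?f \<theta> z - ?f \<theta>' z)"
    unfolding G_def by (simp only: Bochner_Integration.integral_diff[OF g_integrable[OF \<theta>(1)] g_integrable[OF \<theta>(2)]])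
  also have "norm \<dots> \<le> (LINT z|D. norm (?f \<theta> z - ?f \<theta>' z))" by (rule integral_norm_bound)
  also have "\<dots> \<le> (LINT z|D. arm a \<phi> z * norm (\<theta> - \<theta>'))"
  proof (rule integral_mono)
    show "integrable D (\<lambda>z. norm (?f \<theta> z - ?f \<theta>' z))"
      by (intro integrable_norm Bochner_Integration.integrable_diff g_integrable \<theta>)
    show "integrable D (\<lambda>z. arm a \<phi> z * norm (\<theta> - \<theta>'))" using i by simp
    fix z assume "z \<in> space D"
    then show "norm (?f \<theta> z - ?f \<theta>' z) \<le> arm a \<phi> z * norm (\<theta> - \<theta>')"
      using \<theta> \<phi> by (cases z) (auto simp: space_D intro!: jacobian_lipschitz[of "cball 0 R"] g_diff)
  qed
  also have "\<dots> = (LINT z|D. arm a \<phi> z) * norm (\<theta> - \<theta>')" by simp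
  finally show ?thesis .
qed

text \<open>An estimate farther than \<open>\<epsilon>\<close> from the true parameter has
  population score at least \<open>c\<close> by identification, while its empirical score is nearly
  zero. The bound \<open>L\<close> on the envelope average is available only up to probability
  \<open>\<eta>\<close>, so the mesh \<open>\<delta>\<close> and the net depend on
  \<open>\<eta>\<close>. Measurability of \<open>\<theta>h\<close> plays no part here.\<close>

lemma consistency:
  assumes bound: "\<And>T \<omega>. T \<ge> 1 \<Longrightarrow> \<omega> \<in> space M \<Longrightarrow> norm (\<theta>h T \<omega>) \<le> R"
    and root: "\<And>\<epsilon>. \<epsilon> > 0 \<Longrightarrow> whp M (\<lambda>T \<omega>. norm (score a T (\<theta>h T \<omega>) \<omega>) \<le> \<epsilon>)" and \<epsilon>: "\<epsilon> > 0"
  shows "whp M (\<lambda>T \<omega>. norm (\<theta>h T \<omega> - \<theta>s a) \<le> \<epsilon>)"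
proof (rule whp_of_asymp_prob_ge)
  fix \<eta> :: real assume "\<eta> > 0"
  obtain \<phi> :: "real^'p \<Rightarrow> real \<Rightarrow> real" where \<phi>': "\<forall>x y. \<phi> x y \<ge> 0" "(\<lambda>(x, y). \<phi> x y) \<in> borel_measurable OS"
    "\<forall>x\<in>\<X>. \<forall>y \<theta>. norm \<theta> \<le> R \<longrightarrow> spectral_norm (jacobian (g x y) (at \<theta>)) \<le> \<phi> x y"
    "integrable D (\<lambda>z. (arm a \<phi> z)^2)" "integrable D (arm a \<phi>)" by (rule jacobian_envelope'[of a])
  note \<phi> = \<phi>'(1,2,3,5)[rule_format]
  define E where "E = (LINT z|D. arm a \<phi> z)"
  have E: "E \<ge> 0" unfolding E_def by (intro integral_nonneg_AE) (auto simp: \<phi>(1))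
  obtain L where L: "L > 0" "asymp_prob_ge M \<eta> (\<lambda>T \<omega>. norm (ipw_mean a \<phi> T \<omega>) \<le> L)"
    by (rule bounded_in_probD[OF ipw_mean_bounded[OF \<phi>(2,4,1)] \<open>\<eta> > 0\<close>])
  define c where "c = (INF \<theta>\<in>{\<theta>. norm (\<theta> - \<theta>s a) > \<epsilon>}. norm (G a \<theta>))"
  have c: "c > 0" using identified[OF \<epsilon>, of a] by (simp add: c_def G_def)
  have c_le: "c \<le> norm (G a \<theta>)" if "norm (\<theta> - \<theta>s a) > \<epsilon>" for \<theta>
    unfolding c_def using that by (intro cINF_lower bdd_belowI[of _ 0]) auto
  \<comment> \<open>Moving to the nearest net point costs less than
    \<open>(L + E) * \<delta> = c / 4\<close>; two further errors of \<open>c / 4\<close> leave a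
    total below \<open>c\<close>.\<close>
  define \<delta> where "\<delta> = c / (L + E) / 4"
  have \<delta>: "\<delta> > 0" using c L E by (simp add: \<delta>_def)
  \<comment> \<open>The centers must lie in the ball of radius \<open>R\<close>, where the laws of
    large numbers and both Lipschitz bounds hold.\<close>
  obtain K where K: "finite K" "K \<subseteq> cball 0 R" "cball (0 :: real^'d) R \<subseteq> (\<Union>k\<in>K. ball k \<delta>)"
    using seq_compact_imp_totally_bounded[OF compact_imp_seq_compact[OF compact_cball], rule_format, OF \<delta>, of "0 ::
        real^'d" R]
    by (elim exE conjE) (rule that)
  have "whp M (\<lambda>T \<omega>. (\<forall>k\<in>K. norm (score a T k \<omega> - G a k) \<le> c / 4) \<and> norm (score a T (\<theta>h T \<omega>) \<omega>) \<le> c / 4)"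
  proof (rule whp_conj[OF whp_finite_ball[OF K(1)] root])
    show "whp M (\<lambda>T \<omega>. norm (score a T k \<omega> - G a k) \<le> c / 4)" if "k \<in> K" for k
      using that K(2) c by (intro score_lln) auto
  qed (use c in simp)
  moreover have "eventually (\<lambda>T. \<forall>\<omega>\<in>space M.
      ((\<forall>k\<in>K. norm (score a T k \<omega> - G a k) \<le> c / 4) \<and> norm (score a T (\<theta>h T \<omega>) \<omega>) \<le> c / 4) \<longrightarrow>
      (norm (ipw_mean a \<phi> T \<omega>) \<le> L \<longrightarrow> norm (\<theta>h T \<omega> - \<theta>s a) \<le> \<epsilon>)) sequentially"
  proof (rule eventually_mono[OF eventually_ge_at_top[of 1]], intro ballI impI)
    fix T :: nat and \<omega> assume T: "1 \<le> T" and \<omega>: "\<omega> \<in> space M"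
      and *: "(\<forall>k\<in>K. norm (score a T k \<omega> - G a k) \<le> c / 4) \<and> norm (score a T (\<theta>h T \<omega>) \<omega>) \<le> c / 4"
      and l: "norm (ipw_mean a \<phi> T \<omega>) \<le> L"
    let ?\<theta> = "\<theta>h T \<omega>"
    have \<theta>R: "norm ?\<theta> \<le> R" by (rule bound[OF T \<omega>])
    then obtain k where k: "k \<in> K" "norm (?\<theta> - k) < \<delta>"
      using K(3) by (auto simp: dist_norm norm_minus_commute subset_iff)
    have kR: "norm k \<le> R" using K(2) k(1) by auto
    show "norm (?\<theta> - \<theta>s a) \<le> \<epsilon>"
    proof (rule ccontr)
      assume "\<not> norm (?\<theta> - \<theta>s a) \<le> \<epsilon>"
      then have "c \<le> norm (G a ?\<theta>)" by (intro c_le) simp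
      also have "\<dots> \<le> norm (G a ?\<theta> - G a k) + norm (score a T k \<omega> - G a k) + norm (score a T ?\<theta> \<omega> - score a T k \<omega>)
          + norm (score a T ?\<theta> \<omega>)"
      proof -
        have "G a ?\<theta> = (G a ?\<theta> - G a k) - (score a T k \<omega> - G a k) - (score a T ?\<theta> \<omega> - score a T k \<omega>) + score a T ?\<theta> \<omega>"
          by simp
        then show ?thesis
          by (smt (verit) norm_triangle_ineq norm_triangle_ineq4)
      qed
      also have "\<dots> \<le> E * norm (?\<theta> - k) + c / 4 + L * norm (?\<theta> - k) + c / 4"
      proof (intro add_mono)
        show "norm (G a ?\<theta> - G a k) \<le> E * norm (?\<theta> - k)"
          unfolding E_def by (rule G_lipschitz[OF \<phi>(3,4) \<theta>R kR])
        have "norm (score a T ?\<theta> \<omega> - score a T k \<omega>) \<le> ipw_mean a \<phi> T \<omega> * norm (?\<theta> - k)"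
          by (rule score_lipschitz[OF \<phi>(3) \<omega> \<theta>R kR])
        also have "\<dots> \<le> L * norm (?\<theta> - k)" using l by (intro mult_right_mono) auto
        finally show "norm (score a T ?\<theta> \<omega> - score a T k \<omega>) \<le> L * norm (?\<theta> - k)" .
      qed (use * k in auto)
      also have "\<dots> = (L + E) * norm (?\<theta> - k) + c / 2" by (simp add: algebra_simps)
      also have "\<dots> < (L + E) * \<delta> + c / 2" using k(2) L E by simp
      also have "(L + E) * \<delta> = c / 4"
      proof -
        have "L + E \<noteq> 0" using L E by linarith
        then show ?thesis unfolding \<delta>_def times_divide_eq_right
            by (simp only: nonzero_mult_div_cancel_left[OF \<open>L + E \<noteq> 0\<close>])
      qed
      finally show False using c by simp
    qed
  qed
  ultimately have "whp M (\<lambda>T \<omega>. norm (ipw_mean a \<phi> T \<omega>) \<le> L \<longrightarrow> norm (\<theta>h T \<omega> - \<theta>s a) \<le> \<epsilon>)"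
    by (rule whp_mono_ev)
  then show "\<exists>Q'. asymp_prob_ge M \<eta> Q' \<and> whp M (\<lambda>T \<omega>. Q' T \<omega> \<longrightarrow> norm (\<theta>h T \<omega> - \<theta>s a) \<le> \<epsilon>)"
    using L(2) by blast
qed

section \<open>Linearization around the true parameter\<close>

definition jacobian_mean :: "'k \<Rightarrow> nat \<Rightarrow> 'w \<Rightarrow> real^'d^'d" where
  "jacobian_mean a T \<omega> = (1 / real T) *\<^sub>R (\<Sum>t=1..T. ipw a t \<omega> *\<^sub>R jacobian (g (X t \<omega>) (Y t \<omega>)) (at (\<theta>s a)))"

lemma jacobian_mean_component:
  "jacobian_mean a T \<omega> $ i $ j = ipw_mean a (\<lambda>x y. jacobian (g x y) (at (\<theta>s a)) $ i $ j) T \<omega>"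
  by (simp add: jacobian_mean_def ipw_mean_def)

lemma jacobian_square_integrable:
  "integrable D (\<lambda>z. (arm a (\<lambda>x y. jacobian (g x y) (at (\<theta>s a)) $ i $ j) z)^2)"
proof -
  obtain \<phi> :: "real^'p \<Rightarrow> real \<Rightarrow> real" where \<phi>': "\<forall>x y. \<phi> x y \<ge> 0" "(\<lambda>(x, y). \<phi> x y) \<in> borel_measurable OS"
    "\<forall>x\<in>\<X>. \<forall>y \<theta>. norm \<theta> \<le> R \<longrightarrow> spectral_norm (jacobian (g x y) (at \<theta>)) \<le> \<phi> x y"
    "integrable D (\<lambda>z. (arm a \<phi> z)^2)" "integrable D (arm a \<phi>)" by (rule jacobian_envelope'[of a])
  note \<phi> = \<phi>'(3,4)[rule_format]
  show ?thesis
  proof (rule Bochner_Integration.integrable_bound[OF \<phi>(2)])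
    show "(\<lambda>z. (arm a (\<lambda>x y. jacobian (g x y) (at (\<theta>s a)) $ i $ j) z)^2) \<in> borel_measurable D"
      by (intro borel_measurable_power borel_D[OF arm_measurable[OF jacobian_component]])
    have "(jacobian (g x y) (at (\<theta>s a)) $ i $ j)^2 \<le> (\<phi> x y)^2" if "x \<in> \<X>" for x y
    proof -
      have "\<bar>jacobian (g x y) (at (\<theta>s a)) $ i $ j\<bar> \<le> \<phi> x y"
        using \<phi>(1)[OF that, of "\<theta>s a" y] radius[of a] entry_le_spectral_norm[of "jacobian (g x y) (at (\<theta>s a))" i j]
            by simp
      then have "\<bar>jacobian (g x y) (at (\<theta>s a)) $ i $ j\<bar> \<le> \<bar>\<phi> x y\<bar>" by simp
      then show ?thesis by (simp only: abs_le_square_iff)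
    qed
    then show "AE z in D. norm ((arm a (\<lambda>x y. jacobian (g x y) (at (\<theta>s a)) $ i $ j) z)^2) \<le> norm ((arm a \<phi> z)^2)"
      by (intro AE_I2) (auto simp: space_D)
  qed
qed

lemma J_component: "J a $ i $ j = (LINT z|D. arm a (\<lambda>x y. jacobian (g x y) (at (\<theta>s a)) $ i $ j) z)"
proof -
  have ij: "integrable D (\<lambda>z. (case z of (x, y) \<Rightarrow> jacobian (g x (y $ a)) (at (\<theta>s a))) $ i $ j)" for i j
    using D.square_integrable_imp_integrable[OF borel_D[OF arm_measurable[OF jacobian_component]]
        jacobian_square_integrable, of a i j]
    by (simp add: case_prod_unfold)
  then have ii: "integrable D (\<lambda>z. (case z of (x, y) \<Rightarrow> jacobian (g x (y $ a)) (at (\<theta>s a))) $ i)" for i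
    by (intro integrable_vec)
  show ?thesis
    unfolding score_jacobian_mean_def integral_vec_nth[OF integrable_vec[OF ii]] integral_vec_nth[OF ii]
    by (simp add: case_prod_unfold)
qed

text \<open>The error bound is relative to the distance from the true parameter; only this form can
  be absorbed later without a rate. One half of \<open>\<epsilon>\<close> pays for replacing the
  empirical Jacobian by \<open>J\<close>, the other for the quadratic remainder.\<close>

lemma linearization:
  assumes cons: "\<And>\<epsilon>. \<epsilon> > 0 \<Longrightarrow> whp M (\<lambda>T \<omega>. norm (\<theta>h T \<omega> - \<theta>s a) \<le> \<epsilon>)" and \<epsilon>: "\<epsilon> > 0"
  shows "whp M (\<lambda>T \<omega>. norm (score a T (\<theta>h T \<omega>) \<omega> - score a T (\<theta>s a) \<omega> - J a *v (\<theta>h T \<omega> - \<theta>s a))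
      \<le> \<epsilon> * norm (\<theta>h T \<omega> - \<theta>s a))"
proof (rule whp_of_asymp_prob_ge)
  fix \<eta> :: real assume "\<eta> > 0"
  obtain e0 and \<Phi> :: "real^'p \<Rightarrow> real \<Rightarrow> real" where e0: "e0 > 0"
      and \<Phi>': "\<forall>x y. \<Phi> x y \<ge> 0" "(\<lambda>(x, y). \<Phi> x y) \<in> borel_measurable OS"
    "\<forall>x\<in>\<X>. \<forall>y \<theta> i. norm (\<theta> - \<theta>s a) \<le> e0 \<longrightarrow> spectral_norm (hessian (\<lambda>\<theta>'. g x y \<theta>' $ i) \<theta>) \<le> \<Phi> x y"
    "integrable D (arm a \<Phi>)" by (rule hessian_envelope'[of a])
  note \<Phi> = \<Phi>'[rule_format]
  obtain L where L: "L > 0" "asymp_prob_ge M \<eta> (\<lambda>T \<omega>. norm (ipw_mean a \<Phi> T \<omega>) \<le> L)"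
    by (rule bounded_in_probD[OF ipw_mean_bounded[OF \<Phi>(2,4,1)] \<open>\<eta> > 0\<close>])
  let ?n = "real CARD('d)"
  have n: "?n > 0" by simp
  \<comment> \<open>\<open>norm_mult_entrywise\<close> multiplies the entry bound \<open>e1\<close>
    by the number of entries, which gives \<open>\<epsilon> / 2\<close>. The radius
    \<open>e2\<close> stays within the ball of the Hessian envelope and makes
    \<open>L * ?n * norm v\<close> at most \<open>\<epsilon> / 2\<close>.\<close>
  define e1 where "e1 = \<epsilon> / (2 * real (CARD('d) * CARD('d)))"
  define e2 where "e2 = min e0 (\<epsilon> / (2 * ?n * L))"
  have e: "e1 > 0" "e2 > 0" using \<epsilon> e0 L n by (auto simp: e1_def e2_def)
  have "whp M (\<lambda>T \<omega>. (\<forall>ij\<in>(UNIV :: ('d \<times> 'd) set). \<bar>ipw_mean a (\<lambda>x y. jacobian (g x y) (at (\<theta>s a)) $ fst ij $ snd ij)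
      T \<omega>
      - (LINT z|D. arm a (\<lambda>x y. jacobian (g x y) (at (\<theta>s a)) $ fst ij $ snd ij) z)\<bar> \<le> e1) \<and> norm (\<theta>h T \<omega> - \<theta>s a) \<le>
          e2)"
    using e by (intro whp_conj whp_finite_ball cons ipw_mean_lln jacobian_component jacobian_square_integrable) auto
  then have "whp M (\<lambda>T \<omega>. norm (ipw_mean a \<Phi> T \<omega>) \<le> L \<longrightarrow>
      norm (score a T (\<theta>h T \<omega>) \<omega> - score a T (\<theta>s a) \<omega> - J a *v (\<theta>h T \<omega> - \<theta>s a)) \<le> \<epsilon> * norm (\<theta>h T \<omega> - \<theta>s a))"
  proof (rule whp_mono, intro impI)
    fix T \<omega> assume \<omega>: "\<omega> \<in> space M" and l: "norm (ipw_mean a \<Phi> T \<omega>) \<le> L"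
      and *: "(\<forall>ij\<in>(UNIV :: ('d \<times> 'd) set). \<bar>ipw_mean a (\<lambda>x y. jacobian (g x y) (at (\<theta>s a)) $ fst ij $ snd ij) T \<omega>
      - (LINT z|D. arm a (\<lambda>x y. jacobian (g x y) (at (\<theta>s a)) $ fst ij $ snd ij) z)\<bar> \<le> e1) \<and> norm (\<theta>h T \<omega> - \<theta>s a) \<le> e2"
    define v where "v = \<theta>h T \<omega> - \<theta>s a"
    have v: "norm v \<le> e0" "norm v \<le> \<epsilon> / (2 * ?n * L)" using * by (auto simp: v_def e2_def)
    have entry: "\<bar>(jacobian_mean a T \<omega> - J a) $ i $ j\<bar> \<le> e1" for i j
      using bspec[OF conjunct1[OF *], of "(i, j)"] by (simp add: jacobian_mean_component J_component)
    have 1: "norm ((jacobian_mean a T \<omega> - J a) *v v) \<le> \<epsilon> / 2 * norm v"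
      using norm_mult_entrywise[OF entry, of v] by (simp add: e1_def)
    have "score a T (\<theta>h T \<omega>) \<omega> - score a T (\<theta>s a) \<omega> - jacobian_mean a T \<omega> *v v
        = (1 / real T) *\<^sub>R (\<Sum>t=1..T. ipw a t \<omega> *\<^sub>R
          (g (X t \<omega>) (Y t \<omega>) (\<theta>h T \<omega>) - g (X t \<omega>) (Y t \<omega>) (\<theta>s a) - jacobian (g (X t \<omega>) (Y t \<omega>)) (at (\<theta>s a)) *v v))"
    proof -
      have "(\<Sum>t=1..T. ipw a t \<omega> *\<^sub>R jacobian (g (X t \<omega>) (Y t \<omega>)) (at (\<theta>s a))) *v v
          = (\<Sum>t=1..T. ipw a t \<omega> *\<^sub>R (jacobian (g (X t \<omega>) (Y t \<omega>)) (at (\<theta>s a)) *v v))"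
        by (induction T) (simp_all add: matrix_vector_mult_add_rdistrib scaleR_matrix_vector_assoc)
      then show ?thesis
        by (simp add: score_alt jacobian_mean_def scaleR_diff_right sum_subtractf
            scaleR_matrix_vector_assoc[symmetric])
    qed
    also have "norm \<dots> \<le> ipw_mean a \<Phi> T \<omega> * (?n * (norm v)^2)"
    proof (rule ipw_sum_norm_bound[OF \<omega>])
      fix t assume "t \<in> {1..T}"
      then have X: "X t \<omega> \<in> \<X>" using X_in \<omega> by simp
      show "norm (g (X t \<omega>) (Y t \<omega>) (\<theta>h T \<omega>) - g (X t \<omega>) (Y t \<omega>) (\<theta>s a)
          - jacobian (g (X t \<omega>) (Y t \<omega>)) (at (\<theta>s a)) *v v)
          \<le> \<Phi> (X t \<omega>) (Y t \<omega>) * (?n * (norm v)^2)"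
        using second_order_remainder[OF twice_diff[OF X], of "\<theta>s a" e0, OF \<Phi>(3)[OF X] v(1)[unfolded v_def], of "Y t
            \<omega>"] by (simp add: v_def mult_ac)
    qed
    also have "\<dots> \<le> L * (?n * (norm v)^2)" using l by (intro mult_right_mono) auto
    also have "\<dots> = (L * ?n * norm v) * norm v" by (simp add: power2_eq_square)
    also have "\<dots> \<le> \<epsilon> / 2 * norm v"
      using v(2) L n by (intro mult_right_mono) (simp_all add: field_simps)
    finally have 2: "norm (score a T (\<theta>h T \<omega>) \<omega> - score a T (\<theta>s a) \<omega> - jacobian_mean a T \<omega> *v v) \<le> \<epsilon> / 2 * norm v" .
    have "score a T (\<theta>h T \<omega>) \<omega> - score a T (\<theta>s a) \<omega> - J a *v v
        = (score a T (\<theta>h T \<omega>) \<omega> - score a T (\<theta>s a) \<omega> - jacobian_mean a T \<omega> *v v) + (jacobian_mean a T \<omega> - J a) *v v"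
      by (simp add: matrix_vector_mult_diff_rdistrib)
    then have "norm (score a T (\<theta>h T \<omega>) \<omega> - score a T (\<theta>s a) \<omega> - J a *v v) \<le> \<epsilon> / 2 * norm v + \<epsilon> / 2 * norm v"
      by (simp only: norm_triangle_mono[OF 2 1])
    then show "norm (score a T (\<theta>h T \<omega>) \<omega> - score a T (\<theta>s a) \<omega> - J a *v (\<theta>h T \<omega> - \<theta>s a)) \<le> \<epsilon> * norm (\<theta>h T \<omega> - \<theta>s a)"
      by (simp add: v_def)
  qed
  then show "\<exists>Q'. asymp_prob_ge M \<eta> Q' \<and> whp M (\<lambda>T \<omega>. Q' T \<omega> \<longrightarrow>
      norm (score a T (\<theta>h T \<omega>) \<omega> - score a T (\<theta>s a) \<omega> - J a *v (\<theta>h T \<omega> - \<theta>s a)) \<le> \<epsilon> * norm (\<theta>h T \<omega> - \<theta>s a))"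
    using L(2) by blast
qed

end

section \<open>The limit law of the score\<close>

locale ipw_asymptotics = ipw_estimation M \<X> D X P \<pi> A Y \<pi>min g \<theta>s R
  for M :: "'w measure" and \<X> :: "(real^'p) set" and D :: "((real^'p) \<times> (real^'k)) measure"
    and X P \<pi> A Y \<pi>min and g :: "real^'p \<Rightarrow> real \<Rightarrow> real^'d \<Rightarrow> real^'d" and \<theta>s R +
  fixes \<pi>bar :: "real^'p \<Rightarrow> real^'k"
  assumes fourth_moment: "\<And>a. (\<integral>\<^sup>+(x, y). ennreal ((norm (g x (y $ a) (\<theta>s a)))^4) \<partial>D) < \<infinity>"
    and limit_policy_measurable: "\<pi>bar \<in> borel_measurable (restrict_space borel \<X>)"
    and policy_convergence: "\<And>a. tends_to_zero_in_prob M (\<lambda>t \<omega>. \<pi> t \<omega> $ a - \<pi>bar (X t \<omega>) $ a)"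
begin

section \<open>The limit policy and its overlap\<close>

lemma \<pi>bar_TS: "(\<lambda>z. \<pi>bar (fst z) $ a) \<in> borel_measurable TS"
  by (rule measurable_compose[OF measurable_compose[OF measurable_fst limit_policy_measurable] measurable_vec_nth])

lemma \<pi>bar_M: "t \<ge> 1 \<Longrightarrow> (\<lambda>\<omega>. \<pi>bar (X t \<omega>) $ a) \<in> borel_measurable M"
  using measurable_compose[OF XP_measurable \<pi>bar_TS] by simp

lemma \<pi>_component_M: "t \<ge> 1 \<Longrightarrow> (\<lambda>\<omega>. \<pi> t \<omega> $ a) \<in> borel_measurable M"
  by (rule measurable_compose[OF \<pi>_measurable measurable_vec_nth])

text \<open>Overlap is assumed for the realized policies only. Where \<open>\<pi>bar\<close> is
  below \<open>\<pi>min\<close> by more than \<open>e\<close>, the realized policy differs from it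
  by more than \<open>e\<close> almost surely, an event whose probability tends to zero.\<close>

lemma limit_policy_overlap: "AE z in D. \<pi>bar (fst z) $ a \<ge> \<pi>min"
proof -
  have bm [measurable]: "(\<lambda>z. \<pi>bar (fst z) $ a) \<in> borel_measurable D" by (rule borel_D[OF \<pi>bar_TS])
  have null: "AE z in D. \<not> \<pi>bar (fst z) $ a < \<pi>min - e" if e: "e > 0" for e
  proof -
    let ?S = "{z \<in> space D. \<pi>bar (fst z) $ a < \<pi>min - e}"
    have S [measurable]: "?S \<in> sets D" by measurable
    \<comment> \<open>The left side does not depend on \<open>t\<close>, because all tuples have the
      law \<open>D\<close>; letting \<open>t\<close> grow on the right therefore makes it 0.\<close>
    have "D.prob ?S \<le> prob {\<omega> \<in> space M. norm (\<pi> t \<omega> $ a - \<pi>bar (X t \<omega>) $ a) > e}" if t: "t \<ge> 1" for t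
    proof -
      note [measurable] = \<pi>bar_M[OF t] \<pi>_component_M[OF t]
      have "D.prob ?S = measure (distr M TS (XP t)) ?S" by (simp only: D_eq[OF t, symmetric])
      also have "\<dots> = prob (XP t -` ?S \<inter> space M)"
        using S by (intro measure_distr XP_measurable t) (simp add: sets_D)
      also have "\<dots> \<le> prob {\<omega> \<in> space M. norm (\<pi> t \<omega> $ a - \<pi>bar (X t \<omega>) $ a) > e}"
      proof (rule finite_measure_mono_AE)
        show "AE \<omega> in M. \<omega> \<in> XP t -` ?S \<inter> space M \<longrightarrow> \<omega> \<in> {\<omega> \<in> space M. norm (\<pi> t \<omega> $ a - \<pi>bar (X t \<omega>) $ a) > e}"
          using overlap[OF t, of a] by eventually_elim auto
      qed measurable
      finally show ?thesis .
    qed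
    then have "eventually (\<lambda>t. D.prob ?S \<le> prob {\<omega> \<in> space M. norm (\<pi> t \<omega> $ a - \<pi>bar (X t \<omega>) $ a) > e}) sequentially"
      by (intro eventually_mono[OF eventually_ge_at_top[of 1]])
    moreover have "(\<lambda>t. prob {\<omega> \<in> space M. norm (\<pi> t \<omega> $ a - \<pi>bar (X t \<omega>) $ a) > e}) \<longlonglongrightarrow> 0"
      using policy_convergence[of a] e by (simp add: tends_to_zero_in_prob_def)
    ultimately have "D.prob ?S \<le> 0" by (intro tendsto_lowerbound[of _ 0 sequentially]) auto
    then have "D.prob ?S = 0" by (simp add: measure_le_0_iff)
    then show ?thesis using S by (subst (asm) D.prob_eq_0) auto
  qed
  have "AE z in D. \<forall>n. \<not> \<pi>bar (fst z) $ a < \<pi>min - 1 / real (Suc n)"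
    by (subst AE_all_countable) (intro allI null, simp)
  then show ?thesis
  proof eventually_elim
    case (elim z)
    show ?case
    proof (rule ccontr)
      assume "\<not> \<pi>min \<le> \<pi>bar (fst z) $ a"
      then obtain n where "1 / real (Suc n) < \<pi>min - \<pi>bar (fst z) $ a"
        using nat_approx_posE[of "\<pi>min - \<pi>bar (fst z) $ a"] by auto
      then show False using elim by (auto simp: algebra_simps dest!: spec[of _ n])
    qed
  qed
qed

lemma limit_policy_overlap_M:
  assumes "t \<ge> 1" shows "AE \<omega> in M. \<pi>bar (X t \<omega>) $ a \<ge> \<pi>min"
proof -
  have "AE z in distr M TS (XP t). \<pi>bar (fst z) $ a \<ge> \<pi>min"
    using limit_policy_overlap[of a] by (simp only: D_eq[OF assms])
  then show ?thesis
    by (subst (asm) AE_distr_iff[OF XP_measurable[OF assms]])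
       (use \<pi>bar_TS[of a] in \<open>simp_all, measurable\<close>)
qed

section \<open>Convergence of the inverse weights\<close>

definition weight_error :: "'k \<Rightarrow> nat \<Rightarrow> 'w \<Rightarrow> real" where
  "weight_error a t \<omega> = \<bar>1 / \<pi> t \<omega> $ a - 1 / \<pi>bar (X t \<omega>) $ a\<bar>"

lemma weight_error_measurable: "t \<ge> 1 \<Longrightarrow> weight_error a t \<in> borel_measurable M"
  unfolding weight_error_def
  by (intro borel_measurable_abs borel_measurable_diff borel_measurable_divide borel_measurable_const \<pi>bar_M
      \<pi>_component_M)

text \<open>The first bound is for the event where the policies are far apart, the second for its
  complement. The first holds since both inverses lie between 0 and
  \<open>1 / \<pi>min\<close>.\<close>

lemma weight_error_bounds:
  assumes t: "t \<ge> 1"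
  shows "AE \<omega> in M. weight_error a t \<omega> \<le> 1 / \<pi>min \<and> weight_error a t \<omega> \<le> \<bar>\<pi> t \<omega> $ a - \<pi>bar (X t \<omega>) $ a\<bar> / \<pi>min^2"
  using overlap[OF t, of a] limit_policy_overlap_M[OF t, of a]
proof eventually_elim
  case (elim \<omega>)
  let ?p = "\<pi> t \<omega> $ a" and ?q = "\<pi>bar (X t \<omega>) $ a"
  have p: "?p > 0" "?q > 0" using elim \<pi>min_pos by auto
  have "1 / ?p \<le> 1 / \<pi>min" "1 / ?q \<le> 1 / \<pi>min" using elim \<pi>min_pos by (auto intro: divide_left_mono)
  moreover have "1 / ?p > 0" "1 / ?q > 0" using p by auto
  ultimately have "weight_error a t \<omega> \<le> 1 / \<pi>min" unfolding weight_error_def by linarith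
  moreover have "weight_error a t \<omega> = \<bar>?p - ?q\<bar> / (?p * ?q)"
    using p by (simp add: weight_error_def diff_frac_eq abs_mult abs_divide abs_minus_commute)
  moreover have "\<dots> \<le> \<bar>?p - ?q\<bar> / \<pi>min^2"
    using elim \<pi>min_pos p unfolding power2_eq_square by (intro divide_left_mono mult_mono mult_pos_pos) auto
  ultimately show ?case by simp
qed

text \<open>The policies converge in probability only, and the tuple changes with \<open>t\<close>,
  so the bad event is handled by hand: a second moment of \<open>q\<close> makes its contribution
  small. In the application \<open>q\<close> is a squared score, whence the fourth moment.\<close>

lemma weight_error_vanishes:
  assumes q: "q \<in> borel_measurable TS" and q0: "\<And>z. q z \<ge> 0" and i: "integrable D q"
      and i2: "integrable D (\<lambda>z. (q z)^2)"
  shows "(\<lambda>t. expectation (\<lambda>\<omega>. weight_error a t \<omega> * q (XP t \<omega>))) \<longlonglongrightarrow> 0"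
proof (rule LIMSEQ_I)
  fix e :: real assume e: "e > 0"
  define E1 E2 where "E1 = (LINT z|D. q z)" and "E2 = (LINT z|D. (q z)^2)"
  have E: "E1 \<ge> 0" "E2 \<ge> 0" unfolding E1_def E2_def by (auto intro!: integral_nonneg_AE simp: q0)
  \<comment> \<open>\<open>\<epsilon>\<close>, \<open>\<kappa>\<close> and the later bound on
    \<open>prob (?B t)\<close> are such that each of the three terms of the integrated majorant is
    at most \<open>e / 4\<close>. The summand 1 avoids division by zero.\<close>
  define \<epsilon> where "\<epsilon> = e * \<pi>min^2 / (4 * (E1 + 1))"
  define \<kappa> where "\<kappa> = e * \<pi>min / (4 * (E2 + 1))"
  have pos: "\<epsilon> > 0" "\<kappa> > 0" using e E \<pi>min_pos by (simp_all add: \<epsilon>_def \<kappa>_def)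
  let ?B = "\<lambda>t. {\<omega> \<in> space M. norm (\<pi> t \<omega> $ a - \<pi>bar (X t \<omega>) $ a) > \<epsilon>}"
  have "(\<lambda>t. prob (?B t)) \<longlonglongrightarrow> 0" using policy_convergence[of a] pos by (simp add: tends_to_zero_in_prob_def)
  then have "eventually (\<lambda>t. prob (?B t) < e * \<kappa> * \<pi>min) sequentially"
    using e pos \<pi>min_pos by (intro order_tendstoD) auto
  with eventually_ge_at_top[of 1]
  have "eventually (\<lambda>t. norm (expectation (\<lambda>\<omega>. weight_error a t \<omega> * q (XP t \<omega>)) - 0) < e) sequentially"
  proof eventually_elim
    case (elim t)
    note t = elim(1)
    note [measurable] = weight_error_measurable[OF t] \<pi>bar_M[OF t] \<pi>_component_M[OF t]
    have qM [measurable]: "(\<lambda>\<omega>. q (XP t \<omega>)) \<in> borel_measurable M"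
        by (rule measurable_compose[OF XP_measurable[OF t] q])
    have B [measurable]: "?B t \<in> events" by measurable
    have iB: "integrable M (indicator (?B t) :: 'w \<Rightarrow> real)"
        by (rule integrable_real_indicator) (auto simp: emeasure_eq_measure)
    have iq: "integrable M (\<lambda>\<omega>. q (XP t \<omega>))" "expectation (\<lambda>\<omega>. q (XP t \<omega>)) = E1"
      using tuple_integral[OF q t] i by (simp_all add: E1_def)
    have iq2: "integrable M (\<lambda>\<omega>. (q (XP t \<omega>))^2)" "expectation (\<lambda>\<omega>. (q (XP t \<omega>))^2) = E2"
      using tuple_integral[of "\<lambda>z. (q z)^2" t] q i2 t by (simp_all add: E2_def)
    let ?w = "\<lambda>\<omega>. \<epsilon> / \<pi>min^2 * q (XP t \<omega>) + 1 / \<pi>min * (\<kappa> * (q (XP t \<omega>))^2 + indicator (?B t) \<omega> / (4 * \<kappa>))"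
    have iw: "integrable M ?w" using iq iq2 iB by simp
    have le: "AE \<omega> in M. weight_error a t \<omega> * q (XP t \<omega>) \<le> ?w \<omega>"
      using weight_error_bounds[OF t, of a] AE_space
    proof eventually_elim
      case (elim \<omega>)
      let ?q = "q (XP t \<omega>)"
      have q: "?q \<ge> 0" by (rule q0)
      \<comment> \<open>Young's inequality: on the bad event \<open>q\<close> is traded for a small
        multiple of \<open>q^2\<close> plus a constant, which then integrates to a multiple of the
        probability of that event.\<close>
      have k: "?q \<le> \<kappa> * ?q^2 + 1 / (4 * \<kappa>)"
      proof -
        have "0 \<le> (2 * \<kappa> * ?q - 1)^2" by simp
        then have "4 * \<kappa> * ?q \<le> 4 * \<kappa> * (\<kappa> * ?q^2) + 1" by (simp add: power2_eq_square algebra_simps)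
        then have "?q \<le> (4 * \<kappa> * (\<kappa> * ?q^2) + 1) / (4 * \<kappa>)" using pos by (simp add: pos_le_divide_eq mult.commute)
        then show ?thesis using pos by (simp add: add_divide_distrib)
      qed
      show ?case
      proof (cases "\<omega> \<in> ?B t")
        case True
        have "weight_error a t \<omega> * ?q \<le> 1 / \<pi>min * ?q" using elim q by (intro mult_right_mono) auto
        also have "\<dots> \<le> 1 / \<pi>min * (\<kappa> * ?q^2 + 1 / (4 * \<kappa>))" using k \<pi>min_pos by (intro mult_left_mono) auto
        also have "\<dots> \<le> ?w \<omega>" using True q pos \<pi>min_pos by simp
        finally show ?thesis .
      next
        case False
        then have "\<bar>\<pi> t \<omega> $ a - \<pi>bar (X t \<omega>) $ a\<bar> / \<pi>min^2 \<le> \<epsilon> / \<pi>min^2" using elim by (intro divide_right_mono) auto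
        then have "weight_error a t \<omega> \<le> \<epsilon> / \<pi>min^2" using elim by linarith
        then have "weight_error a t \<omega> * ?q \<le> \<epsilon> / \<pi>min^2 * ?q" using q by (rule mult_right_mono)
        also have "\<dots> \<le> ?w \<omega>" using False pos \<pi>min_pos by simp
        finally show ?thesis .
      qed
    qed
    have w0: "weight_error a t \<omega> * q (XP t \<omega>) \<ge> 0" for \<omega> using q0 by (simp add: weight_error_def)
    have "integrable M (\<lambda>\<omega>. weight_error a t \<omega> * q (XP t \<omega>))"
    proof (rule integrable_dominated[OF iw])
      show "AE \<omega> in M. \<bar>weight_error a t \<omega> * q (XP t \<omega>)\<bar> \<le> ?w \<omega>" using le unfolding abs_of_nonneg[OF w0] .
    qed measurable
    from integral_mono_AE[OF this iw le]
    have "expectation (\<lambda>\<omega>. weight_error a t \<omega> * q (XP t \<omega>)) \<le> expectation ?w" .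
    also have "\<dots> = \<epsilon> / \<pi>min^2 * E1 + 1 / \<pi>min * (\<kappa> * E2 + prob (?B t) / (4 * \<kappa>))"
      using iq iq2 iB by simp
    also have "\<dots> < e"
    proof -
      have "\<epsilon> / \<pi>min^2 * E1 = e / 4 * (E1 / (E1 + 1))" using \<pi>min_pos E by (simp add: \<epsilon>_def)
      also have "\<dots> \<le> e / 4 * 1" using E e by (intro mult_left_mono) auto
      finally have 1: "\<epsilon> / \<pi>min^2 * E1 \<le> e / 4" by simp
      have "1 / \<pi>min * (\<kappa> * E2) = e / 4 * (E2 / (E2 + 1))" using \<pi>min_pos E by (simp add: \<kappa>_def)
      also have "\<dots> \<le> e / 4 * 1" using E e by (intro mult_left_mono) auto
      finally have 2: "1 / \<pi>min * (\<kappa> * E2) \<le> e / 4" by simp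
      have "1 / \<pi>min * (prob (?B t) / (4 * \<kappa>)) < 1 / \<pi>min * (e * \<kappa> * \<pi>min / (4 * \<kappa>))"
        using elim(2) \<pi>min_pos pos by (intro mult_strict_left_mono divide_strict_right_mono) auto
      also have "\<dots> = e / 4" using \<pi>min_pos pos by simp
      finally have 3: "1 / \<pi>min * (prob (?B t) / (4 * \<kappa>)) < e / 4" .
      show ?thesis unfolding distrib_left using 1 2 3 e by linarith
    qed
    finally have "expectation (\<lambda>\<omega>. weight_error a t \<omega> * q (XP t \<omega>)) < e" .
    moreover have "expectation (\<lambda>\<omega>. weight_error a t \<omega> * q (XP t \<omega>)) \<ge> 0" by (intro integral_nonneg_AE AE_I2 w0)
    ultimately show ?case by simp
  qed
  then show "\<exists>no. \<forall>t\<ge>no. norm (expectation (\<lambda>\<omega>. weight_error a t \<omega> * q (XP t \<omega>)) - 0) < e"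
    by (simp add: eventually_sequentially)
qed

text \<open>Only the played arm contributes at each time; hence the limit covariance is block diagonal.\<close>

lemma ipw_sum_collapse: "(\<Sum>a\<in>UNIV. ipw a t \<omega> * f a) = ipw (A t \<omega>) t \<omega> * f (A t \<omega>)"
proof -
  have "(\<Sum>a\<in>UNIV. ipw a t \<omega> * f a) = (\<Sum>a\<in>UNIV. if a = A t \<omega> then ipw a t \<omega> * f a else 0)"
    by (intro sum.cong refl) (auto simp: ipw_def)
  then show ?thesis by simp
qed

text \<open>Cramer-Wold reduction: the family \<open>v\<close> holds one coefficient vector per arm,
  so that it encodes a linear functional of the scores of all arms together.\<close>

definition proj :: "('k \<Rightarrow> real^'d) \<Rightarrow> 'k \<Rightarrow> real^'p \<Rightarrow> real \<Rightarrow> real" where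
  "proj v a x y = v a \<bullet> g x y (\<theta>s a)"

definition incr :: "('k \<Rightarrow> real^'d) \<Rightarrow> nat \<Rightarrow> 'w \<Rightarrow> real" where
  "incr v t \<omega> = (\<Sum>a\<in>UNIV. ipw a t \<omega> * proj v a (X t \<omega>) (Y t \<omega>))"

text \<open>The quadratic form at \<open>v\<close> of the block diagonal matrix with blocks E(g g^T
  / \<open>\<pi>bar\<close>); written through scalar projections, it needs no matrix integrals until
  the very end.\<close>

definition limit_variance :: "('k \<Rightarrow> real^'d) \<Rightarrow> real" where
  "limit_variance v = (\<Sum>a\<in>UNIV. LINT z|D. (arm a (proj v a) z)^2 / \<pi>bar (fst z) $ a)"

lemma proj_measurable: "(\<lambda>(x, y). proj v a x y) \<in> borel_measurable OS"
proof -
  have "(\<lambda>z. v a \<bullet> (case z of (x, y) \<Rightarrow> g x y (\<theta>s a))) \<in> borel_measurable OS"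
    by (intro borel_measurable_inner borel_measurable_const g_measurable)
  then show ?thesis by (simp add: proj_def case_prod_unfold)
qed

lemma proj_TS: "arm a (proj v a) \<in> borel_measurable TS"
  by (rule arm_measurable[OF proj_measurable])

lemma proj_fourth: "integrable D (\<lambda>z. (arm a (proj v a) z)^4)"
proof -
  have m: "(\<lambda>z. (norm (case z of (x, p) \<Rightarrow> g x (p $ a) (\<theta>s a)))^4) \<in> borel_measurable D"
    by (intro borel_measurable_power measurable_compose[OF borel_D[OF arm_measurable[OF g_measurable]]
        borel_measurable_norm])
  have i: "integrable D (\<lambda>z. (norm (case z of (x, p) \<Rightarrow> g x (p $ a) (\<theta>s a)))^4)"
    by (rule integrableI_bounded[OF m]) (use fourth_moment[of a] in \<open>simp add: case_prod_unfold\<close>)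
  show ?thesis
  proof (rule Bochner_Integration.integrable_bound[OF integrable_mult_right[OF i, of "(norm (v a))^4"]])
    show "(\<lambda>z. (arm a (proj v a) z)^4) \<in> borel_measurable D" by (intro borel_measurable_power borel_D proj_TS)
    have "(v a \<bullet> w)^4 \<le> (norm (v a))^4 * (norm w)^4" for w :: "real^'d"
    proof -
      have "\<bar>v a \<bullet> w\<bar>^4 \<le> (norm (v a) * norm w)^4" by (intro power_mono Cauchy_Schwarz_ineq2) simp
      then show ?thesis by (simp add: power_mult_distrib)
    qed
    then show "AE z in D. norm ((arm a (proj v a) z)^4)
        \<le> norm ((norm (v a))^4 * (norm (case z of (x, p) \<Rightarrow> g x (p $ a) (\<theta>s a)))^4)"
      by (simp add: case_prod_unfold proj_def)
  qed
qed

lemma proj_abs_power: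
  assumes "n \<le> 4" shows "integrable D (\<lambda>z. \<bar>arm a (proj v a) z\<bar>^n)"
proof (rule integrable_dominated)
  show "integrable D (\<lambda>z. 1 + \<bar>arm a (proj v a) z\<bar>^4)" using proj_fourth by simp
  show "(\<lambda>z. \<bar>arm a (proj v a) z\<bar>^n) \<in> borel_measurable D"
    by (intro borel_measurable_power borel_measurable_abs borel_D proj_TS)
  show "AE z in D. \<bar>\<bar>arm a (proj v a) z\<bar>^n\<bar> \<le> 1 + \<bar>arm a (proj v a) z\<bar>^4"
    using abs_power_le_one_plus_power[OF assms] by simp
qed

lemma proj_square: "integrable D (\<lambda>z. (arm a (proj v a) z)^2)"
  using proj_abs_power[of 2 v a] by simp

lemma proj_integrable: "integrable D (arm a (proj v a))"
  by (rule D.square_integrable_imp_integrable[OF borel_D[OF proj_TS] proj_square])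

lemma proj_square_weighted: "integrable D (\<lambda>z. (arm a (proj v a) z)^2 / \<pi>bar (fst z) $ a)"
proof (rule Bochner_Integration.integrable_bound[OF integrable_mult_right[OF proj_square, of "1 / \<pi>min"]])
  show "(\<lambda>z. (arm a (proj v a) z)^2 / \<pi>bar (fst z) $ a) \<in> borel_measurable D"
    by (intro borel_D borel_measurable_divide borel_measurable_power proj_TS \<pi>bar_TS)
  show "AE z in D. norm ((arm a (proj v a) z)^2 / \<pi>bar (fst z) $ a) \<le> norm (1 / \<pi>min * (arm a (proj v a) z)^2)"
    using limit_policy_overlap[of a]
  proof eventually_elim
    case (elim z)
    then show ?case using \<pi>min_pos by (simp add: abs_divide) (intro divide_left_mono mult_pos_pos; simp)
  qed
qed

lemma proj_mean: "(LINT z|D. arm a (proj v a) z) = 0"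
proof -
  have "norm (\<theta>s a) \<le> R" using radius[of a] by simp
  from integral_bounded_linear[OF bounded_linear_inner_right[of "v a"] g_integrable[OF this, of a]]
  show ?thesis using target[of a] by (simp add: proj_def case_prod_unfold)
qed

lemma incr_F: "\<tau> \<in> {1..t} \<Longrightarrow> incr v \<tau> \<in> borel_measurable (\<F> t)"
  unfolding incr_def by (intro borel_measurable_sum borel_measurable_times ipw_F observed_F proj_measurable)

lemma limit_variance_nonneg: "limit_variance v \<ge> 0"
  unfolding limit_variance_def
proof (intro sum_nonneg integral_nonneg_AE)
  fix a
  show "AE z in D. 0 \<le> (arm a (proj v a) z)^2 / \<pi>bar (fst z) $ a"
    using limit_policy_overlap[of a] by eventually_elim (use \<pi>min_pos in auto)
qed

text \<open>The variance hypothesis is the substantial one. After squaring, the weight of the played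
  arm occurs twice. One weight cancels in expectation; the other leaves \<open>1 / \<pi> t\<close>,
  which is exchanged for \<open>1 / \<pi>bar\<close> before independence of the past can be
  used.\<close>

lemma incr_clt:
  "(\<lambda>T. expectation (\<lambda>\<omega>. cos ((\<Sum>t=1..T. incr v t \<omega>) / sqrt T + b))) \<longlonglongrightarrow> cos b * exp (- limit_variance v / 2)"
proof (rule martingale_clt_cos)
  let ?q = "\<lambda>a. arm a (proj v a)"
  let ?C = "\<Sum>a\<in>UNIV. (1 / \<pi>min)^3 * (LINT z|D. \<bar>?q a z\<bar>^3)"
  \<comment> \<open>The cost of this exchange; it does not involve the cosine, so it is uniform in
    \<open>s\<close> and \<open>b\<close>.\<close>
  let ?\<delta> = "\<lambda>t. \<Sum>a\<in>UNIV. expectation (\<lambda>\<omega>. weight_error a t \<omega> * (?q a (XP t \<omega>))^2)"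
  show meas: "incr v t \<in> borel_measurable M" if "t \<ge> 1" for t
    by (rule measurable_from_subalg[OF subalgebra_F incr_F[of t t]]) (use that in simp)
  have obs: "ipw a t \<omega> * proj v a (X t \<omega>) (Y t \<omega>) = ipw a t \<omega> * ?q a (XP t \<omega>)" if "t \<ge> 1" "\<omega> \<in> space M" for a t \<omega>
    by (rule ipw_observed[OF that])
  have incr_eq: "incr v t \<omega> = (\<Sum>a\<in>UNIV. ipw a t \<omega> * ?q a (XP t \<omega>))" if "t \<ge> 1" "\<omega> \<in> space M" for t \<omega>
    unfolding incr_def by (intro sum.cong refl obs that)
  have qM: "(\<lambda>\<omega>. ?q a (XP t \<omega>)) \<in> borel_measurable M" if "t \<ge> 1" for a t
    by (rule measurable_compose[OF XP_measurable[OF that] proj_TS])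
  have third: "integrable M (\<lambda>\<omega>. \<bar>incr v t \<omega>\<bar>^3) \<and> expectation (\<lambda>\<omega>. \<bar>incr v t \<omega>\<bar>^3) \<le> ?C" if t: "t \<ge> 1" for t
  proof -
    let ?w = "\<lambda>\<omega>. \<Sum>a\<in>UNIV. (1 / \<pi>min)^3 * \<bar>?q a (XP t \<omega>)\<bar>^3"
    have c3: "integrable M (\<lambda>\<omega>. \<bar>?q a (XP t \<omega>)\<bar>^3)" "expectation (\<lambda>\<omega>. \<bar>?q a (XP t \<omega>)\<bar>^3) = (LINT z|D. \<bar>?q a z\<bar>^3)"
        for a
      using tuple_integral[of "\<lambda>z. \<bar>?q a z\<bar>^3" t] proj_TS[of v a] proj_abs_power[of 3 v a] t by simp_all
    have iw: "integrable M ?w" by (intro Bochner_Integration.integrable_sum integrable_mult_right c3)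
    have "AE \<omega> in M. \<forall>a\<in>UNIV. ipw a t \<omega> \<le> 1 / \<pi>min"
      by (rule AE_finite_allI) (auto intro: ipw_bound[OF t])
    then have le: "AE \<omega> in M. \<bar>incr v t \<omega>\<bar>^3 \<le> ?w \<omega>"
      using AE_space
    proof eventually_elim
      case (elim \<omega>)
      let ?a = "A t \<omega>"
      have "incr v t \<omega> = ipw ?a t \<omega> * ?q ?a (XP t \<omega>)"
        unfolding incr_eq[OF t elim(2)] by (rule ipw_sum_collapse)
      then have "\<bar>incr v t \<omega>\<bar>^3 = (ipw ?a t \<omega>)^3 * \<bar>?q ?a (XP t \<omega>)\<bar>^3"
        using ipw_nonneg[OF t elim(2), of ?a] by (simp add: abs_mult power_mult_distrib)
      also have "\<dots> \<le> (1 / \<pi>min)^3 * \<bar>?q ?a (XP t \<omega>)\<bar>^3"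
        using elim(1) ipw_nonneg[OF t elim(2), of ?a] by (intro mult_right_mono power_mono) auto
      \<comment> \<open>The random played arm is replaced by the sum over all arms, whose
        expectation does not depend on time.\<close>
      also have "\<dots> \<le> ?w \<omega>"
        using \<pi>min_pos by (intro member_le_sum[of ?a UNIV "\<lambda>a. (1 / \<pi>min)^3 * \<bar>?q a (XP t \<omega>)\<bar>^3"]) auto
      finally show ?case .
    qed
    have m3: "(\<lambda>\<omega>. \<bar>incr v t \<omega>\<bar>^3) \<in> borel_measurable M" by (intro borel_measurable_power borel_measurable_abs meas t)
    have i3: "integrable M (\<lambda>\<omega>. \<bar>incr v t \<omega>\<bar>^3)"
      by (rule integrable_dominated[OF iw m3]) (use le in simp)
    have "expectation (\<lambda>\<omega>. \<bar>incr v t \<omega>\<bar>^3) \<le> expectation ?w" by (rule integral_mono_AE[OF i3 iw le])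
    also have "\<dots> = ?C" using c3 by (simp add: Bochner_Integration.integral_sum)
    finally show ?thesis using i3 by simp
  qed
  show "integrable M (\<lambda>\<omega>. \<bar>incr v t \<omega>\<bar>^3)" "expectation (\<lambda>\<omega>. \<bar>incr v t \<omega>\<bar>^3) \<le> ?C" if "t \<ge> 1" for t
    using third[OF that] by auto
  define W where "W t s b \<omega> = cos (s * (\<Sum>i\<in>{1..<t}. incr v i \<omega>) + b)" for t s b \<omega>
  have WF: "W t s b \<in> borel_measurable (\<F> (t - 1))" for t s b
  proof -
    have "(\<lambda>\<omega>. \<Sum>i\<in>{1..<t}. incr v i \<omega>) \<in> borel_measurable (\<F> (t - 1))"
      by (intro borel_measurable_sum incr_F) auto
    then show ?thesis unfolding W_def by measurable
  qed
  have W1: "\<bar>W t s b \<omega>\<bar> \<le> 1" for t s b \<omega> by (simp add: W_def)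
  show "expectation (\<lambda>\<omega>. cos (s * (\<Sum>i\<in>{1..<t}. incr v i \<omega>) + b) * incr v t \<omega>) = 0" if t: "t \<ge> 1" for t s b
  proof -
    have "expectation (\<lambda>\<omega>. W t s b \<omega> * incr v t \<omega>) = expectation (\<lambda>\<omega>. \<Sum>a\<in>UNIV. W t s b \<omega> * ipw a t \<omega> * ?q a (XP t \<omega>))"
      by (rule Bochner_Integration.integral_cong[OF refl]) (simp only: incr_eq[OF t] sum_distrib_left mult.assoc)
    also have "\<dots> = (\<Sum>a\<in>UNIV. expectation (\<lambda>\<omega>. W t s b \<omega> * ipw a t \<omega> * ?q a (XP t \<omega>)))"
      by (rule Bochner_Integration.integral_sum)
         (rule ipw_integral(2)[OF t measurable_F_G[OF WF t] AE_I2[OF W1] proj_TS proj_integrable])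
    also have "\<dots> = 0"
      by (simp only: ipw_martingale_bounded[OF t WF W1 proj_TS proj_integrable] proj_mean mult_zero_right
          sum.neutral_const)
    finally show ?thesis by (simp only: W_def)
  qed
  show "\<bar>expectation (\<lambda>\<omega>. cos (s * (\<Sum>i\<in>{1..<t}. incr v i \<omega>) + b) * (incr v t \<omega>)^2)
        - limit_variance v * expectation (\<lambda>\<omega>. cos (s * (\<Sum>i\<in>{1..<t}. incr v i \<omega>) + b))\<bar> \<le> ?\<delta> t" if t: "t \<ge> 1" for t s b
  proof -
    let ?W = "W t s b"
    let ?h = "\<lambda>a z. (?q a z)^2"
    let ?hb = "\<lambda>a z. (?q a z)^2 / \<pi>bar (fst z) $ a"
    have hTS: "?h a \<in> borel_measurable TS" for a by (intro borel_measurable_power proj_TS)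
    have hbTS: "?hb a \<in> borel_measurable TS" for a by (intro borel_measurable_divide hTS \<pi>bar_TS)
    \<comment> \<open>The past cosine times the surviving inverse probability. It is measurable for
      \<open>\<G> t\<close> but not for the past alone, since the policy sees the current
      context.\<close>
    define U where "U a \<omega> = ?W \<omega> / \<pi> t \<omega> $ a" for a \<omega>
    have UG: "U a \<in> borel_measurable (\<G> t)" for a
      unfolding U_def
      by (rule borel_measurable_divide[OF measurable_F_G[OF WF t] measurable_compose[OF policy_measurable[OF t]
          measurable_vec_nth]])
    have Ub: "AE \<omega> in M. \<bar>U a \<omega>\<bar> \<le> 1 / \<pi>min" for a
      using overlap[OF t, of a]
    proof eventually_elim
      case (elim \<omega>)
      have "\<bar>U a \<omega>\<bar> = \<bar>?W \<omega>\<bar> / \<pi> t \<omega> $ a" using elim \<pi>min_pos by (simp add: U_def)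
      also have "\<dots> \<le> 1 / \<pi>min" using elim \<pi>min_pos W1[of t s b \<omega>] by (intro frac_le) auto
      finally show ?case .
    qed
    note Ui = ipw_integral(1,2,3)[OF t UG Ub hTS proj_square]
    note Wi = ipw_integral(1)[OF t measurable_F_G[OF WF t] AE_I2[OF W1] hbTS proj_square_weighted]
    \<comment> \<open>Where arm \<open>a\<close> is played its weight equals
      \<open>1 / \<pi> t $ a\<close>, so the square of the weight is the weight times that
      number.\<close>
    have sq: "?W \<omega> * (incr v t \<omega>)^2 = (\<Sum>a\<in>UNIV. U a \<omega> * ipw a t \<omega> * ?h a (XP t \<omega>))" if \<omega>: "\<omega> \<in> space M" for \<omega>
    proof -
      let ?a = "A t \<omega>"
      have "(\<Sum>a\<in>UNIV. U a \<omega> * ipw a t \<omega> * ?h a (XP t \<omega>)) = (\<Sum>a\<in>UNIV. ipw a t \<omega> * (U a \<omega> * ?h a (XP t \<omega>)))"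
        by (simp only: mult_ac)
      also have "\<dots> = ipw ?a t \<omega> * (U ?a \<omega> * ?h ?a (XP t \<omega>))" by (rule ipw_sum_collapse)
      also have "\<dots> = ?W \<omega> * (ipw ?a t \<omega> * ?q ?a (XP t \<omega>))^2"
        unfolding U_def ipw_alt power2_eq_square by simp
      also have "ipw ?a t \<omega> * ?q ?a (XP t \<omega>) = incr v t \<omega>"
        unfolding incr_eq[OF t \<omega>] by (rule ipw_sum_collapse[symmetric])
      finally show ?thesis by simp
    qed
    have "expectation (\<lambda>\<omega>. ?W \<omega> * (incr v t \<omega>)^2) = expectation (\<lambda>\<omega>. \<Sum>a\<in>UNIV. U a \<omega> * ipw a t \<omega> * ?h a (XP t \<omega>))"
      by (rule Bochner_Integration.integral_cong[OF refl sq])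
    also have "\<dots> = (\<Sum>a\<in>UNIV. expectation (\<lambda>\<omega>. U a \<omega> * ipw a t \<omega> * ?h a (XP t \<omega>)))"
      by (rule Bochner_Integration.integral_sum) (rule Ui(2))
    also have "\<dots> = (\<Sum>a\<in>UNIV. expectation (\<lambda>\<omega>. U a \<omega> * ?h a (XP t \<omega>)))" by (simp only: Ui(3))
    finally have e1: "expectation (\<lambda>\<omega>. ?W \<omega> * (incr v t \<omega>)^2) = (\<Sum>a\<in>UNIV. expectation (\<lambda>\<omega>. U a \<omega> * ?h a (XP t \<omega>)))" .
    \<comment> \<open>\<open>\<pi>bar\<close> is evaluated at the current context only; unlike with
      \<open>U\<close>, the integrand separates into a past and a present factor.\<close>
    have e2: "limit_variance v * expectation ?W = (\<Sum>a\<in>UNIV. expectation (\<lambda>\<omega>. ?W \<omega> * ?hb a (XP t \<omega>)))"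
      unfolding limit_variance_def
      by (simp only: history_independence[OF t WF W1 hbTS proj_square_weighted] sum_distrib_right sum_distrib_left
          mult.commute)
    have "\<bar>expectation (\<lambda>\<omega>. ?W \<omega> * (incr v t \<omega>)^2) - limit_variance v * expectation ?W\<bar>
        = \<bar>\<Sum>a\<in>UNIV. expectation (\<lambda>\<omega>. U a \<omega> * ?h a (XP t \<omega>) - ?W \<omega> * ?hb a (XP t \<omega>))\<bar>"
      unfolding e1 e2 by (simp only: sum_subtractf[symmetric] Bochner_Integration.integral_diff[OF Ui(1) Wi])
    also have "\<dots> \<le> (\<Sum>a\<in>UNIV. \<bar>expectation (\<lambda>\<omega>. U a \<omega> * ?h a (XP t \<omega>) - ?W \<omega> * ?hb a (XP t \<omega>))\<bar>)" by (rule sum_abs)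
    also have "\<dots> \<le> ?\<delta> t"
    proof (rule sum_mono)
      fix a
      have ih: "integrable M (\<lambda>\<omega>. ?h a (XP t \<omega>))"
        unfolding tuple_integral(1)[OF hTS[of a] t] by (rule proj_square[of v a])
      have ie: "integrable M (\<lambda>\<omega>. weight_error a t \<omega> * ?h a (XP t \<omega>))"
      proof (rule Bochner_Integration.integrable_bound[OF integrable_mult_right[OF ih, of "1 / \<pi>min"]])
        show "(\<lambda>\<omega>. weight_error a t \<omega> * ?h a (XP t \<omega>)) \<in> borel_measurable M"
          by (intro borel_measurable_times weight_error_measurable t measurable_compose[OF XP_measurable[OF t] hTS])
        show "AE \<omega> in M. norm (weight_error a t \<omega> * ?h a (XP t \<omega>)) \<le> norm (1 / \<pi>min * ?h a (XP t \<omega>))"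
          using weight_error_bounds[OF t, of a]
        proof eventually_elim
          case (elim \<omega>)
          have "\<bar>weight_error a t \<omega>\<bar> \<le> \<bar>1 / \<pi>min\<bar>" using elim \<pi>min_pos by (simp add: weight_error_def)
          then show ?case unfolding real_norm_def abs_mult by (rule mult_right_mono) simp
        qed
      qed
      have "\<bar>expectation (\<lambda>\<omega>. U a \<omega> * ?h a (XP t \<omega>) - ?W \<omega> * ?hb a (XP t \<omega>))\<bar>
          \<le> expectation (\<lambda>\<omega>. \<bar>U a \<omega> * ?h a (XP t \<omega>) - ?W \<omega> * ?hb a (XP t \<omega>)\<bar>)" by (rule integral_abs_bound)
      also have "\<dots> \<le> expectation (\<lambda>\<omega>. weight_error a t \<omega> * ?h a (XP t \<omega>))"
      proof (rule integral_mono)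
        show "integrable M (\<lambda>\<omega>. \<bar>U a \<omega> * ?h a (XP t \<omega>) - ?W \<omega> * ?hb a (XP t \<omega>)\<bar>)"
          by (rule integrable_abs[OF Bochner_Integration.integrable_diff[OF Ui(1) Wi]])
        fix \<omega>
        have "U a \<omega> * ?h a (XP t \<omega>) - ?W \<omega> * ?hb a (XP t \<omega>)
            = ?W \<omega> * ((1 / \<pi> t \<omega> $ a - 1 / \<pi>bar (X t \<omega>) $ a) * ?h a (XP t \<omega>))"
          by (simp add: U_def algebra_simps)
        then have "\<bar>U a \<omega> * ?h a (XP t \<omega>) - ?W \<omega> * ?hb a (XP t \<omega>)\<bar> = \<bar>?W \<omega>\<bar> * (weight_error a t \<omega> * ?h a (XP t \<omega>))"
          by (simp only: abs_mult weight_error_def abs_power2)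
        also have "\<dots> \<le> 1 * (weight_error a t \<omega> * ?h a (XP t \<omega>))"
          by (intro mult_right_mono W1 mult_nonneg_nonneg) (simp_all add: weight_error_def)
        finally show "\<bar>U a \<omega> * ?h a (XP t \<omega>) - ?W \<omega> * ?hb a (XP t \<omega>)\<bar> \<le> weight_error a t \<omega> * ?h a (XP t \<omega>)" by simp
      qed (rule ie)
      finally show "\<bar>expectation (\<lambda>\<omega>. U a \<omega> * ?h a (XP t \<omega>) - ?W \<omega> * ?hb a (XP t \<omega>))\<bar>
          \<le> expectation (\<lambda>\<omega>. weight_error a t \<omega> * ?h a (XP t \<omega>))" .
    qed
    finally show ?thesis by (simp only: W_def[abs_def])
  qed
  have "(\<lambda>t. ?\<delta> t) \<longlonglongrightarrow> (\<Sum>a\<in>(UNIV :: 'k set). 0)"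
  proof (intro tendsto_sum)
    fix a
    have "integrable D (\<lambda>z. ((?q a z)^2)^2)" using proj_fourth[of v a] by (simp add: power_mult[symmetric])
    then show "(\<lambda>t. expectation (\<lambda>\<omega>. weight_error a t \<omega> * (?q a (XP t \<omega>))^2)) \<longlonglongrightarrow> 0"
      using weight_error_vanishes[of "\<lambda>z. (?q a z)^2" a] proj_square[of v a] proj_TS[of v a] by simp
  qed
  then show "?\<delta> \<longlonglongrightarrow> 0" by simp
  show "limit_variance v \<ge> 0" by (rule limit_variance_nonneg)
qed

end

section \<open>Asymptotic normality of the estimators\<close>

lemma matrix_inv:
  fixes B :: "real^'n^'n"
  assumes "invertible B" shows "matrix_inv B ** B = mat 1" "B ** matrix_inv B = mat 1"
  using someI_ex[OF assms[unfolded invertible_def]] by (simp_all add: matrix_inv_def)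

section \<open>Block structure and the limit covariance\<close>

definition block :: "real^('k \<times> 'd) \<Rightarrow> 'k::finite \<Rightarrow> real^'d" where
  "block u a = (\<chi> j. u $ (a, j))"

lemma sum_pairs: "(\<Sum>p\<in>(UNIV :: ('k::finite \<times> 'd::finite) set). f p) = (\<Sum>a\<in>UNIV. \<Sum>j\<in>UNIV. f (a, j))"
  by (simp add: sum.cartesian_product flip: UNIV_Times_UNIV)

lemma inner_stack: "u \<bullet> stack w = (\<Sum>a\<in>UNIV. block u a \<bullet> w a)"
  by (simp add: inner_vec_def sum_pairs stack_def block_def)

lemma norm_stack_le: "norm (stack (w :: 'k::finite \<Rightarrow> real^'d)) \<le> CARD('d) * (\<Sum>a\<in>UNIV. norm (w a))"
proof -
  have "norm (stack w) \<le> (\<Sum>p\<in>UNIV. \<bar>stack w $ p\<bar>)" by (rule norm_le_l1_cart)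
  also have "\<dots> = (\<Sum>a\<in>UNIV. \<Sum>j\<in>UNIV. \<bar>w a $ j\<bar>)" by (simp add: sum_pairs stack_def)
  also have "\<dots> \<le> (\<Sum>a\<in>UNIV. \<Sum>j\<in>(UNIV :: 'd set). norm (w a))"
    by (intro sum_mono component_le_norm_cart)
  finally show ?thesis by (simp add: sum_distrib_left)
qed

lemma block_diag_quadratic: "u \<bullet> (block_diag S *v u) = (\<Sum>a\<in>UNIV. block u a \<bullet> (S a *v block u a))"
proof -
  have "(block_diag S *v u) $ (a, j) = (S a *v block u a) $ j" for a j
  proof -
    have "(block_diag S *v u) $ (a, j) = (\<Sum>b\<in>UNIV. \<Sum>i\<in>UNIV. (if a = b then S a $ j $ i else 0) * u $ (b, i))"
      by (simp add: matrix_vector_mult_def sum_pairs block_diag_def cong: if_cong)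
    also have "\<dots> = (\<Sum>b\<in>UNIV. if b = a then (\<Sum>i\<in>UNIV. S a $ j $ i * u $ (a, i)) else 0)"
      by (intro sum.cong refl) auto
    finally show ?thesis by (simp add: matrix_vector_mult_def block_def)
  qed
  then show ?thesis by (simp add: inner_vec_def sum_pairs block_def)
qed

lemma transpose_block_diag: "(\<And>a. transpose (S a) = S a) \<Longrightarrow> transpose (block_diag S) = block_diag S"
  by (simp add: vec_eq_iff transpose_def block_diag_def)

lemma quadratic_entries: "v \<bullet> (B *v v) = (\<Sum>i\<in>UNIV. \<Sum>j\<in>UNIV. v $ i * v $ j * B $ i $ j)"
  by (simp add: inner_vec_def matrix_vector_mult_def sum_distrib_left mult_ac)

context ipw_asymptotics
begin

abbreviation "I \<equiv> weighted_score_covariance D g \<theta>s \<pi>bar"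
abbreviation "\<Sigma>s \<equiv> asymptotic_covariance D g \<theta>s \<pi>bar"

text \<open>Taking entries commutes with the Bochner integral only for integrable functions, so this
  precedes any evaluation of the matrix integral.\<close>

lemma weighted_outer_integrable:
  "integrable D (\<lambda>z. (case z of (x, y) \<Rightarrow> (1 / \<pi>bar x $ a) *\<^sub>R outer (g x (y $ a) (\<theta>s a))) $ i $ j)"
proof -
  have R: "norm (\<theta>s a) \<le> R" using radius[of a] by simp
  note i1 = g_component_square_integrable[OF R, of a i] and i2 = g_component_square_integrable[OF R, of a j]
  show ?thesis
  proof (rule integrable_dominated[OF integrable_mult_right[OF Bochner_Integration.integrable_add[OF i1 i2], of "1 /
      \<pi>min"]])
    have "(\<lambda>z. 1 / \<pi>bar (fst z) $ a * (arm a (\<lambda>x y. g x y (\<theta>s a) $ i) z * arm a (\<lambda>x y. g x y (\<theta>s a) $ j) z))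
        \<in> borel_measurable D"
      by (intro borel_D borel_measurable_times borel_measurable_divide borel_measurable_const \<pi>bar_TS arm_measurable
          g_component)
    then show "(\<lambda>z. (case z of (x, y) \<Rightarrow> (1 / \<pi>bar x $ a) *\<^sub>R outer (g x (y $ a) (\<theta>s a))) $ i $ j)
        \<in> borel_measurable D"
      by (simp add: case_prod_unfold outer_def)
    show "AE z in D. \<bar>(case z of (x, y) \<Rightarrow> (1 / \<pi>bar x $ a) *\<^sub>R outer (g x (y $ a) (\<theta>s a))) $ i $ j\<bar>
        \<le> 1 / \<pi>min * ((arm a (\<lambda>x y. g x y (\<theta>s a) $ i) z)^2 + (arm a (\<lambda>x y. g x y (\<theta>s a) $ j) z)^2)"
      using limit_policy_overlap[of a]
    proof eventually_elim
      case (elim z)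
      let ?p = "\<pi>bar (fst z) $ a" and ?x = "g (fst z) (snd z $ a) (\<theta>s a) $ i"
          and ?y = "g (fst z) (snd z $ a) (\<theta>s a) $ j"
      have "\<bar>1 / ?p\<bar> \<le> 1 / \<pi>min" using elim \<pi>min_pos by (simp add: frac_le)
      then have "\<bar>1 / ?p\<bar> * (\<bar>?x\<bar> * \<bar>?y\<bar>) \<le> 1 / \<pi>min * (?x^2 + ?y^2)"
        using \<pi>min_pos abs_mult_le_sum_squares[of ?x ?y] by (intro mult_mono) auto
      then show ?case by (simp add: case_prod_unfold outer_def abs_mult)
    qed
  qed
qed

lemma I_component: "I a $ i $ j = (LINT z|D. 1 / \<pi>bar (fst z) $ a * (g (fst z) (snd z $ a) (\<theta>s a) $ i * g (fst z) (snd
    z $ a) (\<theta>s a) $ j))"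
proof -
  have ii: "integrable D (\<lambda>z. (case z of (x, y) \<Rightarrow> (1 / \<pi>bar x $ a) *\<^sub>R outer (g x (y $ a) (\<theta>s a))) $ i)" for i
    by (rule integrable_vec[OF weighted_outer_integrable])
  show ?thesis
    unfolding weighted_score_covariance_def integral_vec_nth[OF integrable_vec[OF ii]] integral_vec_nth[OF ii]
    by (simp add: case_prod_unfold outer_def)
qed

lemma I_symmetric: "transpose (I a) = I a"
  by (simp add: vec_eq_iff transpose_def I_component mult.commute)

lemma I_quadratic: "w \<bullet> (I a *v w) = (LINT z|D. (w \<bullet> g (fst z) (snd z $ a) (\<theta>s a))^2 / \<pi>bar (fst z) $ a)"
proof -
  let ?g = "\<lambda>z. g (fst z) (snd z $ a) (\<theta>s a)"
  have i: "integrable D (\<lambda>z. 1 / \<pi>bar (fst z) $ a * (?g z $ i * ?g z $ j))" for i j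
    using weighted_outer_integrable[of a i j] by (simp add: case_prod_unfold outer_def)
  have "w \<bullet> (I a *v w) = (\<Sum>i\<in>UNIV. \<Sum>j\<in>UNIV. (LINT z|D. w $ i * w $ j * (1 / \<pi>bar (fst z) $ a * (?g z $ i * ?g z $
      j))))"
    unfolding quadratic_entries I_component by (simp only: integral_mult_right_zero)
  also have "\<dots> = (\<Sum>i\<in>UNIV. (LINT z|D. (\<Sum>j\<in>UNIV. w $ i * w $ j * (1 / \<pi>bar (fst z) $ a * (?g z $ i * ?g z $ j)))))"
    by (intro sum.cong refl Bochner_Integration.integral_sum[symmetric] integrable_mult_right i)
  also have "\<dots> = (LINT z|D. (\<Sum>i\<in>UNIV. \<Sum>j\<in>UNIV. w $ i * w $ j * (1 / \<pi>bar (fst z) $ a * (?g z $ i * ?g z $ j))))"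
    by (intro Bochner_Integration.integral_sum[symmetric] Bochner_Integration.integrable_sum integrable_mult_right i)
  also have "\<dots> = (LINT z|D. (w \<bullet> ?g z)^2 / \<pi>bar (fst z) $ a)"
    by (intro Bochner_Integration.integral_cong refl)
       (simp add: inner_vec_def power2_eq_square sum_product sum_divide_distrib mult_ac)
  finally show ?thesis .
qed

text \<open>The coefficient with which the score of arm \<open>a\<close> enters
  \<open>u \<bullet> Z\<close> in the linear representation: the inverse Jacobian moved to the other
  side of the inner product, with the sign of a Newton step.\<close>

definition direction :: "real^('k \<times> 'd) \<Rightarrow> 'k \<Rightarrow> real^'d" where
  "direction u a = - (transpose (matrix_inv (J a)) *v block u a)"

lemma direction_inner: "direction u a \<bullet> w = - (block u a \<bullet> (matrix_inv (J a) *v w))"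
  by (simp add: direction_def dot_lmul_matrix[symmetric])

text \<open>The outer factors of the sandwich matrix move onto \<open>u\<close> by transposition;
  the minus sign of \<open>direction\<close> disappears in the square.\<close>

lemma covariance_quadratic: "u \<bullet> (block_diag \<Sigma>s *v u) = limit_variance (direction u)"
proof -
  have "block u a \<bullet> (\<Sigma>s a *v block u a) = (LINT z|D. (arm a (proj (direction u) a) z)^2 / \<pi>bar (fst z) $ a)" for a
  proof -
    let ?w = "transpose (matrix_inv (J a)) *v block u a"
    have "block u a \<bullet> (\<Sigma>s a *v block u a) = ?w \<bullet> (I a *v ?w)"
      by (simp add: asymptotic_covariance_def matrix_vector_mul_assoc[symmetric] dot_lmul_matrix[symmetric])
    also have "\<dots> = (LINT z|D. (?w \<bullet> g (fst z) (snd z $ a) (\<theta>s a))^2 / \<pi>bar (fst z) $ a)" by (rule I_quadratic)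
    finally show ?thesis by (simp add: proj_def direction_def case_prod_unfold)
  qed
  then show ?thesis unfolding block_diag_quadratic limit_variance_def by simp
qed

lemma limit_law_exists: obtains N where "multivariate_normal 0 (block_diag \<Sigma>s) N"
proof (rule multivariate_normal_exists)
  show "transpose (block_diag \<Sigma>s) = block_diag \<Sigma>s"
    by (rule transpose_block_diag)
       (simp add: asymptotic_covariance_def matrix_transpose_mul I_symmetric matrix_mul_assoc)
  show "x \<bullet> (block_diag \<Sigma>s *v x) \<ge> 0" for x
    by (simp add: covariance_quadratic limit_variance_nonneg)
qed (rule that)

lemma J_inverse: "matrix_inv (J a) *v (J a *v w) = w" "J a *v (matrix_inv (J a) *v w) = w"
  using matrix_inv[OF nonsingular[of a]] by (simp_all add: matrix_vector_mul_assoc)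

text \<open>One is added to the operator norm so that \<open>\<kappa>\<close> can be divided
  by.\<close>

lemma J_inverse_bound: obtains \<kappa> where "\<kappa> > 0" "\<forall>w. norm (matrix_inv (J a) *v w) \<le> \<kappa> * norm w"
proof (rule that[of "spectral_norm (matrix_inv (J a)) + 1"])
  show "spectral_norm (matrix_inv (J a)) + 1 > 0" using spectral_norm_nonneg[of "matrix_inv (J a)"] by linarith
  show "\<forall>w. norm (matrix_inv (J a) *v w) \<le> (spectral_norm (matrix_inv (J a)) + 1) * norm w"
    unfolding distrib_right using norm_mult_spectral_norm[of "matrix_inv (J a)"] by (auto intro: add_increasing2)
qed

text \<open>With \<open>x\<close> the vector to be bounded and \<open>d\<close> the scaled error,
  linearization gives \<open>norm x \<le> \<kappa> * (e2 + e1 * norm d)\<close>, and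
  \<open>norm d \<le> norm x + \<kappa> * L\<close>. For small \<open>e1\<close> this closes up to a
  bound on \<open>x\<close> alone, so the root rate of the estimator and the representation come out
  together.\<close>

lemma linear_representation:
  assumes bound: "\<And>T \<omega>. T \<ge> 1 \<Longrightarrow> \<omega> \<in> space M \<Longrightarrow> norm (\<theta>h T \<omega>) \<le> R"
    and root: "\<And>\<epsilon>. \<epsilon> > 0 \<Longrightarrow> whp M (\<lambda>T \<omega>. norm (sqrt (real T) *\<^sub>R score a T (\<theta>h T \<omega>) \<omega>) \<le> \<epsilon>)" and \<epsilon>: "\<epsilon> > 0"
  shows "whp M (\<lambda>T \<omega>. norm (sqrt (real T) *\<^sub>R (\<theta>h T \<omega> - \<theta>s a)
      + matrix_inv (J a) *v (sqrt (real T) *\<^sub>R score a T (\<theta>s a) \<omega>)) \<le> \<epsilon>)"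
proof (rule whp_of_asymp_prob_ge)
  fix \<eta> :: real assume \<eta>: "\<eta> > 0"
  obtain \<kappa> where \<kappa>0: "\<kappa> > 0" "\<forall>w. norm (matrix_inv (J a) *v w) \<le> \<kappa> * norm w" by (rule J_inverse_bound[of a])
  note \<kappa> = \<kappa>0[rule_format]
  obtain L where L: "L > 0" "asymp_prob_ge M \<eta> (\<lambda>T \<omega>. norm (sqrt (real T) *\<^sub>R score a T (\<theta>s a) \<omega>) \<le> L)"
    by (rule bounded_in_probD[OF score_root_bounded \<eta>])
  have root': "whp M (\<lambda>T \<omega>. norm (score a T (\<theta>h T \<omega>) \<omega>) \<le> e)" if "e > 0" for e
  proof (rule whp_mono_ev[OF root[OF that]], rule eventually_mono[OF eventually_ge_at_top[of 1]], intro ballI impI)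
    fix T :: nat and \<omega> assume T: "1 \<le> T" and le: "norm (sqrt (real T) *\<^sub>R score a T (\<theta>h T \<omega>) \<omega>) \<le> e"
    have "1 * norm (score a T (\<theta>h T \<omega>) \<omega>) \<le> sqrt (real T) * norm (score a T (\<theta>h T \<omega>) \<omega>)"
      using T by (intro mult_right_mono) auto
    then show "norm (score a T (\<theta>h T \<omega>) \<omega>) \<le> e" using le by simp
  qed
  have cons: "whp M (\<lambda>T \<omega>. norm (\<theta>h T \<omega> - \<theta>s a) \<le> e)" if "e > 0" for e
    by (rule consistency[OF bound root' that])
  \<comment> \<open>The first entry of the minimum gives \<open>\<kappa> * e1 \<le> 1 / 2\<close>,
    which absorbs \<open>norm x\<close>; the second gives
    \<open>\<kappa>^2 * e1 * L \<le> \<epsilon> / 4\<close>. Together with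
    \<open>\<kappa> * e2 = \<epsilon> / 4\<close> half of \<open>norm x\<close> is at most
    \<open>\<epsilon> / 2\<close>.\<close>
  define e1 where "e1 = min (1 / (2 * \<kappa>)) (\<epsilon> / (4 * \<kappa>^2 * L))"
  define e2 where "e2 = \<epsilon> / (4 * \<kappa>)"
  have e: "e1 > 0" "e2 > 0" using \<kappa>(1) L \<epsilon> by (auto simp: e1_def e2_def)
  have "whp M (\<lambda>T \<omega>. norm (score a T (\<theta>h T \<omega>) \<omega> - score a T (\<theta>s a) \<omega> - J a *v (\<theta>h T \<omega> - \<theta>s a))
      \<le> e1 * norm (\<theta>h T \<omega> - \<theta>s a)
      \<and> norm (sqrt (real T) *\<^sub>R score a T (\<theta>h T \<omega>) \<omega>) \<le> e2)"
    by (rule whp_conj[OF linearization[OF cons e(1)] root[OF e(2)]])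
  then have "whp M (\<lambda>T \<omega>. norm (sqrt (real T) *\<^sub>R score a T (\<theta>s a) \<omega>) \<le> L \<longrightarrow>
      norm (sqrt (real T) *\<^sub>R (\<theta>h T \<omega> - \<theta>s a) + matrix_inv (J a) *v (sqrt (real T) *\<^sub>R score a T (\<theta>s a) \<omega>)) \<le> \<epsilon>)"
  proof (rule whp_mono, intro impI)
    fix T \<omega>
    let ?s = "sqrt (real T)"
    assume *: "norm (score a T (\<theta>h T \<omega>) \<omega> - score a T (\<theta>s a) \<omega> - J a *v (\<theta>h T \<omega> - \<theta>s a)) \<le> e1 * norm (\<theta>h T \<omega> - \<theta>s a)
      \<and> norm (?s *\<^sub>R score a T (\<theta>h T \<omega>) \<omega>) \<le> e2" and l: "norm (?s *\<^sub>R score a T (\<theta>s a) \<omega>) \<le> L"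
    define d r s0 where "d = ?s *\<^sub>R (\<theta>h T \<omega> - \<theta>s a)" and "r = ?s *\<^sub>R score a T (\<theta>h T \<omega>) \<omega>"
        and "s0 = ?s *\<^sub>R score a T (\<theta>s a) \<omega>"
    define x where "x = d + matrix_inv (J a) *v s0"
    have "r - s0 - J a *v d = ?s *\<^sub>R (score a T (\<theta>h T \<omega>) \<omega> - score a T (\<theta>s a) \<omega> - J a *v (\<theta>h T \<omega> - \<theta>s a))"
      by (simp only: d_def r_def s0_def matrix_vector_mult_scaleR scaleR_diff_right[symmetric])
    then have "norm (r - s0 - J a *v d) = ?s * norm (score a T (\<theta>h T \<omega>) \<omega> - score a T (\<theta>s a) \<omega> - J a *v (\<theta>h T \<omega>
        - \<theta>s a))"
      by simp
    also have "\<dots> \<le> ?s * (e1 * norm (\<theta>h T \<omega> - \<theta>s a))" using * by (intro mult_left_mono) auto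
    also have "\<dots> = e1 * norm d" by (simp add: d_def)
    finally have rem: "norm (r - s0 - J a *v d) \<le> e1 * norm d" .
    have x_eq: "x = matrix_inv (J a) *v (r - (r - s0 - J a *v d))"
      by (simp add: x_def matrix_vector_mult_diff_distrib matrix_vector_right_distrib J_inverse)
    have "norm x \<le> \<kappa> * norm (r - (r - s0 - J a *v d))" unfolding x_eq by (rule \<kappa>(2))
    also have "\<dots> \<le> \<kappa> * (norm r + norm (r - s0 - J a *v d))" using \<kappa>(1)
        by (intro mult_left_mono norm_triangle_ineq4) auto
    also have "\<dots> \<le> \<kappa> * (e2 + e1 * norm d)" using \<kappa>(1) * rem by (intro mult_left_mono add_mono) (auto simp: r_def)
    finally have 1: "norm x \<le> \<kappa> * (e2 + e1 * norm d)" .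
    have "norm d \<le> norm x + norm (matrix_inv (J a) *v s0)"
      using norm_triangle_ineq4[of x "matrix_inv (J a) *v s0"] by (simp add: x_def)
    also have "norm (matrix_inv (J a) *v s0) \<le> \<kappa> * norm s0" by (rule \<kappa>(2))
    also have "\<kappa> * norm s0 \<le> \<kappa> * L" using l \<kappa>(1) by (simp add: s0_def)
    finally have 2: "norm d \<le> norm x + \<kappa> * L" by simp
    have "\<kappa> * e1 \<le> 1 / 2"
    proof -
      have "\<kappa> * e1 \<le> \<kappa> * (1 / (2 * \<kappa>))" using \<kappa>(1) by (intro mult_left_mono) (auto simp: e1_def)
      then show ?thesis using \<kappa>(1) by simp
    qed
    then have "\<kappa> * e1 * norm x \<le> 1 / 2 * norm x" by (rule mult_right_mono) simp
    moreover have "\<kappa> * e1 * norm d \<le> \<kappa> * e1 * (norm x + \<kappa> * L)" using 2 \<kappa>(1) e by (intro mult_left_mono) auto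
    moreover have "\<kappa> * e1 * (\<kappa> * L) \<le> \<epsilon> / 4"
    proof -
      have "\<kappa> * e1 * (\<kappa> * L) = e1 * (\<kappa>^2 * L)" by (simp add: power2_eq_square)
      also have "\<dots> \<le> \<epsilon> / (4 * \<kappa>^2 * L) * (\<kappa>^2 * L)" using \<kappa>(1) L by (intro mult_right_mono) (auto simp: e1_def)
      also have "\<dots> = \<epsilon> / 4" using \<kappa>(1) L by simp
      finally show ?thesis .
    qed
    moreover have "\<kappa> * e2 = \<epsilon> / 4" using \<kappa>(1) by (simp add: e2_def)
    ultimately have "norm x \<le> \<epsilon>" using 1 by (simp add: distrib_left mult.assoc)
    then show "norm (?s *\<^sub>R (\<theta>h T \<omega> - \<theta>s a) + matrix_inv (J a) *v (?s *\<^sub>R score a T (\<theta>s a) \<omega>)) \<le> \<epsilon>"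
      by (simp add: x_def d_def s0_def)
  qed
  then show "\<exists>Q'. asymp_prob_ge M \<eta> Q' \<and> whp M (\<lambda>T \<omega>. Q' T \<omega> \<longrightarrow>
      norm (sqrt (real T) *\<^sub>R (\<theta>h T \<omega> - \<theta>s a) + matrix_inv (J a) *v (sqrt (real T) *\<^sub>R score a T (\<theta>s a) \<omega>)) \<le> \<epsilon>)"
    using L(2) by blast
qed

text \<open>An estimator only has to be a measurable function of the data, so it may use \<open>\<theta>s\<close> and \<open>J\<close>.\<close>

definition one_step :: "'k \<Rightarrow> nat \<Rightarrow> 'w \<Rightarrow> real^'d" where
  "one_step a T \<omega> = (let z = \<theta>s a - matrix_inv (J a) *v score a T (\<theta>s a) \<omega> in if norm z \<le> R then z else \<theta>s a)"

lemma one_step_bound: "norm (one_step a T \<omega>) \<le> R"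
  using radius[of a] by (simp add: one_step_def Let_def)

lemma one_step_F: "one_step a T \<in> borel_measurable (\<F> T)"
proof -
  have [measurable]: "(\<lambda>\<omega>. \<theta>s a - matrix_inv (J a) *v score a T (\<theta>s a) \<omega>) \<in> borel_measurable (\<F> T)"
    by (intro borel_measurable_diff borel_measurable_const measurable_compose[OF score_F]
        borel_measurable_continuous_onI matrix_vector_mult_linear_continuous_on)
  show ?thesis unfolding one_step_def Let_def by measurable
qed

text \<open>The Newton step cancels the linear part of the score, so what remains is the
  linearization error: a small multiple of the step, which is itself of order
  \<open>1 / sqrt T\<close>.\<close>

lemma one_step_score:
  assumes \<epsilon>: "\<epsilon> > 0" shows "whp M (\<lambda>T \<omega>. norm (sqrt (real T) *\<^sub>R score a T (one_step a T \<omega>) \<omega>) \<le> \<epsilon>)"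
proof -
  obtain \<kappa> where \<kappa>0: "\<kappa> > 0" "\<forall>w. norm (matrix_inv (J a) *v w) \<le> \<kappa> * norm w" by (rule J_inverse_bound[of a])
  note \<kappa> = \<kappa>0[rule_format]
  have R: "norm (\<theta>s a) \<le> R" using radius[of a] by simp
  have step: "whp M (\<lambda>T \<omega>. norm (matrix_inv (J a) *v score a T (\<theta>s a) \<omega>) \<le> e)" if "e > 0" for e
  proof -
    have "whp M (\<lambda>T \<omega>. norm (score a T (\<theta>s a) \<omega> - G a (\<theta>s a)) \<le> e / \<kappa>)" using that \<kappa>(1) by (intro score_lln R) simp
    then show ?thesis
    proof (rule whp_mono)
      fix T \<omega> assume "norm (score a T (\<theta>s a) \<omega> - G a (\<theta>s a)) \<le> e / \<kappa>"
      then have "norm (score a T (\<theta>s a) \<omega>) \<le> e / \<kappa>" using target[of a] by (simp add: G_def)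
      then have "\<kappa> * norm (score a T (\<theta>s a) \<omega>) \<le> e" using \<kappa>(1) by (simp add: pos_le_divide_eq mult.commute)
      then show "norm (matrix_inv (J a) *v score a T (\<theta>s a) \<omega>) \<le> e" using \<kappa>(2) order_trans by blast
    qed
  qed
  \<comment> \<open>The true parameter lies strictly inside the ball, so the fallback value in
    \<open>one_step\<close> is used with vanishing probability only.\<close>
  have inside: "whp M (\<lambda>T \<omega>. one_step a T \<omega> = \<theta>s a - matrix_inv (J a) *v score a T (\<theta>s a) \<omega>)"
  proof (rule whp_mono[OF step])
    show "R - norm (\<theta>s a) > 0" using radius[of a] by simp
    fix T \<omega> assume "norm (matrix_inv (J a) *v score a T (\<theta>s a) \<omega>) \<le> R - norm (\<theta>s a)"
    then have "norm (\<theta>s a - matrix_inv (J a) *v score a T (\<theta>s a) \<omega>) \<le> R"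
      using norm_triangle_ineq4[of "\<theta>s a" "matrix_inv (J a) *v score a T (\<theta>s a) \<omega>"] by linarith
    then show "one_step a T \<omega> = \<theta>s a - matrix_inv (J a) *v score a T (\<theta>s a) \<omega>" by (simp add: one_step_def)
  qed
  have cons: "whp M (\<lambda>T \<omega>. norm (one_step a T \<omega> - \<theta>s a) \<le> e)" if "e > 0" for e
    by (rule whp_mono[OF whp_conj[OF inside step[OF that]]]) simp
  show ?thesis
  proof (rule whp_of_asymp_prob_ge)
    fix \<eta> :: real assume \<eta>: "\<eta> > 0"
    obtain L where L: "L > 0" "asymp_prob_ge M \<eta> (\<lambda>T \<omega>. norm (sqrt (real T) *\<^sub>R score a T (\<theta>s a) \<omega>) \<le> L)"
      by (rule bounded_in_probD[OF score_root_bounded \<eta>])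
    \<comment> \<open>The final bound is \<open>e1 * \<kappa> * L\<close>, with
      \<open>\<kappa>\<close> from the inverse Jacobian and \<open>L\<close> from the scaled
      score.\<close>
    define e1 where "e1 = \<epsilon> / (\<kappa> * L)"
    have e1: "e1 > 0" using \<epsilon> \<kappa>(1) L by (simp add: e1_def)
    have both: "whp M (\<lambda>T \<omega>. one_step a T \<omega> = \<theta>s a - matrix_inv (J a) *v score a T (\<theta>s a) \<omega> \<and>
        norm (score a T (one_step a T \<omega>) \<omega> - score a T (\<theta>s a) \<omega> - J a *v (one_step a T \<omega> - \<theta>s a)) \<le> e1 * norm
            (one_step a T \<omega> - \<theta>s a))"
      by (rule whp_conj[OF inside linearization[OF cons e1]])
    have "whp M (\<lambda>T \<omega>. norm (sqrt (real T) *\<^sub>R score a T (\<theta>s a) \<omega>) \<le> L \<longrightarrow>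
        norm (sqrt (real T) *\<^sub>R score a T (one_step a T \<omega>) \<omega>) \<le> \<epsilon>)"
    proof (rule whp_mono[OF both], intro impI)
      fix T \<omega>
      let ?s = "sqrt (real T)"
      assume *: "one_step a T \<omega> = \<theta>s a - matrix_inv (J a) *v score a T (\<theta>s a) \<omega> \<and>
          norm (score a T (one_step a T \<omega>) \<omega> - score a T (\<theta>s a) \<omega> - J a *v (one_step a T \<omega> - \<theta>s a)) \<le> e1 * norm
              (one_step a T \<omega> - \<theta>s a)"
        and l: "norm (?s *\<^sub>R score a T (\<theta>s a) \<omega>) \<le> L"
      define s0 where "s0 = score a T (\<theta>s a) \<omega>"
      have d: "one_step a T \<omega> - \<theta>s a = - (matrix_inv (J a) *v s0)" using * by (simp add: s0_def)
      have neg: "B *v (- w) = - (B *v w)" for B :: "real^'d^'d" and w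
        using matrix_vector_mult_scaleR[of B "-1" w] by simp
      have "J a *v (one_step a T \<omega> - \<theta>s a) = - s0" unfolding d neg J_inverse ..
      then have "norm (score a T (one_step a T \<omega>) \<omega>) \<le> e1 * norm (matrix_inv (J a) *v s0)"
        using conjunct2[OF *] by (simp add: d s0_def[symmetric])
      also have "\<dots> \<le> e1 * (\<kappa> * norm s0)" using e1 by (intro mult_left_mono \<kappa>(2)) auto
      finally have "?s * norm (score a T (one_step a T \<omega>) \<omega>) \<le> ?s * (e1 * (\<kappa> * norm s0))"
          by (rule mult_left_mono) simp
      also have "\<dots> = e1 * \<kappa> * norm (?s *\<^sub>R s0)" by simp
      also have "\<dots> \<le> e1 * \<kappa> * L" using l e1 \<kappa>(1) by (intro mult_left_mono) (auto simp: s0_def)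
      also have "\<dots> = \<epsilon>" using \<kappa>(1) L by (simp add: e1_def)
      finally show "norm (?s *\<^sub>R score a T (one_step a T \<omega>) \<omega>) \<le> \<epsilon>" by simp
    qed
    then show "\<exists>Q'. asymp_prob_ge M \<eta> Q' \<and> whp M (\<lambda>T \<omega>. Q' T \<omega>
        \<longrightarrow> norm (sqrt (real T) *\<^sub>R score a T (one_step a T \<omega>) \<omega>) \<le> \<epsilon>)"
      using L(2) by blast
  qed
qed

lemma estimators_exist: "ipw_estimators M g R X \<pi> A Y one_step"
  unfolding ipw_estimators_def small_o_p_def
proof (intro conjI allI impI ballI)
  show "tends_to_zero_in_prob M (\<lambda>T \<omega>. score a T (one_step a T \<omega>) \<omega> /\<^sub>R (1 / sqrt (real T)))" for a
    by (rule tends_to_zero_in_probI) (use one_step_score in simp)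
qed (rule one_step_F, rule one_step_bound)

text \<open>Combines three facts: the scaled errors are linear images of the scaled scores up to
  vanishing remainders, the scores satisfy the cosine limit in every direction, and the same
  representation supplies tightness.\<close>

lemma estimators_asymptotically_normal:
  assumes est: "ipw_estimators M g R X \<pi> A Y \<theta>h" and N: "multivariate_normal 0 (block_diag \<Sigma>s) N"
  shows "converges_in_distribution M (\<lambda>T \<omega>. sqrt (real T) *\<^sub>R (stack (\<lambda>a. \<theta>h a T \<omega>) - stack \<theta>s)) N"
proof -
  have hF: "\<theta>h a T \<in> borel_measurable (\<F> T)" if "T \<ge> 1" for a T using est that by (simp add: ipw_estimators_def)
  have bound: "norm (\<theta>h a T \<omega>) \<le> R" if "T \<ge> 1" "\<omega> \<in> space M" for a T \<omega> using est that
      by (simp add: ipw_estimators_def)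
  have root: "whp M (\<lambda>T \<omega>. norm (sqrt (real T) *\<^sub>R score a T (\<theta>h a T \<omega>) \<omega>) \<le> \<epsilon>)" if "\<epsilon> > 0" for a \<epsilon>
  proof -
    have "tends_to_zero_in_prob M (\<lambda>T \<omega>. score a T (\<theta>h a T \<omega>) \<omega> /\<^sub>R (1 / sqrt (real T)))"
      using est by (simp add: ipw_estimators_def small_o_p_def)
    moreover have "eventually (\<lambda>T. (\<lambda>\<omega>. score a T (\<theta>h a T \<omega>) \<omega> /\<^sub>R (1 / sqrt (real T)))
        \<in> borel_measurable M) sequentially"
    proof (rule eventually_mono[OF eventually_ge_at_top[of 1]])
      fix T :: nat assume "1 \<le> T"
      then show "(\<lambda>\<omega>. score a T (\<theta>h a T \<omega>) \<omega> /\<^sub>R (1 / sqrt (real T))) \<in> borel_measurable M"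
        by (intro borel_measurable_scaleR borel_measurable_const measurable_from_subalg[OF subalgebra_F
            score_estimator_measurable] hF)
    qed
    ultimately have "whp M (\<lambda>T \<omega>. norm (score a T (\<theta>h a T \<omega>) \<omega> /\<^sub>R (1 / sqrt (real T))) \<le> \<epsilon>)"
      by (rule whp_of_tends_to_zero[OF _ that])
    then show ?thesis by (simp only: inverse_divide div_by_1)
  qed
  define d where "d a T \<omega> = sqrt (real T) *\<^sub>R (\<theta>h a T \<omega> - \<theta>s a)" for a T \<omega>
  define s0 where "s0 a T \<omega> = sqrt (real T) *\<^sub>R score a T (\<theta>s a) \<omega>" for a T \<omega>
  define x where "x a T \<omega> = d a T \<omega> + matrix_inv (J a) *v s0 a T \<omega>" for a T \<omega>
  define Z where "Z T \<omega> = sqrt (real T) *\<^sub>R (stack (\<lambda>a. \<theta>h a T \<omega>) - stack \<theta>s)" for T \<omega>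
  have Z_eq: "Z T \<omega> = stack (\<lambda>a. d a T \<omega>)" for T \<omega>
    by (simp add: Z_def d_def stack_def vec_eq_iff)
  have lin: "whp M (\<lambda>T \<omega>. norm (x a T \<omega>) \<le> \<epsilon>)" if "\<epsilon> > 0" for a \<epsilon>
    unfolding x_def d_def s0_def by (rule linear_representation[OF bound root that])
  have dM: "d a T \<in> borel_measurable M" if "T \<ge> 1" for a T
    unfolding d_def
    by (intro borel_measurable_scaleR borel_measurable_const borel_measurable_diff measurable_from_subalg[OF
        subalgebra_F hF[OF that]])
  have ZM: "Z T \<in> borel_measurable M" if "T \<ge> 1" for T
    unfolding Z_eq[abs_def] stack_def
    by (rule measurable_vec_lambda) (rule measurable_compose[OF dM[OF that] measurable_vec_nth])
  have "converges_in_distribution M Z N"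
  proof (rule converges_in_distribution_cosI)
    show "prob_space M" by (rule prob_space_axioms)
    show "prob_space N" by (rule multivariate_normal_prob[OF N])
    show "sets N = sets borel" by (rule multivariate_normal_sets[OF N])
    show "eventually (\<lambda>T. Z T \<in> borel_measurable M) sequentially"
      by (rule eventually_mono[OF eventually_ge_at_top[of 1] ZM])
  next
    fix \<eta> :: real assume \<eta>: "\<eta> > 0"
    \<comment> \<open>Up to an error of at most 1 with high probability, \<open>d a\<close> is a
      fixed linear image of the scaled score, which is bounded in probability.\<close>
    have "bounded_in_prob M (d a)" for a
    proof -
      obtain \<kappa> where \<kappa>0: "\<kappa> > 0" "\<forall>w. norm (matrix_inv (J a) *v w) \<le> \<kappa> * norm w" by (rule J_inverse_bound[of a])
  note \<kappa> = \<kappa>0[rule_format]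
      have "whp M (\<lambda>T \<omega>. norm (d a T \<omega>) \<le> \<kappa> * norm (s0 a T \<omega>) + 1)"
      proof (rule whp_mono[OF lin[of 1 a]])
        fix T \<omega> assume "norm (x a T \<omega>) \<le> 1"
        moreover have "norm (d a T \<omega>) \<le> norm (x a T \<omega>) + norm (matrix_inv (J a) *v s0 a T \<omega>)"
          using norm_triangle_ineq4[of "x a T \<omega>" "matrix_inv (J a) *v s0 a T \<omega>"] by (simp add: x_def)
        ultimately show "norm (d a T \<omega>) \<le> \<kappa> * norm (s0 a T \<omega>) + 1" using \<kappa>(2)[of "s0 a T \<omega>"] by linarith
      qed simp
      moreover have "bounded_in_prob M (s0 a)" using score_root_bounded[of a] by (simp add: s0_def[abs_def])
      ultimately show ?thesis using \<kappa>(1) by (intro bounded_in_prob_whp_le[of "s0 a" "d a" \<kappa> 1]) auto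
    qed
    then have "bounded_in_prob M (\<lambda>T \<omega>. \<Sum>a\<in>UNIV. norm (d a T \<omega>))" by (intro bounded_in_prob_sum) auto
    then have "bounded_in_prob M Z"
    proof (rule bounded_in_prob_whp_le)
      show "whp M (\<lambda>T \<omega>. norm (Z T \<omega>) \<le> CARD('d) * norm (\<Sum>a\<in>UNIV. norm (d a T \<omega>)) + 0)"
        unfolding whp_def Z_eq using norm_stack_le[where 'k = 'k and 'd = 'd]
            by (auto intro!: asymp_prob_ge_True simp: sum_nonneg)
    qed simp
    from bounded_in_probD[OF this \<eta>] obtain L where "asymp_prob_ge M \<eta> (\<lambda>T \<omega>. norm (Z T \<omega>) \<le> L)" by blast
    from asymp_prob_geD[OF this] \<eta>
    show "\<exists>L. eventually (\<lambda>T. prob {\<omega> \<in> space M. norm (Z T \<omega>) > L} \<le> \<eta>) sequentially"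
      by (auto simp: not_le)
  next
    fix u :: "real^('k \<times> 'd)" and b :: real
    let ?v = "direction u"
    let ?S = "\<lambda>T \<omega>. (\<Sum>t=1..T. incr ?v t \<omega>) / sqrt (real T)"
    have S_eq: "?S T \<omega> = (\<Sum>a\<in>UNIV. ?v a \<bullet> s0 a T \<omega>)" for T \<omega>
    proof -
      have "(\<Sum>t=1..T. incr ?v t \<omega>) = (\<Sum>a\<in>UNIV. \<Sum>t=1..T. ipw a t \<omega> * (?v a \<bullet> g (X t \<omega>) (Y t \<omega>) (\<theta>s a)))"
        unfolding incr_def proj_def by (rule sum.swap)
      also have "\<dots> = (\<Sum>a\<in>UNIV. ?v a \<bullet> (\<Sum>t=1..T. ipw a t \<omega> *\<^sub>R g (X t \<omega>) (Y t \<omega>) (\<theta>s a)))"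
        by (simp add: inner_sum_right)
      finally have "?S T \<omega> = (\<Sum>a\<in>UNIV. ?v a \<bullet> (\<Sum>t=1..T. ipw a t \<omega> *\<^sub>R g (X t \<omega>) (Y t \<omega>) (\<theta>s a))) / sqrt (real T)"
          by simp
      also have "\<dots> = (\<Sum>a\<in>UNIV. ?v a \<bullet> s0 a T \<omega>)"
      proof -
        \<comment> \<open>Also true at \<open>T = 0\<close>, where both sides are 0 by the
          convention for division.\<close>
        have q: "sqrt (real T) * (1 / real T) = 1 / sqrt (real T)"
          by (cases "T = 0") (simp_all add: field_simps)
        show ?thesis unfolding s0_def score_alt sum_divide_distrib
          by (intro sum.cong refl) (simp only: inner_scaleR_right mult.assoc[symmetric] q, simp)
      qed
      finally show ?thesis .
    qed
    \<comment> \<open>In direction \<open>u\<close>, the stacked error and the normalized sum of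
      increments along \<open>direction u\<close> differ only through the remainders
      \<open>x\<close>, which vanish in probability.\<close>
    have diff: "u \<bullet> Z T \<omega> - ?S T \<omega> = (\<Sum>a\<in>UNIV. block u a \<bullet> x a T \<omega>)" for T \<omega>
      unfolding Z_eq inner_stack S_eq direction_inner x_def
      by (simp add: inner_add_right sum.distrib sum_negf)
    have close: "whp M (\<lambda>T \<omega>. \<bar>(u \<bullet> Z T \<omega> + b) - (?S T \<omega> + b)\<bar> \<le> \<epsilon>)" if \<epsilon>: "\<epsilon> > 0" for \<epsilon>
    proof -
      \<comment> \<open>The summand 1 keeps \<open>c\<close> positive when
        \<open>u = 0\<close>.\<close>
      define c where "c = (\<Sum>a\<in>UNIV. norm (block u a)) + 1"
      have c: "c > 0" unfolding c_def by (intro add_nonneg_pos sum_nonneg) auto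
      have "whp M (\<lambda>T \<omega>. \<forall>a\<in>UNIV. norm (x a T \<omega>) \<le> \<epsilon> / c)"
        using lin \<epsilon> c by (intro whp_finite_ball) auto
      then show ?thesis
      proof (rule whp_mono)
        fix T \<omega> assume *: "\<forall>a\<in>UNIV. norm (x a T \<omega>) \<le> \<epsilon> / c"
        have "\<bar>(u \<bullet> Z T \<omega> + b) - (?S T \<omega> + b)\<bar> = \<bar>\<Sum>a\<in>UNIV. block u a \<bullet> x a T \<omega>\<bar>"
          by (simp only: diff[symmetric] add_diff_add diff_self add_0_right)
        also have "\<dots> \<le> (\<Sum>a\<in>UNIV. \<bar>block u a \<bullet> x a T \<omega>\<bar>)" by (rule sum_abs)
        also have "\<dots> \<le> (\<Sum>a\<in>UNIV. norm (block u a) * (\<epsilon> / c))"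
        proof (rule sum_mono)
          fix a
          show "\<bar>block u a \<bullet> x a T \<omega>\<bar> \<le> norm (block u a) * (\<epsilon> / c)"
            using Cauchy_Schwarz_ineq2[of "block u a" "x a T \<omega>"] * mult_left_mono[of "norm (x a T \<omega>)" "\<epsilon> / c" "norm
                (block u a)"] by force
        qed
        also have "\<dots> = (c - 1) * (\<epsilon> / c)"
        proof -
          have "c - 1 = (\<Sum>a\<in>UNIV. norm (block u a))" by (simp add: c_def)
          then show ?thesis by (simp only: sum_distrib_right)
        qed
        also have "\<dots> \<le> c * (\<epsilon> / c)" using c \<epsilon> by (intro mult_right_mono) auto
        also have "\<dots> = \<epsilon>" using c by simp
        finally show "\<bar>(u \<bullet> Z T \<omega> + b) - (?S T \<omega> + b)\<bar> \<le> \<epsilon>" .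
      qed
    qed
    have "(\<lambda>T. expectation (\<lambda>\<omega>. cos (u \<bullet> Z T \<omega> + b)) - expectation (\<lambda>\<omega>. cos (?S T \<omega> + b))) \<longlonglongrightarrow> 0"
    proof (rule cos_expectation_close[OF _ _ close])
      show "eventually (\<lambda>T. (\<lambda>\<omega>. u \<bullet> Z T \<omega> + b) \<in> borel_measurable M) sequentially"
        by (rule eventually_mono[OF eventually_ge_at_top[of 1]]) (intro borel_measurable_add borel_measurable_inner
            borel_measurable_const ZM)
      have "incr ?v t \<in> borel_measurable M" if "t \<in> {1..T}" for t T
        by (rule measurable_from_subalg[OF subalgebra_F incr_F[OF that]])
      then show "eventually (\<lambda>T. (\<lambda>\<omega>. ?S T \<omega> + b) \<in> borel_measurable M) sequentially"
        by (intro always_eventually allI borel_measurable_add borel_measurable_divide borel_measurable_sum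
            borel_measurable_const)
    qed
    from tendsto_add[OF this incr_clt[of ?v b]]
    have "(\<lambda>T. expectation (\<lambda>\<omega>. cos (u \<bullet> Z T \<omega> + b))) \<longlonglongrightarrow> cos b * exp (- limit_variance ?v / 2)" by simp
    then show "(\<lambda>T. expectation (\<lambda>\<omega>. cos (u \<bullet> Z T \<omega> + b))) \<longlonglongrightarrow> (LINT z|N. cos (u \<bullet> z + b))"
      unfolding multivariate_normal_cos[OF N] covariance_quadratic .
  qed
  then show ?thesis by (simp add: Z_def[abs_def])
qed

end

theorem theorem3p3:
  fixes M :: "'w measure"
    and \<X> :: "(real^'p) set"
    and D :: "((real^'p) \<times> (real^'k)) measure"
    and X :: "nat \<Rightarrow> 'w \<Rightarrow> real^'p"
    and P :: "nat \<Rightarrow> 'w \<Rightarrow> real^'k"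
    and \<pi> :: "nat \<Rightarrow> 'w \<Rightarrow> real^'k"
    and A :: "nat \<Rightarrow> 'w \<Rightarrow> 'k"
    and Y :: "nat \<Rightarrow> 'w \<Rightarrow> real"
    and g :: "real^'p \<Rightarrow> real \<Rightarrow> real^'d \<Rightarrow> real^'d"
    and \<theta>s :: "'k \<Rightarrow> real^'d"
    and R\<theta> M2 \<pi>min :: real
    and \<pi>bar :: "real^'p \<Rightarrow> real^'k"
  assumes bandit: "contextual_bandit M \<X> D X P \<pi> A Y"
    and g_measurable:
      "\<And>\<theta>. (\<lambda>(x, y). g x y \<theta>) \<in> borel_measurable (restrict_space borel \<X> \<Otimes>\<^sub>M borel)"
    and target: "\<And>a. (LINT (x, y)|D. g x (y $ a) (\<theta>s a)) = 0"
    and A1_unconfounded: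
      "\<And>t. t \<ge> 1 \<Longrightarrow>
         cond_indep_var M (decision_algebra M X \<pi> A Y t) (count_space UNIV) (A t) borel (P t)"
    and A2_identified:
      "\<And>a \<epsilon>. \<epsilon> > 0 \<Longrightarrow>
         (INF \<theta>\<in>{\<theta>. norm (\<theta> - \<theta>s a) > \<epsilon>}. norm (LINT (x, y)|D. g x (y $ a) \<theta>)) > 0"
    and A3_i_cond_second_moment:
      "\<And>a. AE z in D. spectral_norm
         (cond_exp_matrix D (vimage_algebra (space D) fst (restrict_space borel \<X>))
            (\<lambda>(x, y). outer (g x (y $ a) (\<theta>s a))) z) \<le> M2"
    and A3_ii_radius: "\<And>a. norm (\<theta>s a) < R\<theta>"
    and A3_ii_second_moment:
      "\<And>a. (SUP \<theta>\<in>{\<theta>. norm \<theta> \<le> R\<theta>}. \<integral>\<^sup>+(x, y). ennreal ((norm (g x (y $ a) \<theta>))^2) \<partial>D) < \<infinity>"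
    and A3_iii_fourth_moment:
      "\<And>a. (\<integral>\<^sup>+(x, y). ennreal ((norm (g x (y $ a) (\<theta>s a)))^4) \<partial>D) < \<infinity>"
    and A4_i_twice_differentiable: "\<And>x y. x \<in> \<X> \<Longrightarrow> twice_differentiable (g x y)"
    and A4_i_nonsingular: "\<And>a. invertible (score_jacobian_mean D g \<theta>s a)"
    and A4_ii_jacobian_envelope:
      "\<And>a. \<exists>\<phi> :: real^'p \<Rightarrow> real \<Rightarrow> real.
         (\<forall>x\<in>\<X>. \<forall>y \<theta>. norm \<theta> \<le> R\<theta> \<longrightarrow> spectral_norm (jacobian (g x y) (at \<theta>)) \<le> \<phi> x y) \<and>
         integrable D (\<lambda>(x, y). (\<phi> x (y $ a))^2)"
    and A4_iii_hessian_envelope: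
      "\<And>a. \<exists>\<epsilon>0>0. \<exists>\<Phi> :: real^'p \<Rightarrow> real \<Rightarrow> real.
         (\<forall>x\<in>\<X>. \<forall>y \<theta> i. norm (\<theta> - \<theta>s a) \<le> \<epsilon>0 \<longrightarrow>
            spectral_norm (hessian (\<lambda>\<theta>'. g x y \<theta>' $ i) \<theta>) \<le> \<Phi> x y) \<and>
         integrable D (\<lambda>(x, y). \<Phi> x (y $ a))"
    and A5_overlap_const: "0 < \<pi>min" "\<pi>min < 1"
    and A5_overlap: "\<And>t a. t \<ge> 1 \<Longrightarrow> AE \<omega> in M. \<pi> t \<omega> $ a \<ge> \<pi>min"
    and limit_policy_measurable: "\<pi>bar \<in> borel_measurable (restrict_space borel \<X>)"
    and limit_policy_simplex: "\<And>x. x \<in> \<X> \<Longrightarrow> \<pi>bar x \<in> prob_simplex"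
    and policy_convergence:
      "\<And>a. tends_to_zero_in_prob M (\<lambda>t \<omega>. \<pi> t \<omega> $ a - \<pi>bar (X t \<omega>) $ a)"
  shows "(\<exists>\<theta>h. ipw_estimators M g R\<theta> X \<pi> A Y \<theta>h) \<and>
    (\<forall>\<theta>h. ipw_estimators M g R\<theta> X \<pi> A Y \<theta>h \<longrightarrow>
      (\<exists>N. multivariate_normal 0 (block_diag (asymptotic_covariance D g \<theta>s \<pi>bar)) N \<and>
        converges_in_distribution M
          (\<lambda>T \<omega>. sqrt (real T) *\<^sub>R (stack (\<lambda>a. \<theta>h a T \<omega>) - stack \<theta>s)) N))"
proof -
  interpret ipw_asymptotics M \<X> D X P \<pi> A Y \<pi>min g \<theta>s R\<theta> \<pi>bar
    by (intro ipw_asymptotics.intro ipw_estimation.intro overlap_bandit.intro bandit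
        overlap_bandit_axioms.intro ipw_estimation_axioms.intro ipw_asymptotics_axioms.intro) (fact assms)+
  \<comment> \<open>The covariance does not involve the estimators, so one law \<open>N\<close>
    serves all of them.\<close>
  obtain N where "multivariate_normal 0 (block_diag (asymptotic_covariance D g \<theta>s \<pi>bar)) N"
    by (rule limit_law_exists)
  then show ?thesis using estimators_exist estimators_asymptotically_normal by blast
qed

end
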